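(* Let $d\in\{1,2,3\}$ and let $\Omega$ be the $d$-dimensional torus identified with the unit cell $(0,1)^d$ with periodic boundary conditions; let $X=H^1(\Omega)$ (periodic $H^1$) with inner product $(u,v)_X=\int_\Omega uv+\int_\Omega\nabla u\cdot\nabla v$, let $f\in H^s(\Omega)$ for some $s\ge1$, and let $V\in H^{r_v}(\Omega)$ for some $r_v\ge2$ with $V\ge V_{\min}>0$. Let $u^*_{\rm src}\in X$ be the unique minimiser over $X$ of $$\mathcal{E}_{\rm src}(u)=\frac12\int_\Omega|\nabla u|^2+\frac12\int_\Omega V|u|^2+\frac14\int_\Omega|u|^4-\int_\Omega fu.$$ For $N\in\mathbb{N}$ let $X_N=\mathrm{span}\{e_{\mathbf G}:\mathbf G\in2\pi\mathbb{Z}^d,\ |\mathbf G|\le2\pi N\}$ where $e_{\mathbf G}(\mathbf x)=|\Omega|^{-1/2}e^{i\mathbf G\cdot\mathbf x}$, let $u^*_{N,\rm src}\in X_N$ be the unique minimiser of $\mathcal{E}_{\rm src}$ over $X_N$, and let $\Pi_N:X\to X_N$ be the $(\cdot,\cdot)_X$-orthogonal projection. Then $$\|\Pi_Nu^*_{\rm src}-u^*_{N,\rm src}\|_{L^2(\Omega)}+N^{-1}\|\Pi_Nu^*_{\rm src}-u^*_{N,\rm src}\|_{H^1(\Omega)}\lesssim N^{-3}\|\Pi_Nu^*_{\rm src}-u^*_{\rm src}\|_{H^1(\Omega)}.$$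
   Context: The notation $\lesssim$ means the inequality holds up to a constant independent of $N$ (for all $N$ sufficiently large). *)

theory Defs
  imports "HOL-Analysis.Analysis"
begin

text \<open>The torus is identified with the unit cell [0,1]^d (periodicity is implicit:
  a function on the torus is a function on the cell). Dimension d = CARD('d).\<close>

definition cell :: "(real^'d) set" where
  "cell = {x. \<forall>i. 0 \<le> x$i \<and> x$i \<le> 1}"

definition kvec :: "int^'d \<Rightarrow> real^'d" where
  "kvec k = (\<chi> i. of_int (k$i))"

text \<open>Fourier coefficient against e_G, G = 2 pi k (|Omega| = 1).\<close>
definition fcoef :: "(real^'d \<Rightarrow> real) \<Rightarrow> int^'d \<Rightarrow> complex" where
  "fcoef u k = (LINT x:cell|lborel. complex_of_real (u x) * cis (- (2 * pi * (kvec k \<bullet> x))))"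

definition L2fun :: "(real^'d \<Rightarrow> real) \<Rightarrow> bool" where
  "L2fun u \<longleftrightarrow> u \<in> borel_measurable borel \<and> set_integrable lborel cell (\<lambda>x. (u x)^2)"

definition Hs :: "real \<Rightarrow> (real^'d \<Rightarrow> real) \<Rightarrow> bool" where
  "Hs s u \<longleftrightarrow> L2fun u \<and>
     (\<lambda>k. (1 + (2*pi)^2 * (norm (kvec k))^2) powr s * (cmod (fcoef u k))^2) summable_on UNIV"

text \<open>int grad u . grad v, by Parseval.\<close>
definition grad_inner :: "(real^'d \<Rightarrow> real) \<Rightarrow> (real^'d \<Rightarrow> real) \<Rightarrow> real" where
  "grad_inner u v = (\<Sum>\<^sub>\<infinity>k. (2*pi)^2 * (norm (kvec k))^2 * Re (fcoef u k * cnj (fcoef v k)))"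

definition X_inner :: "(real^'d \<Rightarrow> real) \<Rightarrow> (real^'d \<Rightarrow> real) \<Rightarrow> real" where
  "X_inner u v = (LINT x:cell|lborel. u x * v x) + grad_inner u v"

definition L2norm :: "(real^'d \<Rightarrow> real) \<Rightarrow> real" where
  "L2norm u = sqrt (LINT x:cell|lborel. (u x)^2)"

definition H1norm :: "(real^'d \<Rightarrow> real) \<Rightarrow> real" where
  "H1norm u = sqrt (X_inner u u)"

definition XN :: "nat \<Rightarrow> (real^'d \<Rightarrow> real) set" where
  "XN N = {u. Hs 1 u \<and> (\<forall>k. norm (kvec k) > real N \<longrightarrow> fcoef u k = 0)}"

definition Esrc :: "(real^'d \<Rightarrow> real) \<Rightarrow> (real^'d \<Rightarrow> real) \<Rightarrow> (real^'d \<Rightarrow> real) \<Rightarrow> real" where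
  "Esrc V f u = grad_inner u u / 2 + (LINT x:cell|lborel. V x * (u x)^2) / 2
      + (LINT x:cell|lborel. (u x)^4) / 4 - (LINT x:cell|lborel. f x * u x)"

end

theory Submission
  imports Defs
begin

text \<open>
  Let \<open>p = \<Pi>\<^sub>N u\<close>, \<open>w = u - p\<close> and \<open>e = p - u\<^sub>N\<close>. Since the \<open>X\<close>-orthogonal projection is Fourier
  truncation, subtracting the two Euler-Lagrange equations gives, for all test functions \<open>v\<close> in \<open>X\<^sub>N\<close>,
  \<open>(\<nabla>e, \<nabla>v) + (W e, v) = - (w, g v)\<close> with \<open>W = V + p\<^sup>2 + p u\<^sub>N + u\<^sub>N\<^sup>2 \<ge> Vmin\<close> and
  \<open>g = V + u\<^sup>2 + u p + p\<^sup>2\<close>. As \<open>w\<close> only has frequencies above \<open>N\<close>, the right-hand side is at most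
  \<open>N\<^sup>-\<^sup>1\<^sup>-\<^sup>r \<parallel>w\<parallel>\<^sub>1 \<parallel>g v\<parallel>\<^sub>r\<close>, and multiplication by \<open>g \<in> H\<^sup>2\<close> is bounded on \<open>H\<^sup>1\<close> and \<open>H\<^sup>2\<close> for \<open>d \<le> 3\<close>.
  Taking \<open>r = 1\<close>, \<open>v = e\<close> yields the \<open>H\<^sup>1\<close> bound. It also bounds \<open>u\<^sub>N\<close> in \<open>H\<^sup>2\<close>, hence \<open>W\<close> by some \<open>\<mu>\<close>,
  uniformly in \<open>N\<close>; taking \<open>r = 2\<close>, \<open>v = (\<mu> - \<Delta>)\<^sup>-\<^sup>1 e\<close> then yields the \<open>L\<^sup>2\<close> bound.

  All Sobolev facts are proved on the Fourier side. The only arithmetic input is that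
  \<open>\<Sum>\<^sub>k (1 + |2\<pi>k|\<^sup>2)\<^sup>-\<^sup>s\<close> converges for \<open>s = 13/8 > 3/2\<close>; Cauchy-Schwarz on the convolution of the coefficients
  turns it into product estimates, from which \<open>H\<^sup>1 \<subseteq> L\<^sup>4\<close>, \<open>H\<^sup>2 \<subseteq> L\<^sup>\<infinity>\<close> and \<open>u \<in> H\<^sup>2\<close> follow.
\<close>

section \<open>Characters on the unit cell\<close>

text \<open>The cubic difference is split at p: u^3 - p^3 goes to the right-hand side, p^3 - u_N^3
  into W. So g contains only V, u and p, all bounded in H^2 independently of N, and u_N occurs only
  in W, whose lower bound needs no sign or size condition since a^2 + ab + b^2 is nonnegative. No
  convergence of u_N is presupposed, and the estimates hold for every N \<ge> 1.

  For the L^2 bound, duality with -\<Delta> + W would need H^2 regularity for a discrete problem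
  whose coefficient changes with N. A constant-coefficient resolvent is diagonal on characters: it
  maps X_N to itself and its H^2 bound is explicit. The price is a zeroth-order remainder, which is
  why W also has to be bounded above.

  The exponent 13/8 serves the regularity proof. If the lattice sum converges at \<sigma>, a product
  of L^2 and H^1 lies in H^(1-\<sigma>), so u is in H^(3-\<sigma>); with u^2 in H^(2-\<sigma>), the
  cube is in L^2 once 5 - 2\<sigma> \<ge> \<sigma>. Every \<sigma> with 3/2 < \<sigma> \<le> 5/3
  closes the argument in two steps.\<close>

definition cellM :: "(real^'d) measure" where
  "cellM = restrict_space lborel cell"

definition ee :: "int^'d \<Rightarrow> real^'d \<Rightarrow> complex" where
  "ee k x = cis (2 * pi * (kvec k \<bullet> x))"

lemma cell_eq_cbox: "(cell :: (real^'d) set) = cbox 0 1"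
  by (auto simp: cell_def mem_box_cart)

lemma cell_sets [measurable]: "(cell :: (real^'d) set) \<in> sets borel"
  by (simp add: cell_eq_cbox)

lemma space_cellM [simp]: "space cellM = cell"
  by (simp add: cellM_def space_restrict_space)

lemma borel_measurable_cellM:
  "f \<in> borel_measurable borel \<Longrightarrow> f \<in> borel_measurable cellM"
  unfolding cellM_def by (rule measurable_restrict_space1) simp

lemma set_integrable_cell:
  fixes f :: "real^'d \<Rightarrow> 'b::{banach, second_countable_topology}"
  shows "set_integrable lborel cell f \<longleftrightarrow> integrable cellM f"
  unfolding cellM_def set_integrable_def by (subst integrable_restrict_space) auto

lemma set_integral_cell:
  fixes f :: "real^'d \<Rightarrow> 'b::{banach, second_countable_topology}"
  shows "(LINT x:cell|lborel. f x) = integral\<^sup>L cellM f"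
  unfolding cellM_def set_lebesgue_integral_def by (subst integral_restrict_space) auto

lemma emeasure_cellM: "emeasure (cellM :: (real^'d) measure) (space cellM) = 1"
proof -
  have "emeasure lborel (cbox 0 (1::real^'d)) = (\<Prod>b\<in>Basis. (1::real^'d) \<bullet> b)"
    by (subst emeasure_lborel_cbox) (auto simp: Basis_vec_def inner_axis)
  also have "(\<Prod>b\<in>Basis. (1::real^'d) \<bullet> b) = 1"
    by (rule prod.neutral) (auto simp: Basis_vec_def inner_axis)
  finally show ?thesis
    unfolding space_cellM unfolding cellM_def
    by (subst emeasure_restrict_space) (auto simp: cell_eq_cbox)
qed

interpretation cellM: finite_measure "cellM :: (real^'d) measure"
  by (rule finite_measureI) (simp add: emeasure_cellM del: space_cellM)

lemma measure_cellM [simp]: "measure cellM cell = 1"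
  using emeasure_cellM by (simp add: measure_def)

lemma L2fun_iff: "L2fun u \<longleftrightarrow> u \<in> borel_measurable borel \<and> integrable cellM (\<lambda>x. (u x)\<^sup>2)"
  by (simp add: L2fun_def set_integrable_cell)

lemma fcoef_eq: "fcoef u k = (\<integral>x. complex_of_real (u x) * cnj (ee k x) \<partial>cellM)"
  by (simp add: fcoef_def set_integral_cell ee_def cis_cnj)

lemma L2norm_eq: "L2norm u = sqrt (\<integral>x. (u x)\<^sup>2 \<partial>cellM)"
  by (simp add: L2norm_def set_integral_cell)

lemma kvec_simps [simp]: "kvec 0 = 0" "kvec (j + k) = kvec j + kvec k" "kvec (- k) = - kvec k"
  "kvec (j - k) = kvec j - kvec k"
  by (simp_all add: kvec_def vec_eq_iff)

lemma ee_simps: "ee 0 x = 1" "ee (j + k) x = ee j x * ee k x" "ee (- k) x = cnj (ee k x)"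
  "cmod (ee k x) = 1"
  by (simp_all add: ee_def inner_add_left cis_mult cis_cnj distrib_left)

lemma ee_measurable [measurable]: "ee k \<in> borel_measurable borel"
  unfolding ee_def by (intro borel_measurable_continuous_onI continuous_intros)

lemma integral_cis_unit_interval:
  "(LBINT t. indicator {0..1} t *\<^sub>R cis (2 * pi * of_int n * t)) = (if n = 0 then 1 else 0)"
proof (cases "n = 0")
  case True
  have "(LBINT (t::real). indicator {0..1} t *\<^sub>R (1::complex)) = 1"
    by (subst integral_scaleR_left) auto
  then show ?thesis using True by simp
next
  case False
  let ?F = "\<lambda>t. cis (2 * pi * of_int n * t) / (2 * pi * of_int n * \<i>)"
  have "(?F has_vector_derivative cis (2 * pi * of_int n * t)) (at t within {0..1})" for t
  proof -
    have "((\<lambda>z. exp (\<i> * (2 * pi * of_int n) * z) / (2 * pi * of_int n * \<i>)) has_field_derivative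
        exp (\<i> * (2 * pi * of_int n) * of_real t)) (at (of_real t))"
      using False by (auto intro!: derivative_eq_intros)
    from has_vector_derivative_real_field[OF this]
    show ?thesis by (simp add: cis_conv_exp mult.assoc)
  qed
  then have "(LBINT t. indicator {0..1} t *\<^sub>R cis (2 * pi * of_int n * t)) = ?F 1 - ?F 0"
    by (intro integral_FTC_Icc) (auto intro!: continuous_intros)
  also have "\<dots> = 0"
    using cis_multiple_2pi[of "of_int n"] by (simp add: mult.commute mult.left_commute)
  finally show ?thesis using False by simp
qed

text \<open>The character factors over the coordinates and \<open>lborel\<close> is the image of a
  product measure, so Fubini reduces orthogonality to one dimension.\<close>

lemma integral_ee:
  fixes k :: "int^'d"
  shows "integral\<^sup>L cellM (ee k) = (if k = 0 then 1 else 0)"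
proof -
  interpret product_sigma_finite "\<lambda>_::real^'d. lborel :: real measure" ..
  \<comment> \<open>For a basis vector \<open>b\<close> the number \<open>kvec k \<bullet> b\<close>
    is an integer; \<open>floor\<close> only turns it into an \<open>int\<close>, as the
    one-dimensional integral expects. The indicator sits inside \<open>h\<close> so that the product
    over the basis also produces the indicator of the cell.\<close>
  define h :: "real^'d \<Rightarrow> real \<Rightarrow> complex"
    where "h b t = indicator {0..1} t *\<^sub>R cis (2 * pi * of_int (floor (kvec k \<bullet> b)) * t)" for b t
  have fl: "of_int (floor (kvec k \<bullet> b)) = kvec k \<bullet> b" if "b \<in> Basis" for b
    using that by (auto simp: Basis_vec_def inner_axis kvec_def)
  have intg: "integrable lborel (h b)" for b
    unfolding h_def
    by (intro borel_integrable_atLeastAtMost'[unfolded set_integrable_def] continuous_intros)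
  have m: "(\<lambda>x. indicator (cell :: (real^'d) set) x *\<^sub>R ee k x) \<in> borel_measurable borel"
    by measurable
  have prod: "indicator cell (\<Sum>b\<in>Basis. f b *\<^sub>R b) *\<^sub>R ee k (\<Sum>b\<in>Basis. f b *\<^sub>R b) = (\<Prod>b\<in>Basis. h b (f b))"
    for f
  proof -
    define x where "x = (\<Sum>b\<in>Basis. f b *\<^sub>R b)"
    have fb: "f b = x \<bullet> b" if "b \<in> Basis" for b
      using that by (simp add: x_def)
    have "(\<Prod>b\<in>Basis. h b (f b)) =
        (\<Prod>b\<in>Basis. of_real (indicator {0..1} (x \<bullet> b)) * cis (2 * pi * ((kvec k \<bullet> b) * (x \<bullet> b))))"
      by (intro prod.cong) (auto simp: h_def fl fb scaleR_conv_of_real mult.assoc)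
    also have "\<dots> = of_real (\<Prod>b\<in>Basis. indicator {0..1} (x \<bullet> b)) * (\<Prod>b\<in>Basis. cis (2 * pi * ((kvec k \<bullet> b) * (x \<bullet> b))))"
      by (simp add: prod.distrib)
    also have "(\<Prod>b\<in>Basis. indicator {0..1} (x \<bullet> b)) = (indicator cell x :: real)"
    proof (cases "x \<in> cell")
      case True
      then show ?thesis
        by (intro prod.neutral[THEN trans]) (auto simp: cell_def Basis_vec_def inner_axis)
    next
      case False
      then have "\<exists>b\<in>Basis. \<not> (0 \<le> x \<bullet> b \<and> x \<bullet> b \<le> 1)"
        by (auto simp: cell_def Basis_vec_def inner_axis)
      then show ?thesis
        using False by (auto simp: prod_zero_iff indicator_def)
    qed
    also have "(\<Prod>b\<in>Basis. cis (2 * pi * ((kvec k \<bullet> b) * (x \<bullet> b)))) = cis (\<Sum>b\<in>Basis. 2 * pi * ((kvec k \<bullet> b) * (x \<bullet> b)))"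
      by (simp add: cis_conv_exp exp_sum sum_distrib_left)
    also have "\<dots> = ee k x"
      unfolding ee_def by (subst (2) euclidean_inner) (simp add: sum_distrib_left)
    finally show ?thesis unfolding x_def by (simp add: scaleR_conv_of_real)
  qed
  have "integral\<^sup>L cellM (ee k) = (LBINT x. indicator (cell :: (real^'d) set) x *\<^sub>R ee k x)"
    unfolding cellM_def by (subst integral_restrict_space) auto
  also have "\<dots> = (\<integral>f. (\<Prod>b\<in>Basis. h b (f b)) \<partial>(\<Pi>\<^sub>M b\<in>Basis. lborel))"
    by (subst lborel_eq, subst integral_distr) (auto simp: prod m)
  also have "\<dots> = (\<Prod>b\<in>Basis. integral\<^sup>L lborel (h b))"
    by (intro product_integral_prod intg) auto
  also have "\<dots> = (\<Prod>b\<in>Basis. if floor (kvec k \<bullet> b) = 0 then 1 else 0)"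
    unfolding h_def by (simp only: integral_cis_unit_interval)
  also have "\<dots> = (if \<forall>b\<in>Basis. floor (kvec k \<bullet> b) = 0 then 1 else 0)"
    by (auto simp: prod_zero_iff)
  also have "(\<forall>b\<in>Basis. floor (kvec k \<bullet> b) = 0) \<longleftrightarrow> k = 0"
    by (auto simp: Basis_vec_def inner_axis kvec_def vec_eq_iff)
  finally show ?thesis .
qed

lemma cnj_ee_measurable [measurable]: "(\<lambda>x. cnj (ee k x)) \<in> borel_measurable borel"
  using ee_measurable[of "- k"] by (simp add: ee_simps(3)[abs_def])

lemma integrable_bounded_cellM:
  fixes h :: "real^'d \<Rightarrow> 'b::{banach, second_countable_topology}"
  assumes "h \<in> borel_measurable borel" "\<And>x. norm (h x) \<le> B"
  shows "integrable cellM h"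
  by (rule cellM.integrable_const_bound[where B = B])
     (use assms in \<open>auto intro!: borel_measurable_cellM\<close>)

section \<open>L^2 functions on the cell and linearity of Fourier coefficients\<close>

lemma L2funD [dest]:
  assumes "L2fun u"
  shows "u \<in> borel_measurable borel" "integrable cellM (\<lambda>x. (u x)\<^sup>2)"
  using assms by (auto simp: L2fun_iff)

lemma L2fun_mult_integrable:
  assumes "L2fun u" "L2fun v"
  shows "integrable cellM (\<lambda>x. u x * v x)"
proof (rule Bochner_Integration.integrable_bound)
  show "integrable cellM (\<lambda>x. (u x)\<^sup>2 + (v x)\<^sup>2)"
    using assms by auto
  have "\<bar>a * b\<bar> \<le> a\<^sup>2 + b\<^sup>2" for a b :: real
  proof -
    have "0 \<le> (\<bar>a\<bar> - \<bar>b\<bar>)\<^sup>2" by simp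
    then have "2 * \<bar>a * b\<bar> \<le> a\<^sup>2 + b\<^sup>2" by (simp add: power2_diff abs_mult)
    then show ?thesis by (smt (verit) zero_le_power2)
  qed
  then show "AE x in cellM. norm (u x * v x) \<le> norm ((u x)\<^sup>2 + (v x)\<^sup>2)"
    by (intro AE_I2) (simp add: order_trans[OF _ abs_ge_self])
  have [measurable]: "u \<in> borel_measurable borel" "v \<in> borel_measurable borel"
    using assms by auto
  show "(\<lambda>x. u x * v x) \<in> borel_measurable cellM"
    by (intro borel_measurable_cellM) measurable
qed

lemma L2fun_bounded:
  assumes "u \<in> borel_measurable borel" "\<And>x. \<bar>u x\<bar> \<le> B"
  shows "L2fun u"
  unfolding L2fun_iff
proof (intro conjI assms(1) integrable_bounded_cellM)
  show "norm ((u x)\<^sup>2) \<le> B\<^sup>2" for x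
    using power_mono[OF assms(2)[of x], of 2] by simp
  show "(\<lambda>x. (u x)\<^sup>2) \<in> borel_measurable borel"
    using assms(1) by measurable
qed

lemma L2fun_const [simp]: "L2fun (\<lambda>_. c)"
  by (rule L2fun_bounded[where B = "\<bar>c\<bar>"]) auto

lemma L2fun_integrable: "L2fun u \<Longrightarrow> integrable cellM u"
  using L2fun_mult_integrable[of u "\<lambda>_. 1"] by simp

lemma L2fun_add:
  assumes "L2fun u" "L2fun v" shows "L2fun (\<lambda>x. u x + v x)"
proof -
  have [measurable]: "u \<in> borel_measurable borel" "v \<in> borel_measurable borel"
    using assms by auto
  have "integrable cellM (\<lambda>x. (u x)\<^sup>2 + (v x)\<^sup>2 + 2 * (u x * v x))"
    by (intro Bochner_Integration.integrable_add integrable_mult_right L2funD assms L2fun_mult_integrable)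
  then show ?thesis
    by (auto simp: L2fun_iff power2_sum mult.assoc)
qed

lemma L2fun_cmult:
  assumes "L2fun u" shows "L2fun (\<lambda>x. c * u x)"
proof -
  have [measurable]: "u \<in> borel_measurable borel"
    using assms by auto
  show ?thesis using assms by (auto simp: L2fun_iff power_mult_distrib)
qed

lemma L2fun_diff:
  assumes "L2fun u" "L2fun v" shows "L2fun (\<lambda>x. u x - v x)"
  using L2fun_add[OF assms(1) L2fun_cmult[OF assms(2), of "-1"]] by simp

lemma fcoef_integrable:
  assumes "integrable cellM u"
  shows "integrable cellM (\<lambda>x. complex_of_real (u x) * cnj (ee k x))"
proof (rule Bochner_Integration.integrable_bound)
  show "integrable cellM u" by fact
  have "u \<in> borel_measurable cellM" using assms by auto
  moreover have "(\<lambda>x. cnj (ee k x)) \<in> borel_measurable cellM"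
    by (intro borel_measurable_cellM) measurable
  ultimately show "(\<lambda>x. complex_of_real (u x) * cnj (ee k x)) \<in> borel_measurable cellM"
    by measurable
qed (auto simp: norm_mult ee_simps)

lemma fcoef_add:
  assumes "integrable cellM u" "integrable cellM v"
  shows "fcoef (\<lambda>x. u x + v x) k = fcoef u k + fcoef v k"
  unfolding fcoef_eq using fcoef_integrable[OF assms(1), of k] fcoef_integrable[OF assms(2), of k]
  by (simp add: distrib_right)

lemma fcoef_cmult: "fcoef (\<lambda>x. c * u x) k = c * fcoef u k"
  unfolding fcoef_eq by (simp add: mult.assoc)

lemma fcoef_diff:
  assumes "integrable cellM u" "integrable cellM v"
  shows "fcoef (\<lambda>x. u x - v x) k = fcoef u k - fcoef v k"
  unfolding fcoef_eq using fcoef_integrable[OF assms(1), of k] fcoef_integrable[OF assms(2), of k]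
  by (simp add: left_diff_distrib)

lemma fcoef_uminus: "fcoef u (- k) = cnj (fcoef u k)"
  unfolding fcoef_eq by (subst Bochner_Integration.integral_cnj[symmetric]) (simp add: ee_simps)

text \<open>Multiplying by a character translates the frequency. \<open>fcoef\<close> takes real
  functions only, so the complex product has to enter as its real and imaginary parts. This shift is
  what turns Parseval's identity into the convolution formula for products.\<close>

lemma fcoef_ee_shift:
  assumes "L2fun v"
  shows "fcoef (\<lambda>x. v x * Re (ee m x)) k + \<i> * fcoef (\<lambda>x. v x * Im (ee m x)) k = fcoef v (k - m)"
    and "L2fun (\<lambda>x. v x * Re (ee m x))" "L2fun (\<lambda>x. v x * Im (ee m x))"
proof -
  have [measurable]: "v \<in> borel_measurable borel"
    using assms by auto
  have bd: "norm ((v x * c)\<^sup>2) \<le> norm ((v x)\<^sup>2)" if "\<bar>c\<bar> \<le> 1" for x c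
    using that by (simp add: power_mult_distrib mult_left_le abs_square_le_1)
  show 1: "L2fun (\<lambda>x. v x * Re (ee m x))"
    unfolding L2fun_iff
    by (safe, measurable)
       (rule Bochner_Integration.integrable_bound[OF L2funD(2)[OF assms]],
        auto intro!: borel_measurable_cellM bd simp: order_trans[OF abs_Re_le_cmod] ee_simps simp del: norm_power real_norm_def)
  show 2: "L2fun (\<lambda>x. v x * Im (ee m x))"
    unfolding L2fun_iff
    by (safe, measurable)
       (rule Bochner_Integration.integrable_bound[OF L2funD(2)[OF assms]],
        auto intro!: borel_measurable_cellM bd simp: order_trans[OF abs_Im_le_cmod] ee_simps simp del: norm_power real_norm_def)
  note i = fcoef_integrable[OF L2fun_integrable[OF 1], of k] fcoef_integrable[OF L2fun_integrable[OF 2], of k]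
  have "fcoef v (k - m) = (\<integral>x. complex_of_real (v x * Re (ee m x)) * cnj (ee k x) +
      \<i> * (complex_of_real (v x * Im (ee m x)) * cnj (ee k x)) \<partial>cellM)"
    unfolding fcoef_eq
  proof (rule Bochner_Integration.integral_cong[OF refl])
    fix x
    have "cnj (ee (k - m) x) = cnj (ee k x) * ee m x"
      using ee_simps(2)[of k "-m" x] by (simp add: ee_simps)
    also have "ee m x = Re (ee m x) + \<i> * Im (ee m x)"
      by (simp add: complex_eq)
    finally show "complex_of_real (v x) * cnj (ee (k - m) x) = complex_of_real (v x * Re (ee m x)) * cnj (ee k x) +
      \<i> * (complex_of_real (v x * Im (ee m x)) * cnj (ee k x))"
      by (simp add: algebra_simps)
  qed
  also have "\<dots> = fcoef (\<lambda>x. v x * Re (ee m x)) k + \<i> * fcoef (\<lambda>x. v x * Im (ee m x)) k"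
    unfolding fcoef_eq using i by (subst Bochner_Integration.integral_add) auto
  finally show "fcoef (\<lambda>x. v x * Re (ee m x)) k + \<i> * fcoef (\<lambda>x. v x * Im (ee m x)) k = fcoef v (k - m)" ..
qed

lemma integral_ee_cnj: "(\<integral>x. ee j x * cnj (ee k x) \<partial>cellM) = (if j = k then 1 else 0)"
  using integral_ee[of "j - k"] ee_simps(2)[of j "-k"]
  by (simp add: ee_simps cong: Bochner_Integration.integral_cong)

lemma integrable_ee: "integrable cellM (\<lambda>x. ee j x * cnj (ee k x))"
  by (rule integrable_bounded_cellM[where B = 1]) (auto simp: norm_mult ee_simps)

text \<open>Expanding the square against orthonormal characters isolates the choice of
  \<open>c\<close> in the last sum. Taking \<open>c = fcoef u\<close> gives Bessel's inequality, and
  dropping that sum shows that no other choice approximates better.\<close>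

lemma L2_distance_trig:
  assumes u: "L2fun u" and K: "finite K"
  shows "integrable cellM (\<lambda>x. (cmod (complex_of_real (u x) - (\<Sum>k\<in>K. c k * ee k x)))\<^sup>2)" (is ?A)
    and "(\<integral>x. (cmod (complex_of_real (u x) - (\<Sum>k\<in>K. c k * ee k x)))\<^sup>2 \<partial>cellM) =
      (\<integral>x. (u x)\<^sup>2 \<partial>cellM) - (\<Sum>k\<in>K. (cmod (fcoef u k))\<^sup>2) + (\<Sum>k\<in>K. (cmod (fcoef u k - c k))\<^sup>2)" (is ?B)
proof -
  define F where "F x = (\<Sum>k\<in>K. c k * ee k x)" for x
  have e: "complex_of_real ((cmod (complex_of_real (u x) - F x))\<^sup>2) =
     complex_of_real ((u x)\<^sup>2) - (\<Sum>k\<in>K. cnj (c k) * (complex_of_real (u x) * cnj (ee k x)))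
      - (\<Sum>k\<in>K. c k * cnj (complex_of_real (u x) * cnj (ee k x))) + (\<Sum>j\<in>K. \<Sum>k\<in>K. c j * cnj (c k) * (ee j x * cnj (ee k x)))" for x
  proof -
    have "complex_of_real ((cmod (complex_of_real (u x) - F x))\<^sup>2) = (complex_of_real (u x) - F x) * cnj (complex_of_real (u x) - F x)"
      by (simp only: complex_norm_square)
    also have "\<dots> = complex_of_real ((u x)\<^sup>2) - u x * cnj (F x) - u x * F x + F x * cnj (F x)"
      by (simp add: algebra_simps power2_eq_square)
    also have "F x * cnj (F x) = (\<Sum>j\<in>K. \<Sum>k\<in>K. c j * cnj (c k) * (ee j x * cnj (ee k x)))"
      unfolding F_def by (simp add: sum_product mult_ac)
    also have "u x * cnj (F x) = (\<Sum>k\<in>K. cnj (c k) * (complex_of_real (u x) * cnj (ee k x)))"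
      unfolding F_def by (simp add: sum_distrib_left mult_ac)
    also have "u x * F x = (\<Sum>k\<in>K. c k * cnj (complex_of_real (u x) * cnj (ee k x)))"
      unfolding F_def by (simp add: sum_distrib_left mult_ac)
    finally show ?thesis .
  qed
  have h1: "has_bochner_integral cellM (\<lambda>x. complex_of_real (u x) * cnj (ee k x)) (fcoef u k)" for k
    using fcoef_integrable[OF L2fun_integrable[OF u]] by (simp add: has_bochner_integral_iff fcoef_eq)
  have h2: "has_bochner_integral cellM (\<lambda>x. complex_of_real ((u x)\<^sup>2)) (complex_of_real (\<integral>x. (u x)\<^sup>2 \<partial>cellM))"
    using u by (intro has_bochner_integral_of_real) (auto simp: has_bochner_integral_iff)
  have h3: "has_bochner_integral cellM (\<lambda>x. cnj (complex_of_real (u x) * cnj (ee k x))) (cnj (fcoef u k))" for k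
    by (rule has_bochner_integral_cnj[OF h1])
  have h4: "has_bochner_integral cellM (\<lambda>x. ee j x * cnj (ee k x)) (if j = k then 1 else 0)" for j k
    by (simp only: has_bochner_integral_iff integrable_ee integral_ee_cnj)
  have H: "has_bochner_integral cellM (\<lambda>x. complex_of_real ((cmod (complex_of_real (u x) - F x))\<^sup>2))
     (complex_of_real (\<integral>x. (u x)\<^sup>2 \<partial>cellM) - (\<Sum>k\<in>K. cnj (c k) * fcoef u k)
      - (\<Sum>k\<in>K. c k * cnj (fcoef u k)) + (\<Sum>j\<in>K. \<Sum>k\<in>K. c j * cnj (c k) * (if j = k then 1 else 0)))"
    unfolding e
    by (intro has_bochner_integral_add has_bochner_integral_diff has_bochner_integral_sum
         has_bochner_integral_mult_right h1 h2 h3 h4)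
  then have "integrable cellM (\<lambda>x. complex_of_real ((cmod (complex_of_real (u x) - F x))\<^sup>2))"
    by (simp only: has_bochner_integral_iff)
  then show ?A unfolding F_def complex_of_real_integrable_eq .
  have "complex_of_real (\<integral>x. (cmod (complex_of_real (u x) - F x))\<^sup>2 \<partial>cellM) =
      (\<integral>x. complex_of_real ((cmod (complex_of_real (u x) - F x))\<^sup>2) \<partial>cellM)"
    by (rule integral_complex_of_real[symmetric])
  also have "\<dots> = complex_of_real (\<integral>x. (u x)\<^sup>2 \<partial>cellM) - (\<Sum>k\<in>K. cnj (c k) * fcoef u k)
      - (\<Sum>k\<in>K. c k * cnj (fcoef u k)) + (\<Sum>j\<in>K. \<Sum>k\<in>K. c j * cnj (c k) * (if j = k then 1 else 0))"
    using H by (simp only: has_bochner_integral_iff)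
  also have "(\<Sum>j\<in>K. \<Sum>k\<in>K. c j * cnj (c k) * (if j = k then 1 else 0)) = (\<Sum>j\<in>K. c j * cnj (c j))"
    using K by (simp add: if_distrib[of "\<lambda>z. _ * z"] cong: if_cong)
  finally have "complex_of_real (\<integral>x. (cmod (complex_of_real (u x) - F x))\<^sup>2 \<partial>cellM) =
     complex_of_real (\<integral>x. (u x)\<^sup>2 \<partial>cellM) - (\<Sum>k\<in>K. cnj (c k) * fcoef u k)
      - (\<Sum>k\<in>K. c k * cnj (fcoef u k)) + (\<Sum>j\<in>K. c j * cnj (c j))" .
  also have "\<dots> = complex_of_real ((\<integral>x. (u x)\<^sup>2 \<partial>cellM) - (\<Sum>k\<in>K. (cmod (fcoef u k))\<^sup>2) + (\<Sum>k\<in>K. (cmod (fcoef u k - c k))\<^sup>2))"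
    unfolding of_real_add of_real_diff of_real_sum complex_norm_square
    by (simp add: algebra_simps sum.distrib sum_subtractf)
  finally show ?B unfolding F_def of_real_eq_iff .
qed

section \<open>Density of trigonometric polynomials\<close>

text \<open>Adding one character at a time makes closure under products a double induction in which
  frequencies add up, with no bookkeeping of coefficient families.\<close>

inductive trigp :: "(real^'d \<Rightarrow> complex) \<Rightarrow> bool" where
  zero: "trigp (\<lambda>_. 0)"
| add: "trigp F \<Longrightarrow> trigp (\<lambda>x. F x + c * ee k x)"

lemma trigp_repr:
  assumes "trigp F"
  shows "\<exists>K c. finite K \<and> F = (\<lambda>x. \<Sum>k\<in>K. c k * ee k x)"
  using assms
proof induction
  case zero
  show ?case by (intro exI[of _ "{}"]) auto
next
  case (add F a m)
  then obtain K c where K: "finite K" "F = (\<lambda>x. \<Sum>k\<in>K. c k * ee k x)" by blast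
  let ?c = "\<lambda>j. (if j \<in> K then c j else 0) + (if j = m then a else 0)"
  have "F x + a * ee m x = (\<Sum>k\<in>insert m K. ?c k * ee k x)" for x
  proof -
    have "(\<Sum>k\<in>insert m K. ?c k * ee k x) =
        (\<Sum>k\<in>insert m K. if k \<in> K then c k * ee k x else 0) + (\<Sum>k\<in>insert m K. if k = m then a * ee k x else 0)"
      by (simp only: sum.distrib[symmetric]) (rule sum.cong, auto simp: algebra_simps)
    also have "(\<Sum>k\<in>insert m K. if k \<in> K then c k * ee k x else 0) = F x"
      using K by (subst sum.inter_restrict[symmetric]) (auto simp: insert_absorb intro!: sum.cong)
    also have "(\<Sum>k\<in>insert m K. if k = m then a * ee k x else 0) = a * ee m x"
      using K by simp
    finally show ?thesis by simp
  qed
  then show ?case using K(1) by (intro exI[of _ "insert m K"] exI[of _ ?c]) auto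
qed

lemma trigp_add:
  assumes "trigp F" "trigp G" shows "trigp (\<lambda>x. F x + G x)"
  using assms(2)
proof induction
  case (add G c k)
  then show ?case using trigp.add[OF add.IH, of c k] by (simp add: add.assoc)
qed (use assms in simp)

lemma trigp_mono: "trigp (\<lambda>x. c * ee k x)"
  using trigp.add[OF trigp.zero, of c k] by simp

lemma trigp_const: "trigp (\<lambda>x. c)"
  using trigp_mono[of c 0] by (simp add: ee_simps)

lemma trigp_mult:
  assumes "trigp F" "trigp G" shows "trigp (\<lambda>x. F x * G x)"
  using assms(2)
proof induction
  case zero
  show ?case using trigp.zero by simp
next
  case (add G c k)
  have "trigp (\<lambda>x. F x * (c * ee k x))"
    using assms(1)
  proof induction
    case zero
    show ?case using trigp.zero by simp
  next
    case (add F a m)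
    from trigp.add[OF add.IH, of "a * c" "m + k"] show ?case
      by (simp add: ee_simps algebra_simps)
  qed
  from trigp_add[OF add.IH this] show ?case by (simp add: distrib_left)
qed

lemma trigp_sum:
  assumes "finite I" "\<And>i. i \<in> I \<Longrightarrow> trigp (F i)" shows "trigp (\<lambda>x. \<Sum>i\<in>I. F i x)"
  using assms
proof (induction I rule: finite_induct)
  case empty
  then show ?case using trigp.zero by simp
next
  case (insert i I)
  then show ?case using trigp_add by auto
qed

text \<open>Glues opposite faces of the cell. Polynomials in the real and imaginary parts of the
  image coordinates pull back to trigonometric polynomials, so Stone-Weierstrass on the image yields
  periodic approximants.\<close>

definition torus_map :: "real^'d \<Rightarrow> complex^'d" where
  "torus_map x = (\<chi> i. cis (2 * pi * x $ i))"

lemma trigp_cos_sin: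
  fixes i :: "'d::finite"
  shows "trigp (\<lambda>x::real^'d. complex_of_real (cos (2 * pi * x $ i)))" "trigp (\<lambda>x::real^'d. complex_of_real (sin (2 * pi * x $ i)))"
proof -
  have e: "ee (axis i 1) x = cis (2 * pi * x $ i)" for x :: "real^'d"
  proof -
    have "kvec (axis i 1) = (axis i 1 :: real^'d)"
      by (simp add: kvec_def axis_def vec_eq_iff)
    then show ?thesis by (simp add: ee_def inner_axis' )
  qed
  have c: "complex_of_real (cos (2 * pi * x $ i)) = (1/2) * ee (axis i 1) x + (1/2) * ee (- axis i 1) x" for x :: "real^'d"
    unfolding ee_simps e by (simp add: complex_eq_iff)
  have s: "complex_of_real (sin (2 * pi * x $ i)) = (-\<i>/2) * ee (axis i 1) x + (\<i>/2) * ee (- axis i 1) x" for x :: "real^'d"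
    unfolding ee_simps e by (simp add: complex_eq_iff)
  show "trigp (\<lambda>x. complex_of_real (cos (2 * pi * x $ i)))"
    unfolding c by (intro trigp_add trigp_mono)
  show "trigp (\<lambda>x. complex_of_real (sin (2 * pi * x $ i)))"
    unfolding s by (intro trigp_add trigp_mono)
qed

lemma trigp_real_polynomial_function:
  fixes P :: "complex^'d \<Rightarrow> real"
  assumes "real_polynomial_function P"
  shows "trigp (\<lambda>x. complex_of_real (P (torus_map x)))"
  using assms
proof induction
  case (linear f)
  then interpret f: bounded_linear f .
  have t: "torus_map x = (\<Sum>i\<in>UNIV. cos (2 * pi * x $ i) *\<^sub>R axis i 1 + sin (2 * pi * x $ i) *\<^sub>R axis i \<i>)" for x :: "real^'d"
    by (simp add: torus_map_def vec_eq_iff axis_def if_distrib[of "\<lambda>z. _ *\<^sub>R z"] sum.distrib complex_eq_iff cong: if_cong)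
  have "complex_of_real (f (torus_map x)) = (\<Sum>i\<in>UNIV. of_real (cos (2 * pi * x $ i)) * of_real (f (axis i 1)) +
      of_real (sin (2 * pi * x $ i)) * of_real (f (axis i \<i>)))" for x
    unfolding t by (simp add: f.sum f.add f.scaleR)
  then show ?case
    by (auto intro!: trigp_sum trigp_add trigp_mult trigp_cos_sin trigp_const)
next
  case (const c)
  show ?case by (rule trigp_const)
next
  case (add f g)
  then show ?case by (simp add: trigp_add)
next
  case (mult f g)
  then show ?case by (simp add: trigp_mult)
qed

lemma cis_2pi_eq_unit_interval:
  assumes "cis (2 * pi * s) = cis (2 * pi * t)" "0 \<le> s" "s \<le> 1" "0 \<le> t" "t \<le> 1"
  shows "s = t \<or> (s \<in> {0,1} \<and> t \<in> {0,1})"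
proof -
  have "sin (2 * pi * s) = sin (2 * pi * t) \<and> cos (2 * pi * s) = cos (2 * pi * t)"
    using assms(1) by (simp add: complex_eq_iff)
  then obtain n :: int where n: "2 * pi * s = 2 * pi * t + 2 * pi * of_int n"
    by (auto simp: sin_cos_eq_iff)
  then have "s = t + of_int n" by (simp flip: distrib_left)
  moreover from this assms have "of_int n \<le> (1::real)" "of_int n \<ge> (-1::real)" by auto
  then have "n \<in> {-1, 0, 1}" by auto
  ultimately show ?thesis using assms by auto
qed

text \<open>Two distinct points of the cell with the same image both lie on faces, where
  \<open>g\<close> vanishes. Hence \<open>g\<close> descends to the compact image of
  \<open>torus_map\<close>, where polynomials are dense.\<close>

lemma trigp_uniform_approx:
  fixes g :: "real^'d \<Rightarrow> real"
  assumes g: "continuous_on cell g" and bd: "\<And>x i. x \<in> cell \<Longrightarrow> x $ i = 0 \<or> x $ i = 1 \<Longrightarrow> g x = 0"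
    and "\<epsilon> > 0"
  obtains F where "trigp F" "\<And>x. x \<in> cell \<Longrightarrow> cmod (complex_of_real (g x) - F x) < \<epsilon>"
proof -
  have cc: "compact (cell :: (real^'d) set)" by (simp add: cell_eq_cbox)
  have cE: "continuous_on A (torus_map :: real^'d \<Rightarrow> _)" for A
    unfolding torus_map_def by (intro continuous_intros)
  define G where "G y = g (inv_into cell torus_map y)" for y
  have gE: "g x = g y" if "x \<in> cell" "y \<in> cell" "torus_map x = torus_map y" for x y
  proof (cases "x = y")
    case False
    then obtain i where i: "x $ i \<noteq> y $ i" by (auto simp: vec_eq_iff)
    have "cis (2 * pi * x $ i) = cis (2 * pi * y $ i)"
      using that(3) by (simp add: torus_map_def vec_eq_iff)
    from cis_2pi_eq_unit_interval[OF this] i that(1,2) have "x $ i \<in> {0,1}" "y $ i \<in> {0,1}"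
      by (auto simp: cell_def)
    then show ?thesis using bd[of x i] bd[of y i] that by auto
  qed auto
  have GE: "G (torus_map x) = g x" if "x \<in> cell" for x
    unfolding G_def by (rule gE) (use that in \<open>auto intro: inv_into_into simp: f_inv_into_f\<close>)
  \<comment> \<open>A continuous map on a compact set sends closed sets to closed sets, so
    continuity passes to the quotient: the preimage of \<open>B\<close> under \<open>G\<close> is
    the image of the compact set on which \<open>g\<close> takes values in \<open>B\<close>.\<close>
  have "continuous_on (torus_map ` cell) G"
    unfolding continuous_on_closed_invariant
  proof safe
    fix B :: "real set" assume "closed B"
    then have "closed (cell \<inter> g -` B)"
      by (intro continuous_closed_preimage g) (auto simp: cell_eq_cbox)
    then have "compact (cell \<inter> g -` B)"
      using cc compact_Int_closed[of cell "cell \<inter> g -` B"] by simp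
    then have "closed (torus_map ` (cell \<inter> g -` B))"
      by (intro compact_imp_closed compact_continuous_image cE)
    moreover have "torus_map ` (cell \<inter> g -` B) \<inter> torus_map ` cell = G -` B \<inter> torus_map ` cell"
      using GE by auto
    ultimately show "\<exists>A. closed A \<and> A \<inter> torus_map ` cell = G -` B \<inter> torus_map ` cell"
      by blast
  qed
  then obtain P where P: "real_polynomial_function P" "\<And>y. y \<in> torus_map ` cell \<Longrightarrow> \<bar>G y - P y\<bar> < \<epsilon>"
    using Stone_Weierstrass_real_polynomial_function[of "torus_map ` (cell :: (real^'d) set)" G \<epsilon>]
      compact_continuous_image[OF cE cc] \<open>\<epsilon> > 0\<close> by blast
  show ?thesis
  proof (rule that[of "\<lambda>x. complex_of_real (P (torus_map x))"])
    show "trigp (\<lambda>x. complex_of_real (P (torus_map x)))"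
      by (rule trigp_real_polynomial_function[OF P(1)])
    show "cmod (complex_of_real (g x) - complex_of_real (P (torus_map x))) < \<epsilon>" if "x \<in> cell" for x
      using P(2)[of "torus_map x"] GE[OF that] that by (simp flip: of_real_diff)
  qed
qed

section \<open>From square-integrable to continuous functions vanishing on the faces\<close>

lemma AE_cellM_negligible:
  assumes "negligible N"
  shows "AE x in cellM. x \<notin> N"
proof -
  have "AE x in lebesgue. x \<notin> N"
    using assms by (intro AE_not_in) (simp add: negligible_iff_null_sets)
  then have "AE x in lborel. x \<notin> N" by (simp add: AE_completion_iff)
  then show ?thesis unfolding cellM_def by (auto simp: AE_restrict_space_iff elim: eventually_mono)
qed

lemma L2_bounded_continuous_approx:
  fixes u :: "real^'d \<Rightarrow> real"
  assumes u [measurable]: "u \<in> borel_measurable borel" and B: "\<And>x. \<bar>u x\<bar> \<le> B" and "\<epsilon> > 0"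
  obtains h where "continuous_on UNIV h"
    "\<And>x i. x \<in> cell \<Longrightarrow> x $ i = 0 \<or> x $ i = 1 \<Longrightarrow> h x = 0"
    "integrable cellM (\<lambda>x. (u x - h x)\<^sup>2)" "(\<integral>x. (u x - h x)\<^sup>2 \<partial>cellM) < \<epsilon>"
proof -
  have "u \<in> borel_measurable lebesgue"
    by (intro measurable_completion) simp
  then have "u measurable_on UNIV"
    by (intro lebesgue_measurable_imp_measurable_on) auto
  then obtain N g where N: "negligible N" and g: "\<And>n::nat. continuous_on UNIV (g n)"
    and lim: "\<And>x. x \<notin> N \<Longrightarrow> (\<lambda>n. g n x) \<longlonglongrightarrow> u x"
    unfolding measurable_on_def by auto
  have B0: "0 \<le> B" using B[of 0] by linarith
  \<comment> \<open>This cutoff vanishes on the faces and, at each interior point, equals 1 for all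
    large \<open>n\<close>, so convergence can fail because of it only on the negligible boundary.
    Clamping \<open>g n\<close> between \<open>- B\<close> and \<open>B\<close> supplies the
    constant for dominated convergence.\<close>
  define \<eta> where "\<eta> n x = min 1 (real n * (\<Prod>i\<in>UNIV. x $ i * (1 - x $ i)))" for n and x :: "real^'d"
  define h where "h n x = max (- B) (min B (g n x)) * \<eta> n x" for n x
  have ch: "continuous_on UNIV (h n)" for n
    unfolding h_def \<eta>_def by (intro continuous_intros g)
  have \<eta>01: "0 \<le> \<eta> n x \<and> \<eta> n x \<le> 1" if "x \<in> cell" for n x
    using that unfolding \<eta>_def cell_def by (auto intro!: mult_nonneg_nonneg prod_nonneg)
  have hb: "\<bar>h n x\<bar> \<le> B" if "x \<in> cell" for n x
  proof -
    have "\<bar>max (- B) (min B (g n x))\<bar> \<le> B" using B0 by auto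
    then have "\<bar>h n x\<bar> \<le> B * 1"
      unfolding h_def abs_mult using \<eta>01[OF that] B0 by (intro mult_mono) auto
    then show ?thesis by simp
  qed
  have h0: "h n x = 0" if "x \<in> cell" "x $ i = 0 \<or> x $ i = 1" for n x i
  proof -
    have "(\<Prod>i\<in>UNIV. x $ i * (1 - x $ i)) = 0"
      using that by (subst prod_zero_iff) auto
    then show ?thesis unfolding h_def \<eta>_def by (simp only:)
  qed
  have [measurable]: "h n \<in> borel_measurable borel" for n
    by (intro borel_measurable_continuous_onI ch)
  have bd: "norm ((u x - h n x)\<^sup>2) \<le> (2 * B)\<^sup>2" if "x \<in> cell" for n x
  proof -
    have "\<bar>u x - h n x\<bar> \<le> \<bar>2 * B\<bar>"
      using B[of x] hb[OF that, of n] by auto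
    then show ?thesis by (simp add: abs_le_square_iff)
  qed
  have meas: "(\<lambda>x. (u x - h n x)\<^sup>2) \<in> borel_measurable cellM" for n
    by (intro borel_measurable_cellM) measurable
  have int: "integrable cellM (\<lambda>x. (u x - h n x)\<^sup>2)" for n
    using meas by (intro cellM.integrable_const_bound[where B = "(2 * B)\<^sup>2"] AE_I2) (auto simp: bd[simplified])
  have conv: "(\<lambda>n. (u x - h n x)\<^sup>2) \<longlonglongrightarrow> 0" if "x \<notin> N" "x \<in> box 0 1" for x
  proof -
    have pos: "(\<Prod>i\<in>UNIV. x $ i * (1 - x $ i)) > 0"
      using that(2) by (intro prod_pos) (auto simp: mem_box_cart)
    then obtain n0 :: nat where n0: "1 / (\<Prod>i\<in>UNIV. x $ i * (1 - x $ i)) \<le> real n0"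
      using real_arch_simple by blast
    have "\<eta> n x = 1" if "n \<ge> n0" for n
    proof -
      have "1 \<le> real n0 * (\<Prod>i\<in>UNIV. x $ i * (1 - x $ i))"
        using n0 pos by (simp add: field_simps)
      also have "\<dots> \<le> real n * (\<Prod>i\<in>UNIV. x $ i * (1 - x $ i))"
        using that pos by (intro mult_right_mono) auto
      finally show ?thesis by (simp add: \<eta>_def)
    qed
    then have \<eta>: "(\<lambda>n. \<eta> n x) \<longlonglongrightarrow> 1"
      by (intro tendsto_eventually) (auto simp: eventually_sequentially)
    have "(\<lambda>n. (u x - h n x)\<^sup>2) \<longlonglongrightarrow> (u x - max (- B) (min B (u x)) * 1)\<^sup>2"
      unfolding h_def by (intro tendsto_intros \<eta> lim that)
    also have "max (- B) (min B (u x)) = u x"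
      using B[of x] by (auto simp: min_def max_def)
    finally show ?thesis by simp
  qed
  have "AE x in cellM. x \<notin> cbox 0 1 - box 0 (1::real^'d)"
    by (intro AE_cellM_negligible negligible_frontier_interval)
  then have AE: "AE x in cellM. (\<lambda>n. (u x - h n x)\<^sup>2) \<longlonglongrightarrow> 0"
    using AE_cellM_negligible[OF N] AE_space
    by eventually_elim (use conv in \<open>auto simp: cell_eq_cbox\<close>)
  have "(\<lambda>n. \<integral>x. (u x - h n x)\<^sup>2 \<partial>cellM) \<longlonglongrightarrow> (\<integral>x. 0 \<partial>(cellM :: (real^'d) measure))"
    by (rule integral_dominated_convergence[where w = "\<lambda>_. (2 * B)\<^sup>2"])
       (use meas AE bd in auto)
  then have "(\<lambda>n. \<integral>x. (u x - h n x)\<^sup>2 \<partial>cellM) \<longlonglongrightarrow> 0" by simp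
  from order_tendstoD(2)[OF this \<open>\<epsilon> > 0\<close>] obtain n where "(\<integral>x. (u x - h n x)\<^sup>2 \<partial>cellM) < \<epsilon>"
    by (auto simp: eventually_sequentially)
  then show ?thesis
    using ch h0 int by (intro that[of "h n"]) auto
qed

lemma L2_clamp_approx:
  fixes u :: "real^'d \<Rightarrow> real"
  assumes u: "L2fun u" and "\<epsilon> > 0"
  obtains B where "(\<integral>x. (u x - max (- B) (min B (u x)))\<^sup>2 \<partial>cellM) < \<epsilon>" "B \<ge> 0"
proof -
  have [measurable]: "u \<in> borel_measurable borel" using u by auto
  have "(\<lambda>n. \<integral>x. (u x - max (- real n) (min (real n) (u x)))\<^sup>2 \<partial>cellM) \<longlonglongrightarrow> (\<integral>x. 0 \<partial>(cellM :: (real^'d) measure))"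
  proof (rule integral_dominated_convergence[where w = "\<lambda>x. (u x)\<^sup>2"])
    show "(\<lambda>x. (u x - max (- real n) (min (real n) (u x)))\<^sup>2) \<in> borel_measurable cellM" for n
      by (intro borel_measurable_cellM) measurable
    show "AE x in cellM. (\<lambda>n. (u x - max (- real n) (min (real n) (u x)))\<^sup>2) \<longlonglongrightarrow> 0"
    proof (intro AE_I2 tendsto_eventually)
      fix x
      obtain n0 :: nat where "\<bar>u x\<bar> \<le> real n0" using real_arch_simple by blast
      then have "\<forall>n\<ge>n0. (u x - max (- real n) (min (real n) (u x)))\<^sup>2 = 0"
        by (auto simp: min_def max_def)
      then show "\<forall>\<^sub>F n in sequentially. (u x - max (- real n) (min (real n) (u x)))\<^sup>2 = 0"
        by (auto simp: eventually_sequentially)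
    qed
    show "AE x in cellM. norm ((u x - max (- real n) (min (real n) (u x)))\<^sup>2) \<le> (u x)\<^sup>2" for n
    proof (intro AE_I2)
      fix x
      have "\<bar>u x - max (- real n) (min (real n) (u x))\<bar> \<le> \<bar>u x\<bar>"
        by (auto simp: min_def max_def)
      then show "norm ((u x - max (- real n) (min (real n) (u x)))\<^sup>2) \<le> (u x)\<^sup>2"
        by (simp add: abs_le_square_iff)
    qed
  qed (use u in auto)
  then have "(\<lambda>n. \<integral>x. (u x - max (- real n) (min (real n) (u x)))\<^sup>2 \<partial>cellM) \<longlonglongrightarrow> 0" by simp
  from order_tendstoD(2)[OF this \<open>\<epsilon> > 0\<close>] obtain n :: nat where "(\<integral>x. (u x - max (- real n) (min (real n) (u x)))\<^sup>2 \<partial>cellM) < \<epsilon>"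
    by (auto simp: eventually_sequentially)
  then show ?thesis by (intro that[of "real n"]) auto
qed

lemma trigp_dense_L2:
  fixes u :: "real^'d \<Rightarrow> real"
  assumes u: "L2fun u" and "\<epsilon> > 0"
  obtains K c where "finite K" "(\<integral>x. (cmod (complex_of_real (u x) - (\<Sum>k\<in>K. c k * ee k x)))\<^sup>2 \<partial>cellM) < \<epsilon>"
proof -
  have um [measurable]: "u \<in> borel_measurable borel" using u by auto
  \<comment> \<open>The square of a sum of three errors is bounded below with factors 4, 4 and 2.
    Two errors under \<epsilon>/16 and a uniform one with square \<epsilon>/4 then add up to less
    than \<epsilon>.\<close>
  obtain B where B: "(\<integral>x. (u x - max (- B) (min B (u x)))\<^sup>2 \<partial>cellM) < \<epsilon> / 16" "B \<ge> 0"
    by (rule L2_clamp_approx[OF u, of "\<epsilon> / 16"]) (use \<open>\<epsilon> > 0\<close> in auto)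
  define v where "v x = max (- B) (min B (u x))" for x
  have vm [measurable]: "v \<in> borel_measurable borel" unfolding v_def by measurable
  have vb: "\<bar>v x\<bar> \<le> B" for x unfolding v_def using B(2) by auto
  have v2: "L2fun v" by (rule L2fun_bounded[OF vm vb])
  obtain h where h: "continuous_on UNIV h"
    "\<And>x i. x \<in> cell \<Longrightarrow> x $ i = 0 \<or> x $ i = 1 \<Longrightarrow> h x = 0"
    "integrable cellM (\<lambda>x. (v x - h x)\<^sup>2)" "(\<integral>x. (v x - h x)\<^sup>2 \<partial>cellM) < \<epsilon> / 16"
    by (rule L2_bounded_continuous_approx[OF vm vb, of "\<epsilon> / 16"]) (use \<open>\<epsilon> > 0\<close> in auto)
  define \<delta> where "\<delta> = sqrt (\<epsilon> / 4)"
  have \<delta>: "\<delta> > 0" "\<delta>\<^sup>2 = \<epsilon> / 4" using \<open>\<epsilon> > 0\<close> by (auto simp: \<delta>_def)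
  obtain F where F: "trigp F" "\<And>x. x \<in> cell \<Longrightarrow> cmod (complex_of_real (h x) - F x) < \<delta>"
    by (rule trigp_uniform_approx[OF continuous_on_subset[OF h(1) subset_UNIV] h(2) \<delta>(1)]) blast+
  obtain K c where K: "finite K" "F = (\<lambda>x. \<Sum>k\<in>K. c k * ee k x)" using trigp_repr[OF F(1)] by blast
  have "integrable cellM (\<lambda>x. (u x - v x)\<^sup>2)"
    using L2fun_diff[OF u v2] by auto
  note ints = this h(3)
  have "(\<integral>x. (cmod (complex_of_real (u x) - (\<Sum>k\<in>K. c k * ee k x)))\<^sup>2 \<partial>cellM) \<le>
     (\<integral>x. 4 * (u x - v x)\<^sup>2 + 4 * (v x - h x)\<^sup>2 + 2 * \<delta>\<^sup>2 \<partial>cellM)"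
  proof (rule integral_mono)
    show "integrable cellM (\<lambda>x. (cmod (complex_of_real (u x) - (\<Sum>k\<in>K. c k * ee k x)))\<^sup>2)"
      by (rule L2_distance_trig(1)[OF u K(1)])
    show "integrable cellM (\<lambda>x. 4 * (u x - v x)\<^sup>2 + 4 * (v x - h x)\<^sup>2 + 2 * \<delta>\<^sup>2)"
      using ints by simp
    fix x :: "real^'d" assume "x \<in> space cellM"
    then have x: "x \<in> cell" by simp
    let ?a = "\<bar>u x - v x\<bar>" and ?b = "\<bar>v x - h x\<bar>"
    have "cmod (complex_of_real (u x) - F x) \<le> cmod (complex_of_real (u x - v x)) + cmod (complex_of_real (v x - h x)) + cmod (complex_of_real (h x) - F x)"
      by (rule order_trans[OF _ add_right_mono[OF norm_triangle_ineq]], rule order_trans[OF _ norm_triangle_ineq]) simp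
    also have "\<dots> \<le> ?a + ?b + \<delta>"
      using F(2)[OF x] by (simp only: norm_of_real)
    finally have "(cmod (complex_of_real (u x) - F x))\<^sup>2 \<le> (?a + ?b + \<delta>)\<^sup>2"
      by (intro power_mono) auto
    also have "\<dots> \<le> 4 * ?a\<^sup>2 + 4 * ?b\<^sup>2 + 2 * \<delta>\<^sup>2"
    proof -
      have "0 \<le> (?a + ?b - \<delta>)\<^sup>2" "0 \<le> (?a - ?b)\<^sup>2" by simp_all
      then show ?thesis unfolding power2_eq_square by (simp add: algebra_simps)
    qed
    finally show "(cmod (complex_of_real (u x) - (\<Sum>k\<in>K. c k * ee k x)))\<^sup>2 \<le> 4 * (u x - v x)\<^sup>2 + 4 * (v x - h x)\<^sup>2 + 2 * \<delta>\<^sup>2"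
      by (simp add: K(2))
  qed
  also have "\<dots> = 4 * (\<integral>x. (u x - v x)\<^sup>2 \<partial>cellM) + 4 * (\<integral>x. (v x - h x)\<^sup>2 \<partial>cellM) + 2 * \<delta>\<^sup>2"
    using ints by simp
  also have "\<dots> < \<epsilon>"
    using B(1) h(4) \<delta>(2) unfolding v_def by simp
  finally show ?thesis using K(1) that by blast
qed

section \<open>Parseval's identity and Fourier coefficients of products\<close>

lemma summable_on_bounded:
  fixes g :: "'a \<Rightarrow> real"
  assumes "\<And>x. 0 \<le> g x" "\<And>F. finite F \<Longrightarrow> sum g F \<le> b"
  shows "g summable_on UNIV" "infsum g UNIV \<le> b"
proof -
  show "g summable_on UNIV"
    by (rule nonneg_bdd_above_summable_on) (use assms in \<open>auto intro!: bdd_aboveI[of _ b]\<close>)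
  then show "infsum g UNIV \<le> b"
    by (rule infsum_le_finite_sums) (use assms in auto)
qed

text \<open>Bessel's inequality gives one direction. Conversely, an approximation with squared error
  below \<epsilon> by characters from \<open>K\<close> leaves less than \<epsilon> of the integral
  outside \<open>K\<close>, because the Fourier coefficients do at least as well as the given
  ones.\<close>

lemma parseval:
  assumes u: "L2fun u"
  shows "((\<lambda>k. (cmod (fcoef u k))\<^sup>2) has_sum (\<integral>x. (u x)\<^sup>2 \<partial>cellM)) UNIV"
proof -
  let ?f = "\<lambda>k. (cmod (fcoef u k))\<^sup>2" and ?I = "\<integral>x. (u x)\<^sup>2 \<partial>cellM"
  have le: "sum ?f K \<le> ?I" if "finite K" for K
  proof -
    have "0 \<le> (\<integral>x. (cmod (complex_of_real (u x) - (\<Sum>k\<in>K. fcoef u k * ee k x)))\<^sup>2 \<partial>cellM)"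
      by (intro Bochner_Integration.integral_nonneg) auto
    then show ?thesis using L2_distance_trig(2)[OF u that, of "fcoef u"] by simp
  qed
  have s: "?f summable_on UNIV" and i: "infsum ?f UNIV \<le> ?I"
    using summable_on_bounded[of ?f ?I] le by auto
  have "?I \<le> infsum ?f UNIV"
  proof (rule field_le_epsilon)
    fix \<epsilon> :: real assume "\<epsilon> > 0"
    obtain K c where K: "finite K" "(\<integral>x. (cmod (complex_of_real (u x) - (\<Sum>k\<in>K. c k * ee k x)))\<^sup>2 \<partial>cellM) < \<epsilon>"
      by (rule trigp_dense_L2[OF u \<open>\<epsilon> > 0\<close>])
    have "0 \<le> (\<Sum>k\<in>K. (cmod (fcoef u k - c k))\<^sup>2)"
      by (intro sum_nonneg) auto
    with K L2_distance_trig(2)[OF u K(1), of c] have "?I - sum ?f K < \<epsilon>" by linarith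
    moreover have "sum ?f K \<le> infsum ?f UNIV"
      by (rule finite_sum_le_infsum[OF s K(1)]) auto
    ultimately show "?I \<le> infsum ?f UNIV + \<epsilon>" by linarith
  qed
  with i s show ?thesis by (simp add: has_sum_iff)
qed

lemma cmod_product_le: "cmod a * cmod b \<le> (cmod a)\<^sup>2 + (cmod b)\<^sup>2"
proof -
  have "0 \<le> cmod a * cmod b" by simp
  then show ?thesis using sum_squares_bound[of "cmod a" "cmod b"] unfolding mult.assoc by linarith
qed

text \<open>Polarisation of \<open>parseval\<close> yields the real parts. The imaginary parts are
  odd in the frequency, since coefficients of real functions are Hermitian, and therefore
  cancel.\<close>

lemma parseval_inner:
  fixes u v :: "real^'d \<Rightarrow> real"
  assumes u: "L2fun u" and v: "L2fun v"
  shows "((\<lambda>k. fcoef u k * cnj (fcoef v k)) has_sum complex_of_real (\<integral>x. u x * v x \<partial>cellM)) UNIV"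
proof -
  let ?p = "\<lambda>k. fcoef u k * cnj (fcoef v k)"
  note uv = L2fun_integrable[OF u] L2fun_integrable[OF v]
  have "((\<lambda>k. (1/4) * (cmod (fcoef (\<lambda>x. u x + v x) k))\<^sup>2 + (-1/4) * (cmod (fcoef (\<lambda>x. u x - v x) k))\<^sup>2) has_sum
      (1/4) * (\<integral>x. (u x + v x)\<^sup>2 \<partial>cellM) + (-1/4) * (\<integral>x. (u x - v x)\<^sup>2 \<partial>cellM)) UNIV"
    by (intro has_sum_add has_sum_cmult_right parseval L2fun_add L2fun_diff u v)
  also have "(\<lambda>k. (1/4) * (cmod (fcoef (\<lambda>x. u x + v x) k))\<^sup>2 + (-1/4) * (cmod (fcoef (\<lambda>x. u x - v x) k))\<^sup>2) = (\<lambda>k. Re (?p k))"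
    unfolding fcoef_add[OF uv] fcoef_diff[OF uv] cmod_power2 by (rule ext) (simp add: power2_eq_square field_simps)
  also have "(1/4) * (\<integral>x. (u x + v x)\<^sup>2 \<partial>cellM) + (-1/4) * (\<integral>x. (u x - v x)\<^sup>2 \<partial>cellM) =
      (\<integral>x. (1/4) * (u x + v x)\<^sup>2 + (-1/4) * (u x - v x)\<^sup>2 \<partial>cellM)"
    using L2funD(2)[OF L2fun_add[OF u v]] L2funD(2)[OF L2fun_diff[OF u v]] by simp
  also have "\<dots> = (\<integral>x. u x * v x \<partial>cellM)"
    by (intro Bochner_Integration.integral_cong) (auto simp: power2_eq_square field_simps)
  finally have Re: "((\<lambda>k. Re (?p k)) has_sum (\<integral>x. u x * v x \<partial>cellM)) UNIV" .
  \<comment> \<open>Cancellation alone would only show that \<open>infsum\<close> is 0, which it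
    also is by default for a divergent family; \<open>has_sum\<close> requires summability as
    well.\<close>
  have "(\<lambda>k. \<bar>Im (?p k)\<bar>) summable_on UNIV"
  proof (rule summable_on_comparison_test)
    show "(\<lambda>k. (cmod (fcoef u k))\<^sup>2 + (cmod (fcoef v k))\<^sup>2) summable_on UNIV"
      using parseval[OF u] parseval[OF v] by (intro summable_on_add) (auto simp: has_sum_iff)
    show "\<bar>Im (?p k)\<bar> \<le> (cmod (fcoef u k))\<^sup>2 + (cmod (fcoef v k))\<^sup>2" for k
      using abs_Im_le_cmod[of "?p k"] cmod_product_le[of "fcoef u k" "fcoef v k"] by (simp add: norm_mult)
  qed auto
  then have s: "(\<lambda>k. Im (?p k)) summable_on UNIV"
    using summable_on_iff_abs_summable_on_real[of "\<lambda>k. Im (?p k)" UNIV] by simp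
  have "(\<Sum>\<^sub>\<infinity>k. Im (?p k)) = (\<Sum>\<^sub>\<infinity>k. Im (?p (- k)))"
    by (rule infsum_reindex_bij_witness[of _ uminus uminus]) auto
  also have "\<dots> = (\<Sum>\<^sub>\<infinity>k. - Im (?p k))"
    by (simp add: fcoef_uminus mult.commute)
  also have "\<dots> = - (\<Sum>\<^sub>\<infinity>k. Im (?p k))"
    by (rule infsum_uminus)
  finally have Im: "((\<lambda>k. Im (?p k)) has_sum 0) UNIV"
    using s by (simp add: has_sum_iff)
  have "((\<lambda>k. of_real (Re (?p k)) + \<i> * of_real (Im (?p k))) has_sum
      complex_of_real (\<integral>x. u x * v x \<partial>cellM) + \<i> * of_real 0) UNIV"
    by (intro has_sum_add has_sum_cmult_right has_sum_of_real Re Im)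
  then show ?thesis by (simp only: complex_eq[symmetric] of_real_0 mult_zero_right add_0_right)
qed

text \<open>Coefficient \<open>m\<close> of the product is the pairing of \<open>u\<close> with
  \<open>v\<close> times a conjugate character, to which Parseval and the frequency shift apply.
  Only square integrability of both factors enters; the product itself may fail to be in
  L^2.\<close>

lemma fcoef_mult:
  assumes u: "L2fun u" and v: "L2fun v"
  shows "((\<lambda>j. fcoef u j * fcoef v (m - j)) has_sum fcoef (\<lambda>x. u x * v x) m) UNIV"
proof -
  let ?R = "\<lambda>x. v x * Re (ee m x)" and ?I = "\<lambda>x. v x * Im (ee m x)"
  note sh = fcoef_ee_shift[OF v, of m]
  have int: "integrable cellM (\<lambda>x. u x * ?R x)" "integrable cellM (\<lambda>x. u x * ?I x)"
    by (intro L2fun_mult_integrable u sh(2,3))+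
  have "((\<lambda>j. fcoef u j * cnj (fcoef ?R j) + (-\<i>) * (fcoef u j * cnj (fcoef ?I j))) has_sum
     complex_of_real (\<integral>x. u x * ?R x \<partial>cellM) + (-\<i>) * complex_of_real (\<integral>x. u x * ?I x \<partial>cellM)) UNIV"
    by (intro has_sum_add has_sum_cmult_right parseval_inner u sh(2,3))
  also have "(\<lambda>j. fcoef u j * cnj (fcoef ?R j) + (-\<i>) * (fcoef u j * cnj (fcoef ?I j))) = (\<lambda>j. fcoef u j * fcoef v (m - j))"
  proof
    fix j
    have "fcoef v (m - j) = cnj (fcoef v (j - m))"
      using fcoef_uminus[of v "j - m"] by simp
    also have "\<dots> = cnj (fcoef ?R j + \<i> * fcoef ?I j)" by (simp only: sh(1))
    finally show "fcoef u j * cnj (fcoef ?R j) + (-\<i>) * (fcoef u j * cnj (fcoef ?I j)) = fcoef u j * fcoef v (m - j)"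
      by (simp only: complex_cnj_add complex_cnj_mult complex_cnj_i) (simp add: algebra_simps)
  qed
  also have "complex_of_real (\<integral>x. u x * ?R x \<partial>cellM) + (-\<i>) * complex_of_real (\<integral>x. u x * ?I x \<partial>cellM) =
     (\<integral>x. complex_of_real (u x * ?R x) + (-\<i>) * complex_of_real (u x * ?I x) \<partial>cellM)"
    by (subst Bochner_Integration.integral_add)
       (use int in \<open>auto intro!: integrable_mult_right integrable_of_real simp del: of_real_mult\<close>)
  also have "\<dots> = fcoef (\<lambda>x. u x * v x) m"
    unfolding fcoef_eq
    by (intro Bochner_Integration.integral_cong) (auto simp: complex_eq_iff)
  finally show ?thesis .
qed

section \<open>Sobolev weights and the convergent lattice sum\<close>

definition wt :: "int^'d \<Rightarrow> real" where
  "wt k = 1 + (2 * pi)\<^sup>2 * (norm (kvec k))\<^sup>2"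

text \<open>This is the squared norm of H^s. It carries information only for functions in
  \<open>Hs s\<close>, because \<open>infsum\<close> is 0 on a divergent series.\<close>

definition sob :: "real \<Rightarrow> (real^'d \<Rightarrow> real) \<Rightarrow> real" where
  "sob s u = (\<Sum>\<^sub>\<infinity>k. wt k powr s * (cmod (fcoef u k))\<^sup>2)"

lemma Hs_iff: "Hs s u \<longleftrightarrow> L2fun u \<and> (\<lambda>k. wt k powr s * (cmod (fcoef u k))\<^sup>2) summable_on UNIV"
  by (simp add: Hs_def wt_def)

lemma wt_ge1: "1 \<le> wt k" by (simp add: wt_def)

lemma wt_pos: "0 < wt k" using wt_ge1[of k] by linarith

text \<open>One factor 2 comes from |a + b|^2 \<le> 2|a|^2 + 2|b|^2, the other from bounding a sum
  by twice its maximum. The maximum allows the weight of the output frequency to be charged to a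
  single factor of a product.\<close>

lemma wt_le_max: "wt k \<le> 4 * max (wt j) (wt (k - j))"
proof -
  have "norm (kvec k) \<le> norm (kvec j) + norm (kvec (k - j))"
    using norm_triangle_ineq[of "kvec j" "kvec (k - j)"] by simp
  then have "(norm (kvec k))\<^sup>2 \<le> (norm (kvec j) + norm (kvec (k - j)))\<^sup>2"
    by (intro power_mono) auto
  also have "\<dots> \<le> 2 * (norm (kvec j))\<^sup>2 + 2 * (norm (kvec (k - j)))\<^sup>2"
    using sum_squares_bound[of "norm (kvec j)" "norm (kvec (k - j))"] by (simp add: power2_sum)
  finally have "(2*pi)\<^sup>2 * (norm (kvec k))\<^sup>2 \<le> (2*pi)\<^sup>2 * (2 * (norm (kvec j))\<^sup>2 + 2 * (norm (kvec (k - j)))\<^sup>2)"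
    by (intro mult_left_mono) auto
  then have "wt k \<le> 2 * (wt j + wt (k - j))"
    by (simp add: wt_def algebra_simps)
  then show ?thesis by (auto simp: max_def)
qed

text \<open>13/24 is a third of 13/8, one share for each of at most three coordinates. The terms
  decay like |m|^(-13/12), just fast enough to be summable.\<close>

lemma sum_one_dim_weight_bounded:
  obtains D where "\<And>n::nat. (\<Sum>m\<in>{- int n..int n}. (1 + (real_of_int m)\<^sup>2) powr (-13/24)) \<le> D" "D \<ge> 0"
proof -
  let ?g = "\<lambda>m::int. (1 + (real_of_int m)\<^sup>2) powr (-13/24)"
  have s: "summable (\<lambda>n. ?g (int n))"
  proof (rule summable_comparison_test_ev)
    show "summable (\<lambda>n. real n powr (-13/12))"
      by (subst summable_real_powr_iff) auto
    show "\<forall>\<^sub>F n in sequentially. norm (?g (int n)) \<le> real n powr (-13/12)"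
    proof (rule eventually_sequentiallyI[of 1])
      fix n :: nat assume n: "1 \<le> n"
      have "?g (int n) \<le> ((real n)\<^sup>2) powr (-13/24)"
        using n by (intro powr_mono2') auto
      also have "\<dots> = real n powr (-13/12)"
        using n by (simp add: powr_powr flip: powr_numeral)
      finally show "norm (?g (int n)) \<le> real n powr (-13/12)" by simp
    qed
  qed
  define T where "T = (\<Sum>n. ?g (int n))"
  have T0: "T \<ge> 0" unfolding T_def by (rule suminf_nonneg[OF s]) auto
  show ?thesis
  proof (rule that[of "2 * T"])
    fix n :: nat
    have le: "(\<Sum>i\<le>n. ?g (int i)) \<le> T"
      unfolding T_def by (rule sum_le_suminf[OF s]) auto
    have "sum ?g {- int n..int n} \<le> sum ?g (int ` {..n} \<union> (\<lambda>i. - int i) ` {..n})"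
    proof (rule sum_mono2)
      show "{- int n..int n} \<subseteq> int ` {..n} \<union> (\<lambda>i. - int i) ` {..n}"
      proof
        fix m assume "m \<in> {- int n..int n}"
        then show "m \<in> int ` {..n} \<union> (\<lambda>i. - int i) ` {..n}"
          by (cases m rule: int_cases2) auto
      qed
    qed auto
    also have "\<dots> \<le> sum ?g (int ` {..n}) + sum ?g ((\<lambda>i. - int i) ` {..n})"
      by (subst sum_Un) (auto intro!: sum_nonneg)
    also have "\<dots> = (\<Sum>i\<le>n. ?g (int i)) + (\<Sum>i\<le>n. ?g (int i))"
      by (subst (1 2) sum.reindex) (auto simp: inj_on_def)
    finally show "sum ?g {- int n..int n} \<le> 2 * T" using le by simp
  qed (use T0 in simp)
qed

lemma finite_int_box: "finite {k :: int^'d. \<forall>i. k $ i \<in> {- int n..int n}}" (is "finite ?X")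
proof -
  have "?X \<subseteq> vec_lambda ` (PiE UNIV (\<lambda>_::'d. {- int n..int n}))"
  proof
    fix k assume "k \<in> ?X"
    then show "k \<in> vec_lambda ` (PiE UNIV (\<lambda>_::'d. {- int n..int n}))"
      by (intro image_eqI[of _ _ "\<lambda>i. k $ i"]) auto
  qed
  then show ?thesis by (rule finite_subset) (auto intro!: finite_PiE)
qed

text \<open>Each factor 1 + k_i^2 is at most \<open>wt k\<close>, so their product over at most
  three coordinates is at most \<open>wt k ^ 3\<close>. With a negative exponent this bounds the
  weight by a product of one-dimensional terms, whose sum over a box factors.\<close>

lemma weight_summable:
  assumes dim: "CARD('d) \<le> 3"
  shows "(\<lambda>k::int^'d. wt k powr (-13/8)) summable_on UNIV"
proof -
  let ?g = "\<lambda>m::int. (1 + (real_of_int m)\<^sup>2) powr (-13/24)"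
  obtain D where D: "\<And>n::nat. (\<Sum>m\<in>{- int n..int n}. ?g m) \<le> D" "D \<ge> 0"
    using sum_one_dim_weight_bounded by blast
  have le: "wt k powr (-13/8) \<le> (\<Prod>i\<in>UNIV. ?g (k $ i))" for k :: "int^'d"
  proof -
    have c: "1 + (real_of_int (k $ i))\<^sup>2 \<le> wt k" for i
    proof -
      have "\<bar>real_of_int (k $ i)\<bar> \<le> norm (kvec k)"
        using component_le_norm_cart[of "kvec k" i] by (simp add: kvec_def)
      then have "(real_of_int (k $ i))\<^sup>2 \<le> (norm (kvec k))\<^sup>2"
        using power_mono[of "\<bar>real_of_int (k $ i)\<bar>" "norm (kvec k)" 2] by simp
      also have "\<dots> \<le> (2*pi)\<^sup>2 * (norm (kvec k))\<^sup>2"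
      proof -
        have "1 \<le> 2 * pi" using pi_ge_two by linarith
        then have "1 \<le> (2 * pi)\<^sup>2" by (rule one_le_power)
        then show ?thesis using mult_right_mono[of 1 "(2*pi)\<^sup>2" "(norm (kvec k))\<^sup>2"] by simp
      qed
      finally show ?thesis by (simp add: wt_def)
    qed
    have "(\<Prod>i\<in>UNIV. 1 + (real_of_int (k $ i))\<^sup>2) \<le> (\<Prod>i\<in>(UNIV::'d set). wt k)"
      by (intro prod_mono) (use c in \<open>auto simp: add_nonneg_nonneg\<close>)
    also have "\<dots> \<le> wt k ^ 3"
      using power_increasing[OF dim wt_ge1[of k]] by simp
    finally have p: "(\<Prod>i\<in>UNIV. 1 + (real_of_int (k $ i))\<^sup>2) \<le> wt k ^ 3" .
    have pos: "0 < 1 + (real_of_int (k $ i))\<^sup>2" for i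
      by (simp add: add_pos_nonneg)
    have "wt k powr (-13/8) = (wt k ^ 3) powr (-13/24)"
      using wt_pos[of k] by (simp add: powr_powr flip: powr_numeral)
    also have "\<dots> \<le> (\<Prod>i\<in>UNIV. 1 + (real_of_int (k $ i))\<^sup>2) powr (-13/24)"
      using p by (intro powr_mono2') (auto intro!: prod_pos pos)
    also have "\<dots> = (\<Prod>i\<in>UNIV. ?g (k $ i))"
      by (rule prod_powr_distrib)
    finally show ?thesis .
  qed
  show ?thesis
  proof (rule summable_on_bounded(1)[where b = "D ^ CARD('d)"])
    fix F :: "(int^'d) set" assume F: "finite F"
    define n where "n = nat (\<Sum>k\<in>F. \<Sum>i\<in>UNIV. \<bar>k $ i\<bar>)"
    have n: "\<bar>k $ i\<bar> \<le> int n" if "k \<in> F" for k i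
    proof -
      have "\<bar>k $ i\<bar> \<le> (\<Sum>i\<in>UNIV. \<bar>k $ i\<bar>)"
        by (rule member_le_sum) auto
      also have "\<dots> \<le> (\<Sum>k\<in>F. \<Sum>i\<in>UNIV. \<bar>k $ i\<bar>)"
        by (rule member_le_sum[where f = "\<lambda>k. \<Sum>i\<in>UNIV. \<bar>k $ i\<bar>"]) (use that F in \<open>auto intro: sum_nonneg\<close>)
      finally show ?thesis unfolding n_def by linarith
    qed
    let ?X = "{k :: int^'d. \<forall>i. k $ i \<in> {- int n..int n}}"
    have bij: "(\<Sum>g\<in>PiE UNIV (\<lambda>_::'d. {- int n..int n}). \<Prod>i\<in>UNIV. ?g (g i)) = (\<Sum>k\<in>?X. \<Prod>i\<in>UNIV. ?g (k $ i))"
      by (rule sum.reindex_bij_witness[of _ "\<lambda>k i. k $ i" "vec_lambda"]) auto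
    note fin = finite_int_box[of n, where 'd = 'd]
    have "(\<Sum>k\<in>F. wt k powr (-13/8)) \<le> (\<Sum>k\<in>?X. \<Prod>i\<in>UNIV. ?g (k $ i))"
    proof (rule order_trans[OF sum_mono[OF le] sum_mono2[OF fin]])
      show "F \<subseteq> ?X"
      proof clarify
        fix k i assume "k \<in> F"
        from n[OF this, of i] show "k $ i \<in> {- int n..int n}" by auto
      qed
    qed (auto intro!: prod_nonneg)
    also have "\<dots> = (\<Prod>i\<in>(UNIV::'d set). \<Sum>m\<in>{- int n..int n}. ?g m)"
      unfolding bij[symmetric] by (rule prod_sum_PiE[symmetric]) auto
    also have "\<dots> \<le> (\<Prod>i\<in>(UNIV::'d set). D)"
      by (intro prod_mono) (use D(1)[of n] in \<open>auto intro!: sum_nonneg\<close>)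
    finally show "(\<Sum>k\<in>F. wt k powr (-13/8)) \<le> D ^ CARD('d)" by simp
  qed auto
qed

section \<open>Products in Sobolev spaces\<close>

lemma infsum_Cauchy_Schwarz:
  fixes x y :: "'a \<Rightarrow> real"
  assumes nn: "\<And>j. 0 \<le> x j" "\<And>j. 0 \<le> y j"
    and X: "(\<lambda>j. (x j)\<^sup>2) summable_on UNIV" and Y: "(\<lambda>j. (y j)\<^sup>2) summable_on UNIV"
  shows "(\<lambda>j. x j * y j) summable_on UNIV"
    and "(\<Sum>\<^sub>\<infinity>j. x j * y j)\<^sup>2 \<le> (\<Sum>\<^sub>\<infinity>j. (x j)\<^sup>2) * (\<Sum>\<^sub>\<infinity>j. (y j)\<^sup>2)"
proof -
  let ?P = "(\<Sum>\<^sub>\<infinity>j. (x j)\<^sup>2) * (\<Sum>\<^sub>\<infinity>j. (y j)\<^sup>2)"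
  have P0: "0 \<le> ?P" by (intro mult_nonneg_nonneg infsum_nonneg) auto
  have fin: "(\<Sum>j\<in>F. x j * y j) \<le> sqrt ?P" if "finite F" for F
  proof (rule real_le_rsqrt)
    have "(\<Sum>j\<in>F. x j * y j)\<^sup>2 \<le> (\<Sum>j\<in>F. (x j)\<^sup>2) * (\<Sum>j\<in>F. (y j)\<^sup>2)"
      by (rule Cauchy_Schwarz_ineq_sum)
    also have "\<dots> \<le> ?P"
      by (intro mult_mono finite_sum_le_infsum X Y that infsum_nonneg) (auto intro: sum_nonneg)
    finally show "(\<Sum>j\<in>F. x j * y j)\<^sup>2 \<le> ?P" .
  qed
  show "(\<lambda>j. x j * y j) summable_on UNIV"
    by (rule summable_on_bounded(1)[OF _ fin]) (auto simp: nn)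
  have "(\<Sum>\<^sub>\<infinity>j. x j * y j) \<le> sqrt ?P"
    by (rule summable_on_bounded(2)[OF _ fin]) (auto simp: nn)
  then have "(\<Sum>\<^sub>\<infinity>j. x j * y j)\<^sup>2 \<le> (sqrt ?P)\<^sup>2"
    by (intro power_mono infsum_nonneg) (auto simp: nn)
  then show "(\<Sum>\<^sub>\<infinity>j. x j * y j)\<^sup>2 \<le> ?P" using P0 by simp
qed

lemma infsum_finite_sum_swap:
  fixes g :: "'a \<Rightarrow> 'b \<Rightarrow> real"
  assumes "finite F" "\<And>m. m \<in> F \<Longrightarrow> g m summable_on UNIV"
  shows "((\<lambda>j. \<Sum>m\<in>F. g m j) has_sum (\<Sum>m\<in>F. infsum (g m) UNIV)) UNIV"
  using assms
proof (induction F rule: finite_induct)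
  case empty
  then show ?case by simp
next
  case (insert m F)
  then show ?case by (auto intro!: has_sum_add)
qed

lemma summable_on_reflect:
  fixes B :: "'a::ab_group_add \<Rightarrow> real"
  assumes "B summable_on UNIV"
  shows "(\<lambda>j. B (m - j)) summable_on UNIV" "(\<Sum>\<^sub>\<infinity>j. B (m - j)) = infsum B UNIV"
proof -
  have bij: "bij_betw (\<lambda>j. m - j) UNIV UNIV"
    by (rule bij_betwI[of _ _ _ "\<lambda>j. m - j"]) auto
  show "(\<lambda>j. B (m - j)) summable_on UNIV"
    using summable_on_reindex_bij_betw[OF bij, of B] assms by simp
  show "(\<Sum>\<^sub>\<infinity>j. B (m - j)) = infsum B UNIV"
    using infsum_reindex_bij_betw[OF bij, of B] by simp
qed

text \<open>Young's inequality for the convolution of two l^1 families. Restricting the outer sum to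
  a finite set means that only a finite sum is exchanged with an infinite one.\<close>

lemma convolution_sum_le:
  fixes A B :: "'a::ab_group_add \<Rightarrow> real"
  assumes nn: "\<And>j. 0 \<le> A j" "\<And>j. 0 \<le> B j"
    and A: "A summable_on UNIV" and B: "B summable_on UNIV"
  shows "(\<lambda>j. A j * B (m - j)) summable_on UNIV"
    and "finite F \<Longrightarrow> (\<Sum>m\<in>F. \<Sum>\<^sub>\<infinity>j. A j * B (m - j)) \<le> infsum A UNIV * infsum B UNIV"
proof -
  have B1: "B k \<le> infsum B UNIV" for k
    using finite_sum_le_infsum[OF B, of "{k}"] nn by simp
  show s: "(\<lambda>j. A j * B (m - j)) summable_on UNIV" for m
    by (rule summable_on_comparison_test[OF summable_on_cmult_left[OF A, of "infsum B UNIV"]])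
       (auto intro!: mult_left_mono mult_nonneg_nonneg nn B1)
  assume F: "finite F"
  have h: "((\<lambda>j. \<Sum>m\<in>F. A j * B (m - j)) has_sum (\<Sum>m\<in>F. \<Sum>\<^sub>\<infinity>j. A j * B (m - j))) UNIV"
    by (rule infsum_finite_sum_swap[OF F s])
  have "((\<lambda>j. A j * infsum B UNIV) has_sum (infsum A UNIV * infsum B UNIV)) UNIV"
    by (intro has_sum_cmult_left) (use A in simp)
  moreover have "(\<Sum>m\<in>F. A j * B (m - j)) \<le> A j * infsum B UNIV" for j
  proof -
    have "(\<Sum>m\<in>F. B (m - j)) = sum B ((\<lambda>m. m - j) ` F)"
      by (subst sum.reindex) (auto simp: inj_on_def)
    also have "\<dots> \<le> infsum B UNIV"
      using F by (intro finite_sum_le_infsum B) (auto simp: nn)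
    finally show ?thesis unfolding sum_distrib_left[symmetric] by (intro mult_left_mono nn)
  qed
  ultimately show "(\<Sum>m\<in>F. \<Sum>\<^sub>\<infinity>j. A j * B (m - j)) \<le> infsum A UNIV * infsum B UNIV"
    using has_sum_mono[OF h] by blast
qed

definition wsum :: "'d::finite itself \<Rightarrow> real" where
  "wsum _ = (\<Sum>\<^sub>\<infinity>k::int^'d. wt k powr (-13/8))"

lemma wsum_nonneg: "0 \<le> wsum TYPE('d::finite)"
  unfolding wsum_def by (intro infsum_nonneg) auto

text \<open>The larger of the two weights absorbs \<open>wt k powr r\<close>. What remains of it has
  exponent at most 0, so it may be replaced by the smaller weight, which collects the total exponent
  r - s - t \<le> -13/8. Which weight is smaller depends on \<open>j\<close>, hence the sum of both
  on the right.\<close>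

lemma weight_product_le:
  fixes k j :: "int^'d"
  assumes r: "0 \<le> r" "r \<le> s" "r \<le> t" "13/8 \<le> s + t - r"
  shows "wt k powr r * (wt j powr (-s) * wt (k - j) powr (-t)) \<le>
    4 powr r * (wt j powr (-13/8) + wt (k - j) powr (-13/8))"
proof -
  have core: "max a b powr r * (a powr (-s) * b powr (-t)) \<le> b powr (-13/8)"
    if "1 \<le> b" "b \<le> a" "0 \<le> r" "r \<le> s" "13/8 \<le> s + t - r" for a b s t :: real
  proof -
    have "max a b powr r * (a powr (-s) * b powr (-t)) = a powr (r - s) * b powr (-t)"
      using that by (simp add: max_def powr_diff powr_minus field_simps)
    also have "\<dots> \<le> b powr (r - s) * b powr (-t)"
      using that by (intro mult_right_mono powr_mono2') auto
    also have "\<dots> = b powr (r - s - t)"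
      by (simp add: powr_add[symmetric])
    also have "\<dots> \<le> b powr (-13/8)"
      using that by (intro powr_mono) auto
    finally show ?thesis .
  qed
  let ?a = "wt j" and ?b = "wt (k - j)"
  have "wt k powr r \<le> (4 * max ?a ?b) powr r"
    using wt_le_max[of k j] wt_pos[of k] r by (intro powr_mono2) auto
  also have "\<dots> = 4 powr r * max ?a ?b powr r"
    using wt_pos[of j] by (intro powr_mult)
  finally have "wt k powr r * (?a powr (-s) * ?b powr (-t)) \<le>
      4 powr r * max ?a ?b powr r * (?a powr (-s) * ?b powr (-t))"
    by (intro mult_right_mono) auto
  also have "\<dots> = 4 powr r * (max ?a ?b powr r * (?a powr (-s) * ?b powr (-t)))" by simp
  also have "max ?a ?b powr r * (?a powr (-s) * ?b powr (-t)) \<le> ?a powr (-13/8) + ?b powr (-13/8)"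
  proof (cases "?b \<le> ?a")
    case True
    from core[OF wt_ge1 True r(1,2,4)] show ?thesis by (simp add: add_increasing)
  next
    case False
    then have "?a \<le> ?b" by simp
    from core[OF wt_ge1 this r(1,3), of s] r(4) have "max ?b ?a powr r * (?b powr (-t) * ?a powr (-s)) \<le> ?a powr (-13/8)"
      by (simp add: add.commute)
    then show ?thesis by (simp add: add_increasing2 max.commute mult.commute)
  qed
  finally show ?thesis by simp
qed

lemma weight_convolution_summable:
  fixes m :: "int^'d"
  assumes dim: "CARD('d) \<le> 3" and r: "0 \<le> r" "r \<le> s" "r \<le> t" "13/8 \<le> s + t - r"
  shows "(\<lambda>j. wt m powr r * (wt j powr (-s) * wt (m - j) powr (-t))) summable_on UNIV"
    and "(\<Sum>\<^sub>\<infinity>j. wt m powr r * (wt j powr (-s) * wt (m - j) powr (-t))) \<le> 2 * 4 powr r * wsum TYPE('d)"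
proof -
  note W = weight_summable[OF dim]
  have h: "((\<lambda>j. 4 powr r * (wt j powr (-13/8) + wt (m - j) powr (-13/8))) has_sum
     4 powr r * (wsum TYPE('d) + wsum TYPE('d))) UNIV"
    unfolding wsum_def
    using W summable_on_reflect[OF W, of m]
    by (intro has_sum_cmult_right has_sum_add) (auto simp: has_sum_iff)
  show s: "(\<lambda>j. wt m powr r * (wt j powr (-s) * wt (m - j) powr (-t))) summable_on UNIV"
    by (rule summable_on_comparison_test[OF has_sum_imp_summable[OF h] weight_product_le[OF r]]) auto
  show "(\<Sum>\<^sub>\<infinity>j. wt m powr r * (wt j powr (-s) * wt (m - j) powr (-t))) \<le> 2 * 4 powr r * wsum TYPE('d)"
    using has_sum_mono[OF has_sum_infsum[OF s] h weight_product_le[OF r]] by simp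
qed

lemma powr_half_square: "0 < a \<Longrightarrow> (a powr (s / 2))\<^sup>2 = (a::real) powr s"
  by (simp add: power2_eq_square flip: powr_add)

lemma fcoef_mult_norm_le:
  assumes u: "L2fun u" and v: "L2fun v"
  shows "(\<lambda>j. cmod (fcoef u j) * cmod (fcoef v (m - j))) summable_on UNIV"
    and "cmod (fcoef (\<lambda>x. u x * v x) m) \<le> (\<Sum>\<^sub>\<infinity>j. cmod (fcoef u j) * cmod (fcoef v (m - j)))"
proof -
  have V: "(\<lambda>j. (cmod (fcoef v j))\<^sup>2) summable_on UNIV" and U: "(\<lambda>j. (cmod (fcoef u j))\<^sup>2) summable_on UNIV"
    using parseval[OF u] parseval[OF v] by (auto simp: has_sum_iff)
  show s: "(\<lambda>j. cmod (fcoef u j) * cmod (fcoef v (m - j))) summable_on UNIV"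
    by (rule infsum_Cauchy_Schwarz(1)[OF _ _ U summable_on_reflect(1)[OF V]]) auto
  show "cmod (fcoef (\<lambda>x. u x * v x) m) \<le> (\<Sum>\<^sub>\<infinity>j. cmod (fcoef u j) * cmod (fcoef v (m - j)))"
    using norm_has_sum_bound[OF has_sum_infsum[OF s, folded norm_mult] fcoef_mult[OF u v]]
    by (simp add: norm_mult)
qed

text \<open>Weights given to the coefficients in \<open>?x\<close> are taken away again in
  \<open>?y\<close>. After Cauchy-Schwarz the squares of \<open>?x\<close> form an l^1 convolution
  with total at most \<open>sob s u * sob t v\<close>, while those of \<open>?y\<close> sum to at
  most a constant common to all output frequencies. The result concerns coefficients only; that the
  product lies in L^2 is a separate matter, settled for H^1 factors by the L^4 bound.\<close>

lemma sob_mult: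
  fixes u v :: "real^'d \<Rightarrow> real"
  assumes dim: "CARD('d) \<le> 3" and u: "Hs s u" and v: "Hs t v"
    and r: "0 \<le> r" "r \<le> s" "r \<le> t" "13/8 \<le> s + t - r"
  shows "(\<lambda>k. wt k powr r * (cmod (fcoef (\<lambda>x. u x * v x) k))\<^sup>2) summable_on UNIV"
    and "sob r (\<lambda>x. u x * v x) \<le> 2 * 4 powr r * wsum TYPE('d) * sob s u * sob t v"
proof -
  let ?A = "\<lambda>j. wt j powr s * (cmod (fcoef u j))\<^sup>2" and ?B = "\<lambda>j. wt j powr t * (cmod (fcoef v j))\<^sup>2"
  let ?C = "2 * 4 powr r * wsum TYPE('d)"
  have u2: "L2fun u" and v2: "L2fun v" and A: "?A summable_on UNIV" and B: "?B summable_on UNIV"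
    using u v by (auto simp: Hs_iff)
  have C0: "0 \<le> ?C" using wsum_nonneg[where 'd = 'd] by simp
  have AB: "(\<lambda>j. ?A j * ?B (m - j)) summable_on UNIV" for m
    by (rule convolution_sum_le(1)[OF _ _ A B]) auto
  have pt: "wt m powr r * (cmod (fcoef (\<lambda>x. u x * v x) m))\<^sup>2 \<le> ?C * (\<Sum>\<^sub>\<infinity>j. ?A j * ?B (m - j))" for m
  proof -
    let ?x = "\<lambda>j. (wt j powr (s/2) * cmod (fcoef u j)) * (wt (m - j) powr (t/2) * cmod (fcoef v (m - j)))"
    let ?y = "\<lambda>j. wt m powr (r/2) * (wt j powr (-s/2) * wt (m - j) powr (-t/2))"
    have x2: "(?x j)\<^sup>2 = ?A j * ?B (m - j)" for j
      by (simp add: power_mult_distrib powr_half_square[OF wt_pos])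
    have y2: "(?y j)\<^sup>2 = wt m powr r * (wt j powr (-s) * wt (m - j) powr (-t))" for j
      using powr_half_square[OF wt_pos, of j "-s"] powr_half_square[OF wt_pos, of "m-j" "-t"]
      by (simp add: power_mult_distrib powr_half_square[OF wt_pos])
    have xy: "?x j * ?y j = wt m powr (r/2) * (cmod (fcoef u j) * cmod (fcoef v (m - j)))" for j
    proof -
      have e: "wt i powr (q/2) * wt i powr (-q/2) = 1" for q and i :: "int^'d"
        using wt_pos[of i] by (simp flip: powr_add)
      have "?x j * ?y j = (wt j powr (s/2) * wt j powr (-s/2)) * (wt (m - j) powr (t/2) * wt (m - j) powr (-t/2)) *
          (wt m powr (r/2) * (cmod (fcoef u j) * cmod (fcoef v (m - j))))"
        by (simp only: mult_ac)
      then show ?thesis unfolding e by simp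
    qed
    note wc = weight_convolution_summable[OF dim r, of m]
    have cs: "(\<Sum>\<^sub>\<infinity>j. ?x j * ?y j)\<^sup>2 \<le> (\<Sum>\<^sub>\<infinity>j. (?x j)\<^sup>2) * (\<Sum>\<^sub>\<infinity>j. (?y j)\<^sup>2)"
      by (rule infsum_Cauchy_Schwarz(2)) (use wc(1) AB[of m] in \<open>simp_all only: x2 y2\<close>, auto)
    have "wt m powr r * (cmod (fcoef (\<lambda>x. u x * v x) m))\<^sup>2 =
        (wt m powr (r/2) * cmod (fcoef (\<lambda>x. u x * v x) m))\<^sup>2"
      by (simp add: power_mult_distrib powr_half_square[OF wt_pos])
    also have "\<dots> \<le> (wt m powr (r/2) * (\<Sum>\<^sub>\<infinity>j. cmod (fcoef u j) * cmod (fcoef v (m - j))))\<^sup>2"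
      by (intro power_mono mult_left_mono fcoef_mult_norm_le(2) u2 v2) auto
    also have "wt m powr (r/2) * (\<Sum>\<^sub>\<infinity>j. cmod (fcoef u j) * cmod (fcoef v (m - j))) = (\<Sum>\<^sub>\<infinity>j. ?x j * ?y j)"
      unfolding xy by (rule infsum_cmult_right'[symmetric])
    also have "(\<Sum>\<^sub>\<infinity>j. ?x j * ?y j)\<^sup>2 \<le> (\<Sum>\<^sub>\<infinity>j. ?A j * ?B (m - j)) * (\<Sum>\<^sub>\<infinity>j. wt m powr r * (wt j powr (-s) * wt (m - j) powr (-t)))"
      using cs unfolding x2 y2 .
    also have "\<dots> \<le> (\<Sum>\<^sub>\<infinity>j. ?A j * ?B (m - j)) * ?C"
      by (intro mult_left_mono wc(2) infsum_nonneg) auto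
    finally show ?thesis by (simp add: mult.commute)
  qed
  have fin: "(\<Sum>m\<in>F. wt m powr r * (cmod (fcoef (\<lambda>x. u x * v x) m))\<^sup>2) \<le> ?C * sob s u * sob t v" if "finite F" for F
  proof -
    have "(\<Sum>m\<in>F. wt m powr r * (cmod (fcoef (\<lambda>x. u x * v x) m))\<^sup>2) \<le> (\<Sum>m\<in>F. ?C * (\<Sum>\<^sub>\<infinity>j. ?A j * ?B (m - j)))"
      by (intro sum_mono pt)
    also have "\<dots> = ?C * (\<Sum>m\<in>F. \<Sum>\<^sub>\<infinity>j. ?A j * ?B (m - j))"
      by (simp add: sum_distrib_left)
    also have "\<dots> \<le> ?C * (sob s u * sob t v)"
      unfolding sob_def by (intro mult_left_mono C0 convolution_sum_le(2) A B that) auto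
    finally show ?thesis by (simp add: mult.assoc)
  qed
  show "(\<lambda>k. wt k powr r * (cmod (fcoef (\<lambda>x. u x * v x) k))\<^sup>2) summable_on UNIV"
    by (rule summable_on_bounded(1)[OF _ fin]) auto
  show "sob r (\<lambda>x. u x * v x) \<le> ?C * sob s u * sob t v"
    unfolding sob_def[of r] by (rule summable_on_bounded(2)[OF _ fin]) auto
qed

text \<open>Multiplication maps L^2 times H^1 into H^(-5/8). The target order is negative, so
  \<open>sob_mult\<close> does not apply; instead the output weight takes part in the lattice sum,
  where 5/8 + 1 is exactly the exponent 13/8.\<close>

lemma sob_mult_negative:
  fixes g u :: "real^'d \<Rightarrow> real"
  assumes dim: "CARD('d) \<le> 3" and g: "L2fun g" and u: "Hs 1 u"
  shows "(\<lambda>k. wt k powr (-5/8) * (cmod (fcoef (\<lambda>x. g x * u x) k))\<^sup>2) summable_on UNIV"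
proof -
  let ?G = "\<lambda>j. (cmod (fcoef g j))\<^sup>2" and ?B = "\<lambda>j. wt j powr 1 * (cmod (fcoef u j))\<^sup>2"
  have u2: "L2fun u" and B: "?B summable_on UNIV"
    using u by (auto simp: Hs_iff)
  have G: "?G summable_on UNIV" using parseval[OF g] by (auto simp: has_sum_iff)
  have wle: "wt j powr (-1) \<le> 1" for j :: "int^'d"
    using wt_ge1[of j] by (simp add: powr_minus field_simps)
  have GW: "(\<lambda>j. ?G j * wt (m - j) powr (-1)) summable_on UNIV" for m
    by (rule summable_on_comparison_test[OF G]) (rule mult_left_le[OF wle], auto)
  let ?b = "infsum ?B UNIV"
  have b0: "0 \<le> ?b" by (intro infsum_nonneg) auto
  have pt: "(cmod (fcoef (\<lambda>x. g x * u x) m))\<^sup>2 \<le> ?b * (\<Sum>\<^sub>\<infinity>j. ?G j * wt (m - j) powr (-1))" for m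
  proof -
    let ?x = "\<lambda>j. wt (m - j) powr (1/2) * cmod (fcoef u (m - j))"
    let ?y = "\<lambda>j. cmod (fcoef g j) * wt (m - j) powr (-1/2)"
    have x2: "(?x j)\<^sup>2 = ?B (m - j)" for j
      by (simp only: power_mult_distrib powr_half_square[OF wt_pos])
    have y2: "(?y j)\<^sup>2 = ?G j * wt (m - j) powr (-1)" for j
      using powr_half_square[OF wt_pos, of "m-j" "-1"] by (simp add: power_mult_distrib)
    have xy: "?x j * ?y j = cmod (fcoef g j) * cmod (fcoef u (m - j))" for j
    proof -
      have e: "wt i powr (1/2) * wt i powr (-1/2) = 1" for i :: "int^'d"
        using wt_pos[of i] by (simp flip: powr_add)
      have "?x j * ?y j = (wt (m - j) powr (1/2) * wt (m - j) powr (-1/2)) *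
          (cmod (fcoef g j) * cmod (fcoef u (m - j)))"
        by (simp only: mult_ac)
      then show ?thesis unfolding e by simp
    qed
    have cs: "(\<Sum>\<^sub>\<infinity>j. ?x j * ?y j)\<^sup>2 \<le> (\<Sum>\<^sub>\<infinity>j. (?x j)\<^sup>2) * (\<Sum>\<^sub>\<infinity>j. (?y j)\<^sup>2)"
      by (rule infsum_Cauchy_Schwarz(2)) (use GW[of m] summable_on_reflect(1)[OF B, of m] in \<open>simp_all only: x2 y2\<close>, auto)
    have "(cmod (fcoef (\<lambda>x. g x * u x) m))\<^sup>2 \<le> (\<Sum>\<^sub>\<infinity>j. ?x j * ?y j)\<^sup>2"
      unfolding xy by (intro power_mono fcoef_mult_norm_le(2) g u2) auto
    also have "\<dots> \<le> ?b * (\<Sum>\<^sub>\<infinity>j. ?G j * wt (m - j) powr (-1))"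
      using cs unfolding x2 y2 summable_on_reflect(2)[OF B] .
    finally show ?thesis .
  qed
  show ?thesis
  proof (rule summable_on_bounded(1)[where b = "?b * (infsum ?G UNIV * (2 * wsum TYPE('d)))"])
    fix F :: "(int^'d) set" assume F: "finite F"
    have h: "((\<lambda>j. \<Sum>m\<in>F. wt m powr (-5/8) * (?G j * wt (m - j) powr (-1))) has_sum
       (\<Sum>m\<in>F. \<Sum>\<^sub>\<infinity>j. wt m powr (-5/8) * (?G j * wt (m - j) powr (-1)))) UNIV"
      by (rule infsum_finite_sum_swap[OF F]) (intro summable_on_cmult_right GW)
    have h2: "((\<lambda>j. ?G j * (2 * wsum TYPE('d))) has_sum (infsum ?G UNIV * (2 * wsum TYPE('d)))) UNIV"
      by (intro has_sum_cmult_left) (use G in simp)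
    have le: "(\<Sum>m\<in>F. wt m powr (-5/8) * (?G j * wt (m - j) powr (-1))) \<le> ?G j * (2 * wsum TYPE('d))" for j
    proof -
      \<comment> \<open>The roles are exchanged here: the output frequency \<open>m\<close> is
        summed over and \<open>j\<close> is held fixed, which is legitimate because
        \<open>wt\<close> is even.\<close>
      note wc = weight_convolution_summable[OF dim, of 0 "5/8" 1 j]
      have sy: "wt (m - j) = wt (j - m)" for m
        unfolding wt_def by (simp add: norm_minus_commute)
      have "(\<Sum>m\<in>F. wt m powr (-5/8) * wt (m - j) powr (-1)) \<le> 2 * wsum TYPE('d)"
        using order_trans[OF finite_sum_le_infsum[OF wc(1) F] wc(2)] wt_pos[of j]
        by (simp add: sy)
      from mult_left_mono[OF this, of "?G j"] show ?thesis by (simp add: sum_distrib_left mult_ac)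
    qed
    have "(\<Sum>m\<in>F. wt m powr (-5/8) * (cmod (fcoef (\<lambda>x. g x * u x) m))\<^sup>2) \<le>
       (\<Sum>m\<in>F. wt m powr (-5/8) * (?b * (\<Sum>\<^sub>\<infinity>j. ?G j * wt (m - j) powr (-1))))"
      by (intro sum_mono mult_left_mono pt) auto
    also have "\<dots> = ?b * (\<Sum>m\<in>F. \<Sum>\<^sub>\<infinity>j. wt m powr (-5/8) * (?G j * wt (m - j) powr (-1)))"
      unfolding infsum_cmult_right' sum_distrib_left by (simp only: mult.left_commute)
    also have "\<dots> \<le> ?b * (infsum ?G UNIV * (2 * wsum TYPE('d)))"
      by (intro mult_left_mono b0 has_sum_mono[OF h h2 le])
    finally show "(\<Sum>m\<in>F. wt m powr (-5/8) * (cmod (fcoef (\<lambda>x. g x * u x) m))\<^sup>2) \<le> \<dots>" .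
  qed auto
qed

section \<open>Truncation and embeddings\<close>

definition kball :: "nat \<Rightarrow> (int^'d) set" where
  "kball N = {k. norm (kvec k) \<le> real N}"

lemma kball_comp: "k \<in> kball N \<Longrightarrow> \<bar>k $ i\<bar> \<le> int N"
  using component_le_norm_cart[of "kvec k" i] by (simp add: kball_def kvec_def)

lemma finite_kball [simp]: "finite (kball N :: (int^'d) set)"
proof (rule finite_subset[OF _ finite_int_box[of N]])
  show "kball N \<subseteq> {k :: int^'d. \<forall>i. k $ i \<in> {- int N..int N}}"
  proof clarify
    fix k :: "int^'d" and i assume "k \<in> kball N"
    from kball_comp[OF this, of i] show "k $ i \<in> {- int N..int N}" by auto
  qed
qed

lemma uminus_kball [simp]: "- k \<in> kball N \<longleftrightarrow> k \<in> kball N"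
  by (simp add: kball_def)

lemma exists_kball_superset:
  assumes "finite K" shows "\<exists>n. \<forall>m\<ge>n. K \<subseteq> kball m"
proof -
  obtain n :: nat where n: "(\<Sum>k\<in>K. norm (kvec k)) \<le> real n" using real_arch_simple by blast
  have "K \<subseteq> kball m" if "m \<ge> n" for m
  proof
    fix k assume "k \<in> K"
    then have "norm (kvec k) \<le> (\<Sum>k\<in>K. norm (kvec k))"
      using assms by (intro member_le_sum[where f = "\<lambda>k. norm (kvec k)"]) auto
    with n that show "k \<in> kball m" by (simp add: kball_def)
  qed
  then show ?thesis by blast
qed

text \<open>Meant for Hermitian coefficients, \<open>c (- k) = cnj (c k)\<close>, where the real part is redundant.\<close>

definition tpoly :: "nat \<Rightarrow> (int^'d \<Rightarrow> complex) \<Rightarrow> real^'d \<Rightarrow> real" where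
  "tpoly N c x = Re (\<Sum>k\<in>kball N. c k * ee k x)"

lemma tpoly_measurable [measurable]: "tpoly N c \<in> borel_measurable borel"
  unfolding tpoly_def by measurable

lemma tpoly_bound: "\<bar>tpoly N c x\<bar> \<le> (\<Sum>k\<in>kball N. cmod (c k))"
proof -
  have "\<bar>tpoly N c x\<bar> \<le> cmod (\<Sum>k\<in>kball N. c k * ee k x)"
    unfolding tpoly_def by (rule abs_Re_le_cmod)
  also have "\<dots> \<le> (\<Sum>k\<in>kball N. cmod (c k * ee k x))" by (rule norm_sum)
  finally show ?thesis by (simp add: norm_mult ee_simps)
qed

lemma L2fun_tpoly: "L2fun (tpoly N c)"
  by (rule L2fun_bounded[OF tpoly_measurable tpoly_bound])

lemma tpoly_eq_sum:
  assumes "\<And>k. c (- k) = cnj (c k)"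
  shows "complex_of_real (tpoly N c x) = (\<Sum>k\<in>kball N. c k * ee k x)"
proof -
  have "cnj (\<Sum>k\<in>kball N. c k * ee k x) = (\<Sum>k\<in>kball N. c (- k) * ee (- k) x)"
    by (simp add: assms ee_simps)
  also have "\<dots> = (\<Sum>k\<in>kball N. c k * ee k x)"
    by (rule sum.reindex_bij_witness[of _ uminus uminus]) auto
  finally have "(\<Sum>k\<in>kball N. c k * ee k x) \<in> \<real>"
    by (simp only: Reals_cnj_iff)
  then show ?thesis unfolding tpoly_def by (simp only: of_real_Re)
qed

lemma fcoef_tpoly:
  assumes "\<And>k. c (- k) = cnj (c k)"
  shows "fcoef (tpoly N c) k = (if k \<in> kball N then c k else 0)"
proof -
  have "has_bochner_integral cellM (\<lambda>x. \<Sum>j\<in>kball N. c j * (ee j x * cnj (ee k x))) (\<Sum>j\<in>kball N. c j * (if j = k then 1 else 0))"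
    by (intro has_bochner_integral_sum has_bochner_integral_mult_right)
       (simp only: has_bochner_integral_iff integrable_ee integral_ee_cnj)
  moreover have "(\<lambda>x. \<Sum>j\<in>kball N. c j * (ee j x * cnj (ee k x))) = (\<lambda>x. complex_of_real (tpoly N c x) * cnj (ee k x))"
    unfolding tpoly_eq_sum[of c, OF assms] by (simp add: sum_distrib_right mult.assoc)
  ultimately show ?thesis
    unfolding fcoef_eq by (simp add: has_bochner_integral_iff if_distrib[of "\<lambda>z. _ * z"] cong: if_cong)
qed

lemma sum_finite_coef:
  assumes "\<And>k. k \<notin> kball N \<Longrightarrow> g k = (0::'a::{comm_monoid_add, t2_space})"
  shows "g summable_on UNIV" "infsum g UNIV = sum g (kball N)"
  using has_sum_finite_neutralI[of "kball N" UNIV g "sum g (kball N)"] assms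
  by (auto simp: has_sum_iff)

lemma Hs_tpoly:
  assumes "\<And>k. c (- k) = cnj (c k)"
  shows "Hs s (tpoly N c)"
  unfolding Hs_iff
  by (intro conjI L2fun_tpoly sum_finite_coef(1)[of N]) (simp add: fcoef_tpoly[of c, OF assms])

lemma tpoly_in_XN:
  assumes "\<And>k. c (- k) = cnj (c k)"
  shows "tpoly N c \<in> XN N"
  using Hs_tpoly[of c 1 N, OF assms] by (auto simp: XN_def fcoef_tpoly[of c, OF assms] kball_def)

section \<open>Linear structure of the Sobolev and discrete spaces\<close>

lemma Hs_add:
  assumes "Hs s u" "Hs s v" shows "Hs s (\<lambda>x. u x + v x)"
proof -
  have u: "L2fun u" and v: "L2fun v" using assms by (auto simp: Hs_iff)
  have "(\<lambda>k. 2 * (wt k powr s * (cmod (fcoef u k))\<^sup>2) + 2 * (wt k powr s * (cmod (fcoef v k))\<^sup>2)) summable_on UNIV"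
    using assms by (intro summable_on_add summable_on_cmult_right) (auto simp: Hs_iff)
  then have "(\<lambda>k. wt k powr s * (cmod (fcoef (\<lambda>x. u x + v x) k))\<^sup>2) summable_on UNIV"
  proof (rule summable_on_comparison_test)
    fix k
    have "(cmod (fcoef u k + fcoef v k))\<^sup>2 \<le> (cmod (fcoef u k) + cmod (fcoef v k))\<^sup>2"
      by (intro power_mono norm_triangle_ineq) auto
    also have "\<dots> \<le> 2 * (cmod (fcoef u k))\<^sup>2 + 2 * (cmod (fcoef v k))\<^sup>2"
      using sum_squares_bound[of "cmod (fcoef u k)" "cmod (fcoef v k)"] by (simp add: power2_sum)
    finally show "wt k powr s * (cmod (fcoef (\<lambda>x. u x + v x) k))\<^sup>2 \<le>
       2 * (wt k powr s * (cmod (fcoef u k))\<^sup>2) + 2 * (wt k powr s * (cmod (fcoef v k))\<^sup>2)"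
      unfolding fcoef_add[OF L2fun_integrable[OF u] L2fun_integrable[OF v]]
      by (metis (no_types, opaque_lifting) distrib_left mult.left_commute mult_left_mono powr_ge_zero)
  qed auto
  then show ?thesis using L2fun_add[OF u v] by (simp add: Hs_iff)
qed

lemma Hs_cmult:
  assumes "Hs s u" shows "Hs s (\<lambda>x. c * u x)"
proof -
  have "(\<lambda>k. c\<^sup>2 * (wt k powr s * (cmod (fcoef u k))\<^sup>2)) summable_on UNIV"
    using assms by (intro summable_on_cmult_right) (auto simp: Hs_iff)
  then show ?thesis
    using assms L2fun_cmult by (auto simp: Hs_iff fcoef_cmult norm_mult power_mult_distrib mult_ac)
qed

lemma Hs_diff:
  assumes "Hs s u" "Hs s v" shows "Hs s (\<lambda>x. u x - v x)"
  using Hs_add[OF assms(1) Hs_cmult[OF assms(2), of "-1"]] by simp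

lemma Hs_mono:
  assumes "Hs s u" "t \<le> s" shows "Hs t u" "sob t u \<le> sob s u"
proof -
  have le: "wt k powr t * (cmod (fcoef u k))\<^sup>2 \<le> wt k powr s * (cmod (fcoef u k))\<^sup>2" for k
    using assms(2) wt_ge1[of k] by (intro mult_right_mono powr_mono) auto
  have s: "(\<lambda>k. wt k powr s * (cmod (fcoef u k))\<^sup>2) summable_on UNIV"
    using assms(1) by (simp add: Hs_iff)
  have "(\<lambda>k. wt k powr t * (cmod (fcoef u k))\<^sup>2) summable_on UNIV"
    by (rule summable_on_comparison_test[OF s le]) auto
  then show "Hs t u" "sob t u \<le> sob s u"
    using assms(1) le s unfolding sob_def by (auto simp: Hs_iff intro!: infsum_mono)
qed

lemma XN_add:
  assumes "u \<in> XN N" "v \<in> XN N" shows "(\<lambda>x. u x + v x) \<in> XN N"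
  using assms Hs_add[of 1 u v] fcoef_add[of u v] L2fun_integrable[of u] L2fun_integrable[of v]
  by (auto simp: XN_def Hs_iff)

lemma XN_cmult:
  assumes "u \<in> XN N" shows "(\<lambda>x. c * u x) \<in> XN N"
  using assms Hs_cmult[of 1 u c] by (auto simp: XN_def fcoef_cmult)

lemma XN_diff:
  assumes "u \<in> XN N" "v \<in> XN N" shows "(\<lambda>x. u x - v x) \<in> XN N"
  using XN_add[OF assms(1) XN_cmult[OF assms(2), of "-1"]] by simp

section \<open>Convergence of Fourier truncations and Sobolev embeddings\<close>

lemma trunc_L2_tendsto:
  fixes u :: "real^'d \<Rightarrow> real"
  assumes u: "L2fun u"
  shows "(\<lambda>n. \<integral>x. (u x - tpoly n (fcoef u) x)\<^sup>2 \<partial>cellM) \<longlonglongrightarrow> 0"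
proof -
  let ?I = "\<integral>x. (u x)\<^sup>2 \<partial>cellM"
  have "(\<integral>x. (u x - tpoly n (fcoef u) x)\<^sup>2 \<partial>cellM) = ?I - (\<Sum>k\<in>kball n. (cmod (fcoef u k))\<^sup>2)" for n
  proof -
    have "(cmod (complex_of_real (u x) - (\<Sum>k\<in>kball n. fcoef u k * ee k x)))\<^sup>2 = (u x - tpoly n (fcoef u) x)\<^sup>2" for x
      unfolding tpoly_eq_sum[of "fcoef u", OF fcoef_uminus, symmetric] of_real_diff[symmetric] norm_of_real by simp
    then show ?thesis
      using L2_distance_trig(2)[OF u finite_kball[of n], where c = "fcoef u"] by simp
  qed
  moreover have "(\<lambda>n. \<Sum>k\<in>kball n. (cmod (fcoef u k))\<^sup>2) \<longlonglongrightarrow> ?I"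
  proof (rule filterlim_compose[OF parseval[OF u, unfolded has_sum_def]])
    show "filterlim kball (finite_subsets_at_top (UNIV :: (int^'d) set)) sequentially"
      unfolding filterlim_iff eventually_finite_subsets_at_top
    proof (intro allI impI, elim exE conjE)
      fix P and X :: "(int^'d) set"
      assume "finite X" and P: "\<forall>Y. finite Y \<and> X \<subseteq> Y \<and> Y \<subseteq> UNIV \<longrightarrow> P Y"
      then obtain n where "\<forall>m\<ge>n. X \<subseteq> kball m" using exists_kball_superset by blast
      then show "\<forall>\<^sub>F m in sequentially. P (kball m)"
        using P by (auto simp: eventually_sequentially intro!: exI[of _ n])
    qed
  qed
  then have "(\<lambda>n. ?I - (\<Sum>k\<in>kball n. (cmod (fcoef u k))\<^sup>2)) \<longlonglongrightarrow> ?I - ?I"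
    by (intro tendsto_intros)
  ultimately show ?thesis by simp
qed

text \<open>Bounds uniform over all truncations pass to \<open>u\<close> by Fatou's lemma or by
  pointwise limits, and for both an almost everywhere convergent subsequence is enough.\<close>

lemma trunc_AE_subseq:
  assumes u: "L2fun u"
  obtains r :: "nat \<Rightarrow> nat" where "AE x in cellM. (\<lambda>n. tpoly (r n) (fcoef u) x) \<longlonglongrightarrow> u x"
proof -
  have "\<exists>r::nat\<Rightarrow>nat. strict_mono r \<and> (AE x in cellM. (\<lambda>n. (u x - tpoly (r n) (fcoef u) x)\<^sup>2) \<longlonglongrightarrow> 0)"
  proof (rule tendsto_L1_AE_subseq)
    show "integrable cellM (\<lambda>x. (u x - tpoly n (fcoef u) x)\<^sup>2)" for n
      using L2fun_diff[OF u L2fun_tpoly] by auto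
  qed (use trunc_L2_tendsto[OF u] in simp)
  then obtain r :: "nat \<Rightarrow> nat" where r: "AE x in cellM. (\<lambda>n. (u x - tpoly (r n) (fcoef u) x)\<^sup>2) \<longlonglongrightarrow> 0"
    by blast
  have "AE x in cellM. (\<lambda>n. tpoly (r n) (fcoef u) x) \<longlonglongrightarrow> u x"
    using r
  proof eventually_elim
    case (elim x)
    then have "(\<lambda>n. u x - tpoly (r n) (fcoef u) x) \<longlonglongrightarrow> 0" by simp
    then have "(\<lambda>n. u x - (u x - tpoly (r n) (fcoef u) x)) \<longlonglongrightarrow> u x - 0"
      by (intro tendsto_intros)
    then show ?case by simp
  qed
  then show ?thesis by (rule that)
qed

lemma sob_nonneg: "0 \<le> sob s u"
  unfolding sob_def by (intro infsum_nonneg) auto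

lemma sob_0: "L2fun u \<Longrightarrow> sob 0 u = (\<integral>x. (u x)\<^sup>2 \<partial>cellM)"
  unfolding sob_def using parseval[of u] wt_pos by (simp add: has_sum_iff less_imp_neq[OF wt_pos, symmetric])

lemma sob_trunc_le:
  assumes "Hs s u" shows "sob s (tpoly N (fcoef u)) \<le> sob s u"
  unfolding sob_def
proof (rule infsum_mono)
  show "(\<lambda>k. wt k powr s * (cmod (fcoef (tpoly N (fcoef u)) k))\<^sup>2) summable_on UNIV"
    using Hs_tpoly[of "fcoef u" s N, OF fcoef_uminus] by (simp add: Hs_iff)
qed (use assms in \<open>auto simp: Hs_iff fcoef_tpoly[of "fcoef u", OF fcoef_uminus]\<close>)

text \<open>The integral of u^4 is the squared L^2 norm of u * u, which \<open>sob_mult\<close>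
  would bound, but Parseval for u * u presupposes that it is square integrable. Truncations are
  bounded functions, so the estimate is valid for them, uniformly, and Fatou's lemma transfers
  it.\<close>

lemma H1_L4:
  fixes u :: "real^'d \<Rightarrow> real"
  assumes dim: "CARD('d) \<le> 3" and u: "Hs 1 u"
  shows "integrable cellM (\<lambda>x. (u x)^4)"
proof -
  have u2: "L2fun u" using u by (simp add: Hs_iff)
  have [measurable]: "u \<in> borel_measurable borel" using u2 by auto
  let ?p = "\<lambda>n. tpoly n (fcoef u)"
  let ?M = "2 * wsum TYPE('d) * sob 1 u * sob 1 u"
  have W: "0 \<le> wsum TYPE('d)" by (rule wsum_nonneg)
  have pm: "integrable cellM (\<lambda>x. (?p n x)^4)" "(\<integral>x. (?p n x)^4 \<partial>cellM) \<le> ?M" for n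
  proof -
    have H: "Hs 1 (?p n)" by (rule Hs_tpoly[of "fcoef u", OF fcoef_uminus])
    have L: "L2fun (\<lambda>x. ?p n x * ?p n x)"
    proof (rule L2fun_bounded)
      let ?b = "\<Sum>k\<in>kball n. cmod (fcoef u k)"
      show "\<bar>?p n x * ?p n x\<bar> \<le> ?b * ?b" for x
        unfolding abs_mult by (intro mult_mono tpoly_bound) (auto intro: sum_nonneg)
    qed measurable
    show "integrable cellM (\<lambda>x. (?p n x)^4)"
      using L2funD(2)[OF L] by (simp add: power2_eq_square power4_eq_xxxx mult.assoc)
    have "(\<integral>x. (?p n x)^4 \<partial>cellM) = sob 0 (\<lambda>x. ?p n x * ?p n x)"
      unfolding sob_0[OF L] by (simp add: power2_eq_square power4_eq_xxxx mult.assoc)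
    also have "\<dots> \<le> 2 * 4 powr 0 * wsum TYPE('d) * sob 1 (?p n) * sob 1 (?p n)"
      by (rule sob_mult(2)[OF dim H H]) auto
    also have "\<dots> \<le> 2 * 4 powr 0 * wsum TYPE('d) * sob 1 u * sob 1 u"
      using W by (intro mult_mono sob_trunc_le[OF u]) (auto intro!: mult_nonneg_nonneg sob_nonneg)
    finally show "(\<integral>x. (?p n x)^4 \<partial>cellM) \<le> ?M" by simp
  qed
  obtain r where r: "AE x in cellM. (\<lambda>n. ?p (r n) x) \<longlonglongrightarrow> u x"
    using trunc_AE_subseq[OF u2] by blast
  have "(\<integral>\<^sup>+x. ennreal ((u x)^4) \<partial>cellM) = (\<integral>\<^sup>+x. liminf (\<lambda>n. ennreal ((?p (r n) x)^4)) \<partial>cellM)"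
  proof (rule nn_integral_cong_AE, use r in eventually_elim)
    case (elim x)
    then have "(\<lambda>n. ennreal ((?p (r n) x)^4)) \<longlonglongrightarrow> ennreal ((u x)^4)"
      by (intro tendsto_ennrealI tendsto_intros)
    then show ?case by (intro lim_imp_Liminf[symmetric]) auto
  qed
  also have "\<dots> \<le> liminf (\<lambda>n. \<integral>\<^sup>+x. ennreal ((?p (r n) x)^4) \<partial>cellM)"
    by (rule nn_integral_liminf) (intro borel_measurable_cellM, measurable)
  also have "\<dots> \<le> liminf (\<lambda>n. ennreal ?M)"
  proof (rule Liminf_mono, intro always_eventually allI)
    fix n
    show "(\<integral>\<^sup>+x. ennreal ((?p (r n) x)^4) \<partial>cellM) \<le> ennreal ?M"
      using pm[of "r n"] by (subst nn_integral_eq_integral) (auto intro!: ennreal_leI)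
  qed
  also have "\<dots> < \<infinity>" by (subst Liminf_const) auto
  finally have "(\<integral>\<^sup>+x. ennreal ((u x)^4) \<partial>cellM) < \<infinity>" .
  then show ?thesis
    by (intro integrableI_nonneg borel_measurable_cellM) auto
qed

text \<open>Cauchy-Schwarz bounds the sum of |coefficients|, and with it every truncation at every
  point, because the needed exponent -2 lies below -13/8. The limit is an almost everywhere
  statement since \<open>u\<close> may be altered on a null set.\<close>

lemma H2_bounded:
  fixes u :: "real^'d \<Rightarrow> real"
  assumes dim: "CARD('d) \<le> 3" and u: "Hs 2 u"
  shows "AE x in cellM. \<bar>u x\<bar> \<le> sqrt (wsum TYPE('d) * sob 2 u)"
proof -
  have u2: "L2fun u" using u by (simp add: Hs_iff)
  let ?p = "\<lambda>n. tpoly n (fcoef u)" and ?B = "wsum TYPE('d) * sob 2 u"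
  have b: "\<bar>?p n x\<bar> \<le> sqrt ?B" for n x
  proof -
    have "(\<Sum>k\<in>kball n. cmod (fcoef u k))\<^sup>2 = (\<Sum>k\<in>kball n. wt k powr (-1) * (wt k powr 1 * cmod (fcoef u k)))\<^sup>2"
    proof -
      have "wt k powr (-1) * (wt k powr 1 * z) = z" for k :: "int^'d" and z
        using wt_pos[of k] by (simp only: mult.assoc[symmetric] powr_add[symmetric]) simp
      then show ?thesis by (simp only:)
    qed
    also have "\<dots> \<le> (\<Sum>k\<in>(kball n :: (int^'d) set). (wt k powr (-1))\<^sup>2) * (\<Sum>k\<in>kball n. (wt k powr 1 * cmod (fcoef u k))\<^sup>2)"
      by (rule Cauchy_Schwarz_ineq_sum)
    also have "\<dots> \<le> ?B"
    proof (rule mult_mono)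
      have "(\<Sum>k\<in>(kball n :: (int^'d) set). (wt k powr (-1))\<^sup>2) \<le> (\<Sum>k\<in>(kball n :: (int^'d) set). wt k powr (-13/8))"
      proof (rule sum_mono)
        fix k :: "int^'d"
        have "(wt k powr (-1))\<^sup>2 = wt k powr (-2)"
          using powr_half_square[OF wt_pos, of k "-2"] by simp
        also have "\<dots> \<le> wt k powr (-13/8)"
          using wt_ge1[of k] by (intro powr_mono) auto
        finally show "(wt k powr (-1))\<^sup>2 \<le> wt k powr (-13/8)" .
      qed
      also have "\<dots> \<le> wsum TYPE('d)"
        unfolding wsum_def by (rule finite_sum_le_infsum[OF weight_summable[OF dim]]) auto
      finally show "(\<Sum>k\<in>(kball n :: (int^'d) set). (wt k powr (-1))\<^sup>2) \<le> wsum TYPE('d)" .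
      have "(\<Sum>k\<in>kball n. (wt k powr 1 * cmod (fcoef u k))\<^sup>2) = (\<Sum>k\<in>kball n. wt k powr 2 * (cmod (fcoef u k))\<^sup>2)"
        by (simp add: power_mult_distrib powr_numeral wt_pos less_imp_le)
      also have "\<dots> \<le> sob 2 u"
        unfolding sob_def by (rule finite_sum_le_infsum) (use u in \<open>auto simp: Hs_iff\<close>)
      finally show "(\<Sum>k\<in>kball n. (wt k powr 1 * cmod (fcoef u k))\<^sup>2) \<le> sob 2 u" .
    qed (auto intro: wsum_nonneg sum_nonneg)
    finally have "(\<Sum>k\<in>kball n. cmod (fcoef u k)) \<le> sqrt ?B" by (rule real_le_rsqrt)
    then show ?thesis using tpoly_bound[of n "fcoef u" x] by linarith
  qed
  obtain r where r: "AE x in cellM. (\<lambda>n. ?p (r n) x) \<longlonglongrightarrow> u x"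
    using trunc_AE_subseq[OF u2] by blast
  then show ?thesis
  proof eventually_elim
    case (elim x)
    show ?case
      by (rule LIMSEQ_le_const2[OF tendsto_rabs[OF elim]]) (use b in auto)
  qed
qed

section \<open>Euler-Lagrange equations and regularity\<close>

lemma L2fun_mult_of_L4:
  assumes [measurable]: "u \<in> borel_measurable borel" "v \<in> borel_measurable borel"
    and "integrable cellM (\<lambda>x. (u x)^4)" "integrable cellM (\<lambda>x. (v x)^4)"
  shows "L2fun (\<lambda>x. u x * v x)"
  unfolding L2fun_iff
proof
  show "integrable cellM (\<lambda>x. (u x * v x)\<^sup>2)"
  proof (rule Bochner_Integration.integrable_bound)
    show "integrable cellM (\<lambda>x. (u x)^4 + (v x)^4)" using assms by auto
    show "(\<lambda>x. (u x * v x)\<^sup>2) \<in> borel_measurable cellM"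
      by (intro borel_measurable_cellM) measurable
    have "(a * b)\<^sup>2 \<le> a^4 + b^4" for a b :: real
    proof -
      have "2 * (a\<^sup>2 * b\<^sup>2) \<le> (a\<^sup>2)\<^sup>2 + (b\<^sup>2)\<^sup>2"
        using sum_squares_bound[of "a\<^sup>2" "b\<^sup>2"] by (simp add: mult.assoc)
      moreover have "0 \<le> a\<^sup>2 * b\<^sup>2" by simp
      ultimately have "a\<^sup>2 * b\<^sup>2 \<le> (a\<^sup>2)\<^sup>2 + (b\<^sup>2)\<^sup>2" by linarith
      then show ?thesis by (simp add: power_mult_distrib)
    qed
    then show "AE x in cellM. norm ((u x * v x)\<^sup>2) \<le> norm ((u x)^4 + (v x)^4)"
      by (intro AE_I2) (simp add: order_trans[OF _ abs_ge_self])
  qed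
qed measurable

lemma H1_mult_L2:
  fixes u v :: "real^'d \<Rightarrow> real"
  assumes dim: "CARD('d) \<le> 3" and "Hs 1 u" "Hs 1 v"
  shows "L2fun (\<lambda>x. u x * v x)"
  using assms H1_L4[OF dim] by (intro L2fun_mult_of_L4) (auto simp: Hs_iff)

section \<open>Pairings with elements of the discrete space\<close>

lemma XN_H1: "v \<in> XN N \<Longrightarrow> Hs 1 v"
  and XN_L2: "v \<in> XN N \<Longrightarrow> L2fun v"
  and XN_coef: "v \<in> XN N \<Longrightarrow> k \<notin> kball N \<Longrightarrow> fcoef v k = 0"
  by (auto simp: XN_def Hs_iff kball_def)

lemma XN_Hs: "v \<in> XN N \<Longrightarrow> Hs s v"
  unfolding Hs_iff by (intro conjI sum_finite_coef(1)[of N]) (auto simp: XN_L2 XN_coef)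

lemma XN_sob: "v \<in> XN N \<Longrightarrow> sob s v = (\<Sum>k\<in>kball N. wt k powr s * (cmod (fcoef v k))\<^sup>2)"
  unfolding sob_def by (intro sum_finite_coef(2)) (auto simp: XN_coef)

lemma grad_inner_eq: "grad_inner u v = (\<Sum>\<^sub>\<infinity>k. (wt k - 1) * Re (fcoef u k * cnj (fcoef v k)))"
  by (simp add: grad_inner_def wt_def)

text \<open>With one argument in \<open>XN N\<close> the sum is finite, so it can be manipulated
  without any summability assumption on the other argument.\<close>

lemma grad_inner_XN:
  assumes "v \<in> XN N"
  shows "grad_inner u v = (\<Sum>k\<in>kball N. (wt k - 1) * Re (fcoef u k * cnj (fcoef v k)))"
  unfolding grad_inner_eq using assms by (intro sum_finite_coef(2)) (auto simp: XN_coef)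

lemma integral_XN:
  assumes "L2fun u" "v \<in> XN N"
  shows "(\<integral>x. u x * v x \<partial>cellM) = (\<Sum>k\<in>kball N. Re (fcoef u k * cnj (fcoef v k)))"
proof -
  have "((\<lambda>k. Re (fcoef u k * cnj (fcoef v k))) has_sum Re (complex_of_real (\<integral>x. u x * v x \<partial>cellM))) UNIV"
    by (intro has_sum_Re parseval_inner assms XN_L2[OF assms(2)])
  then have "(\<integral>x. u x * v x \<partial>cellM) = (\<Sum>\<^sub>\<infinity>k. Re (fcoef u k * cnj (fcoef v k)))"
    by (simp add: has_sum_iff)
  also have "\<dots> = (\<Sum>k\<in>kball N. Re (fcoef u k * cnj (fcoef v k)))"
    using assms by (intro sum_finite_coef(2)) (auto simp: XN_coef)
  finally show ?thesis .
qed

lemma X_inner_eq: "X_inner u v = (\<integral>x. u x * v x \<partial>cellM) + grad_inner u v"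
  by (simp add: X_inner_def set_integral_cell)

lemma grad_inner_self:
  assumes "Hs 1 u"
  shows "((\<lambda>k. (wt k - 1) * (cmod (fcoef u k))\<^sup>2) has_sum grad_inner u u) UNIV"
    and "sob 1 u = (\<integral>x. (u x)\<^sup>2 \<partial>cellM) + grad_inner u u"
proof -
  have u: "L2fun u" and s: "(\<lambda>k. wt k powr 1 * (cmod (fcoef u k))\<^sup>2) summable_on UNIV"
    using assms by (auto simp: Hs_iff)
  have s': "((\<lambda>k. wt k * (cmod (fcoef u k))\<^sup>2) has_sum sob 1 u) UNIV"
    using s by (simp add: sob_def has_sum_iff abs_of_pos wt_pos)
  have e: "grad_inner u u = (\<Sum>\<^sub>\<infinity>k. (wt k - 1) * (cmod (fcoef u k))\<^sup>2)"
    unfolding grad_inner_eq by (simp add: complex_norm_square[symmetric] flip: of_real_power)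
  have h: "((\<lambda>k. wt k * (cmod (fcoef u k))\<^sup>2 + (-1) * (cmod (fcoef u k))\<^sup>2) has_sum
     sob 1 u + (-1) * (\<integral>x. (u x)\<^sup>2 \<partial>cellM)) UNIV"
    by (intro has_sum_add has_sum_cmult_right s' parseval u)
  then show "((\<lambda>k. (wt k - 1) * (cmod (fcoef u k))\<^sup>2) has_sum grad_inner u u) UNIV"
    unfolding e by (simp add: has_sum_iff algebra_simps)
  show "sob 1 u = (\<integral>x. (u x)\<^sup>2 \<partial>cellM) + grad_inner u u"
    using h unfolding e by (simp add: has_sum_iff algebra_simps)
qed

lemma H1norm_eq: "Hs 1 u \<Longrightarrow> H1norm u = sqrt (sob 1 u)"
  unfolding H1norm_def X_inner_eq grad_inner_self(2) by (simp add: power2_eq_square)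

lemma grad_inner_add_XN:
  assumes u: "Hs 1 u" and v: "v \<in> XN N"
  shows "grad_inner (\<lambda>x. u x + t * v x) (\<lambda>x. u x + t * v x) =
    grad_inner u u + 2 * t * grad_inner u v + t\<^sup>2 * grad_inner v v"
proof -
  note i = L2fun_integrable[OF XN_L2[OF v]]
  have u2: "integrable cellM u" using u by (auto simp: Hs_iff intro: L2fun_integrable)
  have c: "fcoef (\<lambda>x. u x + t * v x) k = fcoef u k + t * fcoef v k" for k
    using i u2 by (subst fcoef_add) (auto simp: fcoef_cmult)
  have hv: "((\<lambda>k. (wt k - 1) * Re (fcoef w k * cnj (fcoef v k))) has_sum grad_inner w v) UNIV" for w
    unfolding grad_inner_eq
    using sum_finite_coef(1)[of N "\<lambda>k. (wt k - 1) * Re (fcoef w k * cnj (fcoef v k))"] XN_coef[OF v] by simp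
  have hu: "((\<lambda>k. (wt k - 1) * Re (fcoef u k * cnj (fcoef u k))) has_sum grad_inner u u) UNIV"
    using grad_inner_self(1)[OF u, unfolded cmod_power2] by (simp add: power2_eq_square)
  have "((\<lambda>k. (wt k - 1) * Re (fcoef u k * cnj (fcoef u k)) + 2 * t * ((wt k - 1) * Re (fcoef u k * cnj (fcoef v k))) +
      t\<^sup>2 * ((wt k - 1) * Re (fcoef v k * cnj (fcoef v k)))) has_sum
     grad_inner u u + 2 * t * grad_inner u v + t\<^sup>2 * grad_inner v v) UNIV"
    by (intro has_sum_add has_sum_cmult_right hv hu)
  also have "(\<lambda>k. (wt k - 1) * Re (fcoef u k * cnj (fcoef u k)) + 2 * t * ((wt k - 1) * Re (fcoef u k * cnj (fcoef v k))) +
      t\<^sup>2 * ((wt k - 1) * Re (fcoef v k * cnj (fcoef v k)))) =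
     (\<lambda>k. (wt k - 1) * Re (fcoef (\<lambda>x. u x + t * v x) k * cnj (fcoef (\<lambda>x. u x + t * v x) k)))"
    by (rule ext) (simp add: c algebra_simps power2_eq_square)
  finally show ?thesis
    by (simp add: has_sum_iff grad_inner_eq)
qed

section \<open>First variation of the energy and the regularity of its minimiser\<close>

lemma Esrc_eq: "Esrc V f u = grad_inner u u / 2 + (\<integral>x. V x * (u x)\<^sup>2 \<partial>cellM) / 2
      + (\<integral>x. (u x)^4 \<partial>cellM) / 4 - (\<integral>x. f x * u x \<partial>cellM)"
  by (simp add: Esrc_def set_integral_cell)

lemma quartic_min_at_0:
  fixes A B C D :: real
  assumes "\<And>t. 0 \<le> A * t + B * t\<^sup>2 + C * t^3 + D * t^4"
  shows "A = 0"
proof (rule DERIV_local_min[where f = "\<lambda>t. A * t + B * t\<^sup>2 + C * t^3 + D * t^4" and x = 0 and d = 1])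
  show "((\<lambda>t. A * t + B * t\<^sup>2 + C * t^3 + D * t^4) has_real_derivative A) (at 0)"
    by (auto intro!: derivative_eq_intros)
qed (use assms in auto)

lemma weak_form_integrable:
  fixes u v w z V :: "real^'d \<Rightarrow> real"
  assumes dim: "CARD('d) \<le> 3" and V: "L2fun V" and u: "Hs 1 u" and v: "Hs 1 v" and w: "Hs 1 w" and z: "Hs 1 z"
  shows "integrable cellM (\<lambda>x. V x * (u x * v x))"
    and "integrable cellM (\<lambda>x. (u x * v x) * (w x * z x))"
  by (intro L2fun_mult_integrable V H1_mult_L2[OF dim] u v w z)+

text \<open>Along a line the energy is exactly a quartic polynomial in \<open>t\<close>, so its
  linear coefficient vanishes at a minimum and no differentiation under the integral is involved.
  Minimality is required only along directions in \<open>XN N\<close>, so the statement covers the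
  full and the discrete minimiser alike.\<close>

lemma euler_lagrange:
  fixes u v V f :: "real^'d \<Rightarrow> real"
  assumes dim: "CARD('d) \<le> 3" and V: "L2fun V" and f: "L2fun f" and u: "Hs 1 u" and v: "v \<in> XN N"
    and min: "\<And>t. Esrc V f u \<le> Esrc V f (\<lambda>x. u x + t * v x)"
  shows "grad_inner u v + (\<integral>x. V x * (u x * v x) \<partial>cellM) + (\<integral>x. (u x * u x) * (u x * v x) \<partial>cellM)
     - (\<integral>x. f x * v x \<partial>cellM) = 0"
proof -
  note v1 = XN_H1[OF v]
  note i = weak_form_integrable[OF dim V]
  have u2: "L2fun u" and v2: "L2fun v" using u v1 by (auto simp: Hs_iff)
  let ?A = "grad_inner u v + (\<integral>x. V x * (u x * v x) \<partial>cellM) + (\<integral>x. (u x * u x) * (u x * v x) \<partial>cellM)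
     - (\<integral>x. f x * v x \<partial>cellM)"
  let ?B = "grad_inner v v / 2 + (\<integral>x. V x * (v x * v x) \<partial>cellM) / 2 + (3/2) * (\<integral>x. (u x * v x) * (u x * v x) \<partial>cellM)"
  let ?C = "\<integral>x. (u x * v x) * (v x * v x) \<partial>cellM" and ?D = "(\<integral>x. (v x * v x) * (v x * v x) \<partial>cellM) / 4"
  have ex: "Esrc V f (\<lambda>x. u x + t * v x) = Esrc V f u + (?A * t + ?B * t\<^sup>2 + ?C * t^3 + ?D * t^4)" for t
  proof -
    have a: "(\<integral>x. V x * (u x + t * v x)\<^sup>2 \<partial>cellM) = (\<integral>x. V x * (u x * u x) \<partial>cellM) +
       2 * t * (\<integral>x. V x * (u x * v x) \<partial>cellM) + t\<^sup>2 * (\<integral>x. V x * (v x * v x) \<partial>cellM)"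
    proof -
      have "(\<integral>x. V x * (u x + t * v x)\<^sup>2 \<partial>cellM) = (\<integral>x. V x * (u x * u x) + 2 * t * (V x * (u x * v x)) + t\<^sup>2 * (V x * (v x * v x)) \<partial>cellM)"
        by (intro Bochner_Integration.integral_cong) (auto simp: power2_eq_square algebra_simps)
      then show ?thesis using i(1)[OF u u u u] i(1)[OF u v1 u u] i(1)[OF v1 v1 u u] by simp
    qed
    have b: "(\<integral>x. (u x + t * v x)^4 \<partial>cellM) = (\<integral>x. (u x * u x) * (u x * u x) \<partial>cellM) +
       4 * t * (\<integral>x. (u x * u x) * (u x * v x) \<partial>cellM) + 6 * t\<^sup>2 * (\<integral>x. (u x * v x) * (u x * v x) \<partial>cellM)
       + 4 * t^3 * ?C + t^4 * (\<integral>x. (v x * v x) * (v x * v x) \<partial>cellM)"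
    proof -
      have "(\<integral>x. (u x + t * v x)^4 \<partial>cellM) = (\<integral>x. (u x * u x) * (u x * u x) + 4 * t * ((u x * u x) * (u x * v x)) +
         6 * t\<^sup>2 * ((u x * v x) * (u x * v x)) + 4 * t^3 * ((u x * v x) * (v x * v x)) + t^4 * ((v x * v x) * (v x * v x)) \<partial>cellM)"
        by (intro Bochner_Integration.integral_cong) (auto simp: power4_eq_xxxx power3_eq_cube power2_eq_square algebra_simps)
      also have "\<dots> = (\<integral>x. (u x * u x) * (u x * u x) \<partial>cellM) + (\<integral>x. 4 * t * ((u x * u x) * (u x * v x)) \<partial>cellM) +
         (\<integral>x. 6 * t\<^sup>2 * ((u x * v x) * (u x * v x)) \<partial>cellM) + (\<integral>x. 4 * t^3 * ((u x * v x) * (v x * v x)) \<partial>cellM)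
         + (\<integral>x. t^4 * ((v x * v x) * (v x * v x)) \<partial>cellM)"
        using i(2)[OF u u u u] i(2)[OF u u u v1] i(2)[OF u v1 u v1] i(2)[OF u v1 v1 v1] i(2)[OF v1 v1 v1 v1]
        by (simp del: integral_mult_right_zero)
      finally show ?thesis by simp
    qed
    have c: "(\<integral>x. f x * (u x + t * v x) \<partial>cellM) = (\<integral>x. f x * u x \<partial>cellM) + t * (\<integral>x. f x * v x \<partial>cellM)"
    proof -
      have "(\<integral>x. f x * (u x + t * v x) \<partial>cellM) = (\<integral>x. f x * u x + t * (f x * v x) \<partial>cellM)"
        by (intro Bochner_Integration.integral_cong) (auto simp: algebra_simps)
      then show ?thesis using L2fun_mult_integrable[OF f u2] L2fun_mult_integrable[OF f v2] by simp
    qed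
    have d: "(\<integral>x. (u x)^4 \<partial>cellM) = (\<integral>x. (u x * u x) * (u x * u x) \<partial>cellM)"
      by (intro Bochner_Integration.integral_cong) (auto simp: power4_eq_xxxx)
    have e: "(\<integral>x. V x * (u x)\<^sup>2 \<partial>cellM) = (\<integral>x. V x * (u x * u x) \<partial>cellM)"
      by (simp add: power2_eq_square)
    show ?thesis
      unfolding Esrc_eq a b c d e grad_inner_add_XN[OF u v] by (simp add: field_simps)
  qed
  show ?thesis
    by (rule quartic_min_at_0[of ?A ?B ?C ?D]) (use min ex in \<open>simp add: add.assoc\<close>)
qed

text \<open>Stated for merely integrable \<open>h\<close>: before regularity is known, the products
  V u and u^3 are only seen to be integrable, so Parseval is out of reach for them.\<close>

lemma integral_mult_tpoly:
  assumes "integrable cellM h"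
  shows "(\<integral>x. h x * tpoly N c x \<partial>cellM) = Re (\<Sum>k\<in>kball N. c k * cnj (fcoef h k))"
proof -
  have h: "has_bochner_integral cellM (\<lambda>x. \<Sum>k\<in>kball N. c k * cnj (complex_of_real (h x) * cnj (ee k x))) (\<Sum>k\<in>kball N. c k * cnj (fcoef h k))"
    using fcoef_integrable[OF assms]
    by (intro has_bochner_integral_sum has_bochner_integral_mult_right has_bochner_integral_cnj)
       (simp add: has_bochner_integral_iff fcoef_eq)
  have e: "h x * tpoly N c x = Re (\<Sum>k\<in>kball N. c k * cnj (complex_of_real (h x) * cnj (ee k x)))" for x
  proof -
    have "(\<Sum>k\<in>kball N. c k * cnj (complex_of_real (h x) * cnj (ee k x))) = of_real (h x) * (\<Sum>k\<in>kball N. c k * ee k x)"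
      by (simp add: sum_distrib_left mult_ac)
    then show ?thesis unfolding tpoly_def by (simp only: Re_complex_of_real times_complex.sel Im_complex_of_real)
  qed
  show ?thesis unfolding e using integral_Re[of cellM] h by (simp add: has_bochner_integral_iff del: Re_sum)
qed

lemma coefficient_equation:
  fixes u V f :: "real^'d \<Rightarrow> real"
  assumes dim: "CARD('d) \<le> 3" and V: "L2fun V" and f: "L2fun f" and u: "Hs 1 u"
    and min: "\<And>v. Hs 1 v \<Longrightarrow> Esrc V f u \<le> Esrc V f v"
  shows "(wt k - 1) * fcoef u k = fcoef f k - fcoef (\<lambda>x. V x * u x) k - fcoef (\<lambda>x. (u x * u x) * u x) k"
proof -
  obtain N where N: "k \<in> kball N" using exists_kball_superset[of "{k}"] by auto
  have u2: "L2fun u" using u by (simp add: Hs_iff)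
  have Vu: "integrable cellM (\<lambda>x. V x * u x)" by (rule L2fun_mult_integrable[OF V u2])
  have u3: "integrable cellM (\<lambda>x. (u x * u x) * u x)"
    by (rule L2fun_mult_integrable[OF H1_mult_L2[OF dim u u] u2])
  have fi: "integrable cellM f" by (rule L2fun_integrable[OF f])
  \<comment> \<open>The residual of the claimed equation serves as its own test function: the weak
    form then becomes the sum of |d j|^2 over a ball containing \<open>k\<close>, and every term has
    to vanish.\<close>
  define d where "d j = (wt j - 1) * fcoef u j + fcoef (\<lambda>x. V x * u x) j + fcoef (\<lambda>x. (u x * u x) * u x) j - fcoef f j" for j
  have herm: "d (- j) = cnj (d j)" for j
    by (simp add: d_def fcoef_uminus wt_def)
  let ?v = "tpoly N d"
  have v: "?v \<in> XN N" by (rule tpoly_in_XN[of d, OF herm])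
  have "Hs 1 (\<lambda>x. u x + t * ?v x)" for t
    by (intro Hs_add Hs_cmult u XN_H1[OF v])
  then have "grad_inner u ?v + (\<integral>x. V x * (u x * ?v x) \<partial>cellM) + (\<integral>x. (u x * u x) * (u x * ?v x) \<partial>cellM)
     - (\<integral>x. f x * ?v x \<partial>cellM) = 0"
    by (intro euler_lagrange[OF dim V f u v] min)
  also have "(\<integral>x. V x * (u x * ?v x) \<partial>cellM) = Re (\<Sum>j\<in>kball N. d j * cnj (fcoef (\<lambda>x. V x * u x) j))"
    using integral_mult_tpoly[OF Vu, of N d] by (simp add: mult.assoc)
  also have "(\<integral>x. (u x * u x) * (u x * ?v x) \<partial>cellM) = Re (\<Sum>j\<in>kball N. d j * cnj (fcoef (\<lambda>x. (u x * u x) * u x) j))"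
    using integral_mult_tpoly[OF u3, of N d] by (simp add: mult.assoc)
  also have "(\<integral>x. f x * ?v x \<partial>cellM) = Re (\<Sum>j\<in>kball N. d j * cnj (fcoef f j))"
    by (rule integral_mult_tpoly[OF fi])
  also have "grad_inner u ?v = Re (\<Sum>j\<in>kball N. d j * cnj ((wt j - 1) * fcoef u j))"
    unfolding grad_inner_XN[OF v] fcoef_tpoly[of d, OF herm] Re_sum
    by (intro sum.cong refl) (simp add: algebra_simps)
  finally have "Re (\<Sum>j\<in>kball N. d j * cnj (d j)) = 0"
    unfolding d_def[of "_"] by (simp add: sum.distrib sum_subtractf algebra_simps)
  then have "(\<Sum>j\<in>kball N. (cmod (d j))\<^sup>2) = 0"
    by (simp add: complex_norm_square[symmetric] flip: of_real_power)
  then have "d k = 0" using N by (subst (asm) sum_nonneg_eq_0_iff) auto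
  then show ?thesis by (simp add: d_def algebra_simps)
qed

text \<open>The elliptic gain of two derivatives, read off coefficientwise: the cube in H^(-\<rho>),
  with the other terms in L^2, puts \<open>u\<close> in H^(2-\<rho>).\<close>

lemma regularity_step:
  fixes u V f :: "real^'d \<Rightarrow> real"
  assumes eq: "\<And>k. (wt k - 1) * fcoef u k = fcoef f k - fcoef (\<lambda>x. V x * u x) k - fcoef (\<lambda>x. (u x * u x) * u x) k"
    and u: "L2fun u" and f: "L2fun f" and Vu: "(\<lambda>k. (cmod (fcoef (\<lambda>x. V x * u x) k))\<^sup>2) summable_on UNIV"
    and \<rho>: "0 \<le> \<rho>" and u3: "(\<lambda>k. wt k powr (-\<rho>) * (cmod (fcoef (\<lambda>x. (u x * u x) * u x) k))\<^sup>2) summable_on UNIV"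
  shows "Hs (2 - \<rho>) u"
proof -
  let ?a = "\<lambda>k. (cmod (fcoef u k))\<^sup>2" and ?b = "\<lambda>k. (cmod (fcoef f k))\<^sup>2" and ?c = "\<lambda>k. (cmod (fcoef (\<lambda>x. V x * u x) k))\<^sup>2"
   and ?d = "\<lambda>k. (cmod (fcoef (\<lambda>x. (u x * u x) * u x) k))\<^sup>2"
  have "(\<lambda>k. 4 * (?a k + ?b k + ?c k + wt k powr (-\<rho>) * ?d k)) summable_on UNIV"
    using parseval[OF u] parseval[OF f] Vu u3
    by (intro summable_on_cmult_right summable_on_add) (auto simp: has_sum_iff)
  then have "(\<lambda>k. wt k powr (2 - \<rho>) * ?a k) summable_on UNIV"
  proof (rule summable_on_comparison_test)
    fix k :: "int^'d"
    have sq: "(p + q + r + s)\<^sup>2 \<le> 4 * (p\<^sup>2 + q\<^sup>2 + r\<^sup>2 + s\<^sup>2)" for p q r s :: real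
    proof -
      have "0 \<le> (p - q)\<^sup>2 + (p - r)\<^sup>2 + (p - s)\<^sup>2 + (q - r)\<^sup>2 + (q - s)\<^sup>2 + (r - s)\<^sup>2" by simp
      then show ?thesis by (simp add: power2_eq_square algebra_simps)
    qed
    \<comment> \<open>The symbol \<open>wt k - 1\<close> vanishes at frequency 0. Adding
      \<open>fcoef u k\<close> on both sides replaces it by the invertible \<open>wt k\<close>, at
      the cost of one more L^2 term.\<close>
    have "wt k * fcoef u k = fcoef u k + fcoef f k - fcoef (\<lambda>x. V x * u x) k - fcoef (\<lambda>x. (u x * u x) * u x) k"
      using eq[of k] by (simp add: algebra_simps)
    then have "cmod (wt k * fcoef u k) = cmod (fcoef u k + fcoef f k - fcoef (\<lambda>x. V x * u x) k - fcoef (\<lambda>x. (u x * u x) * u x) k)"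
      by simp
    also have "\<dots> \<le> cmod (fcoef u k) + cmod (fcoef f k) + cmod (fcoef (\<lambda>x. V x * u x) k) + cmod (fcoef (\<lambda>x. (u x * u x) * u x) k)"
      by (intro order_trans[OF norm_triangle_ineq4] add_right_mono norm_triangle_ineq)
    finally have "wt k * cmod (fcoef u k) \<le> cmod (fcoef u k) + cmod (fcoef f k) + cmod (fcoef (\<lambda>x. V x * u x) k) + cmod (fcoef (\<lambda>x. (u x * u x) * u x) k)"
      using wt_pos[of k] by (simp add: norm_mult)
    then have "(wt k * cmod (fcoef u k))\<^sup>2 \<le> (cmod (fcoef u k) + cmod (fcoef f k) + cmod (fcoef (\<lambda>x. V x * u x) k) + cmod (fcoef (\<lambda>x. (u x * u x) * u x) k))\<^sup>2"
      using wt_pos[of k] by (intro power_mono) auto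
    also note sq
    finally have 1: "(wt k)\<^sup>2 * ?a k \<le> 4 * (?a k + ?b k + ?c k + ?d k)"
      by (simp add: power_mult_distrib)
    have w1: "wt k powr (-\<rho>) \<le> 1"
      using powr_mono[of "-\<rho>" 0 "wt k"] \<rho> wt_ge1[of k] by simp
    have "wt k powr (2 - \<rho>) * ?a k = wt k powr (-\<rho>) * ((wt k)\<^sup>2 * ?a k)"
    proof -
      have "wt k powr (2 - \<rho>) = wt k powr (-\<rho>) * wt k powr 2"
        by (simp flip: powr_add)
      then show ?thesis using wt_pos[of k] by simp
    qed
    also have "\<dots> \<le> wt k powr (-\<rho>) * (4 * (?a k + ?b k + ?c k + ?d k))"
      by (intro mult_left_mono 1) auto
    also have "\<dots> = 4 * (wt k powr (-\<rho>) * (?a k + ?b k + ?c k) + wt k powr (-\<rho>) * ?d k)"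
      by (simp add: algebra_simps)
    also have "\<dots> \<le> 4 * (1 * (?a k + ?b k + ?c k) + wt k powr (-\<rho>) * ?d k)"
      by (intro mult_left_mono add_right_mono mult_right_mono w1) auto
    finally show "wt k powr (2 - \<rho>) * ?a k \<le> 4 * (?a k + ?b k + ?c k + wt k powr (-\<rho>) * ?d k)" by simp
  qed auto
  with u show ?thesis by (simp add: Hs_iff)
qed

text \<open>The cubic term is critical for a direct bound in \<open>L\<^sup>2\<close>, hence the detour through \<open>H\<^sup>-\<^sup>5\<^sup>/\<^sup>8\<close>:
  first \<open>u \<in> H\<^sup>1\<^sup>1\<^sup>/\<^sup>8\<close>, then \<open>u \<in> H\<^sup>2\<close>.\<close>

lemma minimizer_H2:
  fixes u V f :: "real^'d \<Rightarrow> real"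
  assumes dim: "CARD('d) \<le> 3" and V: "Hs 2 V" and f: "L2fun f" and u: "Hs 1 u"
    and min: "\<And>v. Hs 1 v \<Longrightarrow> Esrc V f u \<le> Esrc V f v"
  shows "Hs 2 u"
proof -
  have V2: "L2fun V" and u2: "L2fun u" using V u by (auto simp: Hs_iff)
  note eq = coefficient_equation[OF dim V2 f u min]
  have w0: "wt k powr 0 = 1" for k :: "int^'d" using wt_pos[of k] by simp
  have Vu: "(\<lambda>k. (cmod (fcoef (\<lambda>x. V x * u x) k))\<^sup>2) summable_on UNIV"
    using sob_mult(1)[OF dim V u, of 0] unfolding w0 by simp
  note uu = H1_mult_L2[OF dim u u]
  \<comment> \<open>The order 1/4 is what the last step needs, since 1/4 + 11/8 = 13/8; it is
    available here because 1 + 1 - 1/4 \<ge> 13/8.\<close>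
  have uuH: "Hs (1/4) (\<lambda>x. u x * u x)"
    unfolding Hs_iff using uu sob_mult(1)[OF dim u u, of "1/4"] by simp
  have "Hs (2 - 5/8) u"
    by (rule regularity_step[OF eq u2 f Vu]) (use sob_mult_negative[OF dim uu u] in auto)
  then have uH: "Hs (11/8) u" by simp
  have "Hs (2 - 0) u"
    by (rule regularity_step[OF eq u2 f Vu]) (use sob_mult(1)[OF dim uuH uH, of 0] in auto)
  then show ?thesis by simp
qed

section \<open>Error estimates\<close>

text \<open>The X inner product is diagonal in the characters with weights \<open>wt\<close>.
  Testing orthogonality with the coefficient difference itself, cut to the ball, leaves a vanishing
  sum of nonnegative terms.\<close>

lemma projection_coef:
  assumes u: "L2fun u" and p: "p \<in> XN N" and orth: "\<And>v. v \<in> XN N \<Longrightarrow> X_inner (\<lambda>x. u x - p x) v = 0"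
    and k: "k \<in> kball N"
  shows "fcoef p k = fcoef u k"
proof -
  note p2 = XN_L2[OF p]
  define c where "c j = fcoef u j - fcoef p j" for j
  have herm: "c (- j) = cnj (c j)" for j by (simp add: c_def fcoef_uminus)
  have v: "tpoly N c \<in> XN N" by (rule tpoly_in_XN[of c, OF herm])
  have d: "fcoef (\<lambda>x. u x - p x) j = c j" for j
    unfolding c_def by (intro fcoef_diff L2fun_integrable u p2)
  have "0 = X_inner (\<lambda>x. u x - p x) (tpoly N c)" using orth[OF v] by simp
  also have "\<dots> = (\<Sum>j\<in>kball N. wt j * (cmod (c j))\<^sup>2)"
    unfolding X_inner_eq integral_XN[OF L2fun_diff[OF u p2] v] grad_inner_XN[OF v] d sum.distrib[symmetric]
      fcoef_tpoly[of c, OF herm] cmod_power2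
    by (intro sum.cong refl) (simp add: power2_eq_square algebra_simps)
  finally have "wt k * (cmod (c k))\<^sup>2 = 0"
    using k by (subst (asm) eq_commute, subst (asm) sum_nonneg_eq_0_iff) (auto simp: less_imp_le[OF wt_pos])
  then show ?thesis using wt_pos[of k] by (simp add: c_def)
qed

lemma wt_ge_outside_kball:
  assumes "k \<notin> kball N" shows "(real N)\<^sup>2 \<le> wt k"
proof -
  have "(real N)\<^sup>2 \<le> (norm (kvec k))\<^sup>2"
    using assms by (intro power_mono) (auto simp: kball_def)
  also have "\<dots> \<le> (2 * pi)\<^sup>2 * (norm (kvec k))\<^sup>2"
  proof -
    have "1 \<le> 2 * pi" using pi_ge_two by linarith
    then have "1 \<le> (2 * pi)\<^sup>2" by (rule one_le_power)
    then show ?thesis using mult_right_mono[of 1 "(2*pi)\<^sup>2" "(norm (kvec k))\<^sup>2"] by simp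
  qed
  finally show ?thesis by (simp add: wt_def)
qed

text \<open>Duality between H^(-r) and H^r. Where \<open>w\<close> has nonzero coefficients,
  \<open>wt k\<close> is at least N^2, so passing from H^(-r) up to H^1 gains N^(-2(1+r)) in the
  squared norm.\<close>

lemma high_frequency_pairing:
  assumes w: "Hs 1 w" and low: "\<And>k. k \<in> kball N \<Longrightarrow> fcoef w k = 0" and h: "Hs r h"
    and r: "0 \<le> r" and N: "1 \<le> N"
  shows "\<bar>\<integral>x. w x * h x \<partial>cellM\<bar> \<le> real N powr (- (1 + r)) * sqrt (sob 1 w) * sqrt (sob r h)"
proof -
  have w2: "L2fun w" and h2: "L2fun h" using w h by (auto simp: Hs_iff)
  have W: "(\<lambda>k. wt k powr 1 * (cmod (fcoef w k))\<^sup>2) summable_on UNIV"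
    and H: "(\<lambda>k. wt k powr r * (cmod (fcoef h k))\<^sup>2) summable_on UNIV" using w h by (auto simp: Hs_iff)
  let ?n = "real N powr (- 2 * (1 + r))"
  let ?x = "\<lambda>k. wt k powr (-r/2) * cmod (fcoef w k)" and ?y = "\<lambda>k. wt k powr (r/2) * cmod (fcoef h k)"
  have y2: "(?y k)\<^sup>2 = wt k powr r * (cmod (fcoef h k))\<^sup>2" for k
    by (simp add: power_mult_distrib powr_half_square[OF wt_pos])
  have x2: "(?x k)\<^sup>2 \<le> ?n * (wt k powr 1 * (cmod (fcoef w k))\<^sup>2)" for k
  proof (cases "k \<in> kball N")
    case True
    then show ?thesis by (simp add: low)
  next
    case False
    have "wt k powr (-r) = wt k powr (-(1+r)) * wt k powr 1"
      by (simp only: powr_add[symmetric]) simp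
    also have "wt k powr (-(1+r)) \<le> ((real N)\<^sup>2) powr (-(1+r))"
      using wt_ge_outside_kball[OF False] r N by (intro powr_mono2') auto
    also have "((real N)\<^sup>2) powr (-(1+r)) = ?n"
      using N by (simp add: powr_powr flip: powr_numeral)
    finally have "wt k powr (-r) \<le> ?n * wt k powr 1" using wt_pos[of k] by simp
    then have "wt k powr (-r) * (cmod (fcoef w k))\<^sup>2 \<le> ?n * wt k powr 1 * (cmod (fcoef w k))\<^sup>2"
      by (intro mult_right_mono) auto
    then show ?thesis
      using powr_half_square[OF wt_pos, of k "-r"] by (simp add: power_mult_distrib mult.assoc)
  qed
  have X: "(\<lambda>k. (?x k)\<^sup>2) summable_on UNIV"
    by (rule summable_on_comparison_test[OF summable_on_cmult_right[OF W] x2]) auto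
  have Xle: "(\<Sum>\<^sub>\<infinity>k. (?x k)\<^sup>2) \<le> ?n * sob 1 w"
    unfolding sob_def infsum_cmult_right'[symmetric]
    by (rule infsum_mono[OF X summable_on_cmult_right[OF W] x2])
  have xy: "?x k * ?y k = cmod (fcoef w k * cnj (fcoef h k))" for k
  proof -
    have "wt k powr (-r/2) * wt k powr (r/2) = 1" using wt_pos[of k] by (simp flip: powr_add)
    then have "(wt k powr (-r/2) * wt k powr (r/2)) * (cmod (fcoef w k) * cmod (fcoef h k)) = cmod (fcoef w k * cnj (fcoef h k))"
      by (simp only: mult_1 norm_mult complex_mod_cnj)
    then show ?thesis by (simp only: mult_ac)
  qed
  note CS = infsum_Cauchy_Schwarz[of ?x ?y, OF _ _ X, unfolded y2, OF _ _ H]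
  have "(\<lambda>k. ?x k * ?y k) summable_on UNIV"
    by (rule CS(1)) auto
  then have "norm (complex_of_real (\<integral>x. w x * h x \<partial>cellM)) \<le> (\<Sum>\<^sub>\<infinity>k. ?x k * ?y k)"
    unfolding xy by (intro norm_has_sum_bound[OF _ parseval_inner[OF w2 h2]]) auto
  then have "\<bar>\<integral>x. w x * h x \<partial>cellM\<bar> \<le> (\<Sum>\<^sub>\<infinity>k. ?x k * ?y k)"
    by (simp only: norm_of_real)
  also have "\<dots> \<le> sqrt ((\<Sum>\<^sub>\<infinity>k. (?x k)\<^sup>2) * sob r h)"
    unfolding sob_def by (rule real_le_rsqrt, rule CS(2)) auto
  also have "\<dots> \<le> sqrt (?n * sob 1 w * sob r h)"
    by (intro real_sqrt_le_mono mult_right_mono Xle sob_nonneg)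
  also have "\<dots> = real N powr (- (1 + r)) * sqrt (sob 1 w) * sqrt (sob r h)"
  proof -
    have "?n = (real N powr (- (1 + r)))\<^sup>2"
      by (simp add: power2_eq_square flip: powr_add)
    then show ?thesis by (simp add: real_sqrt_mult)
  qed
  finally show ?thesis .
qed

text \<open>With one factor in H^2 the quantity s + t - r of \<open>sob_mult\<close> is 2 for every
  \<open>r\<close>, so the other factor keeps its order. The constant 32 is
  \<open>2 * 4 powr r\<close> at its largest, r = 2.\<close>

lemma Hs_mult_H2:
  fixes a b :: "real^'d \<Rightarrow> real"
  assumes dim: "CARD('d) \<le> 3" and a: "Hs 2 a" and b: "Hs r b" and r: "1 \<le> r" "r \<le> 2"
  shows "Hs r (\<lambda>x. a x * b x)" "sob r (\<lambda>x. a x * b x) \<le> 32 * wsum TYPE('d) * sob 2 a * sob r b"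
proof -
  have L: "L2fun (\<lambda>x. a x * b x)"
    by (intro H1_mult_L2[OF dim] Hs_mono(1)[OF a] Hs_mono(1)[OF b]) (use r in auto)
  show "Hs r (\<lambda>x. a x * b x)"
    unfolding Hs_iff using L sob_mult(1)[OF dim a b, of r] r by auto
  have "sob r (\<lambda>x. a x * b x) \<le> 2 * 4 powr r * wsum TYPE('d) * sob 2 a * sob r b"
    by (rule sob_mult(2)[OF dim a b]) (use r in auto)
  also have "\<dots> \<le> 2 * 4 powr 2 * wsum TYPE('d) * sob 2 a * sob r b"
    by (intro mult_right_mono mult_left_mono powr_mono sob_nonneg wsum_nonneg) (use r in auto)
  finally show "sob r (\<lambda>x. a x * b x) \<le> 32 * wsum TYPE('d) * sob 2 a * sob r b" by simp
qed

lemma sob_low_le: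
  assumes u: "Hs s u" and p: "p \<in> XN N" and pu: "\<And>k. k \<in> kball N \<Longrightarrow> fcoef p k = fcoef u k"
  shows "sob s p \<le> sob s u" "sob s (\<lambda>x. u x - p x) \<le> sob s u"
proof -
  have U: "(\<lambda>k. wt k powr s * (cmod (fcoef u k))\<^sup>2) summable_on UNIV" and u2: "L2fun u" using u by (auto simp: Hs_iff)
  have P: "Hs s p" by (rule XN_Hs[OF p])
  show "sob s p \<le> sob s u"
    unfolding sob_def
  proof (rule infsum_mono[OF _ U])
    show "wt k powr s * (cmod (fcoef p k))\<^sup>2 \<le> wt k powr s * (cmod (fcoef u k))\<^sup>2" for k
      by (cases "k \<in> kball N") (auto simp: pu XN_coef[OF p])
  qed (use P in \<open>auto simp: Hs_iff\<close>)
  show "sob s (\<lambda>x. u x - p x) \<le> sob s u"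
    unfolding sob_def
  proof (rule infsum_mono[OF _ U])
    show "wt k powr s * (cmod (fcoef (\<lambda>x. u x - p x) k))\<^sup>2 \<le> wt k powr s * (cmod (fcoef u k))\<^sup>2" for k
      unfolding fcoef_diff[OF L2fun_integrable[OF u2] L2fun_integrable[OF XN_L2[OF p]]]
      by (cases "k \<in> kball N") (auto simp: pu XN_coef[OF p])
  qed (use Hs_diff[OF u P] in \<open>auto simp: Hs_iff\<close>)
qed

text \<open>Only \<open>V\<close>, \<open>u\<close> and \<open>p\<close> multiply \<open>w\<close>,
  and truncation gives \<open>sob 2 p \<le> sob 2 u\<close>. The constant therefore depends neither
  on the discrete solution nor on \<open>N\<close>; each quadratic factor costs two applications of
  the H^2 multiplication bound.\<close>

lemma consistency_bound:
  fixes u V p v :: "real^'d \<Rightarrow> real"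
  assumes dim: "CARD('d) \<le> 3" and V: "Hs 2 V" and u: "Hs 2 u" and p: "p \<in> XN N"
    and pu: "\<And>k. k \<in> kball N \<Longrightarrow> fcoef p k = fcoef u k"
    and v: "v \<in> XN N" and r: "1 \<le> r" "r \<le> 2" and N: "1 \<le> N"
  defines "w \<equiv> \<lambda>x. u x - p x" and "C \<equiv> 32 * wsum TYPE('d)"
  shows "\<bar>(\<integral>x. w x * (V x * v x) \<partial>cellM) + (\<integral>x. w x * (u x * (u x * v x)) \<partial>cellM)
    + (\<integral>x. w x * (u x * (p x * v x)) \<partial>cellM) + (\<integral>x. w x * (p x * (p x * v x)) \<partial>cellM)\<bar> \<le>
    real N powr (- (1 + r)) * (sqrt (C * sob 2 V) + 3 * (C * sob 2 u)) * sqrt (sob 1 w) * sqrt (sob r v)"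
proof -
  have C0: "0 \<le> C" unfolding C_def using wsum_nonneg[where 'd = 'd] by simp
  have p2: "Hs 2 p" and vr: "Hs r v" by (auto intro: XN_Hs[OF p] XN_Hs[OF v])
  have w1: "Hs 1 w" unfolding w_def by (intro Hs_diff Hs_mono(1)[OF u] XN_H1[OF p]) auto
  have low: "fcoef w k = 0" if "k \<in> kball N" for k
  proof -
    have "fcoef w k = fcoef u k - fcoef p k"
      unfolding w_def using u p2 by (intro fcoef_diff L2fun_integrable) (auto simp: Hs_iff)
    then show ?thesis using pu[OF that] by simp
  qed
  let ?n = "real N powr (- (1 + r)) * sqrt (sob 1 w)"
  have n0: "0 \<le> ?n" by (simp add: sob_nonneg)
  note hf = high_frequency_pairing[OF w1 low _ _ N]
  have 1: "\<bar>\<integral>x. w x * (V x * v x) \<partial>cellM\<bar> \<le> ?n * (sqrt (C * sob 2 V) * sqrt (sob r v))"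
  proof -
    note m = Hs_mult_H2[OF dim V vr r, folded C_def]
    have "\<bar>\<integral>x. w x * (V x * v x) \<partial>cellM\<bar> \<le> ?n * sqrt (sob r (\<lambda>x. V x * v x))"
      by (rule hf[OF _ m(1)]) (use r in auto)
    also have "\<dots> \<le> ?n * sqrt (C * sob 2 V * sob r v)"
      by (intro mult_left_mono n0 real_sqrt_le_mono m(2))
    finally show ?thesis by (simp add: real_sqrt_mult)
  qed
  have 2: "\<bar>\<integral>x. w x * (a x * (b x * v x)) \<partial>cellM\<bar> \<le> ?n * (C * sob 2 u * sqrt (sob r v))"
    if a: "Hs 2 a" "sob 2 a \<le> sob 2 u" and b: "Hs 2 b" "sob 2 b \<le> sob 2 u" for a b
  proof -
    note m = Hs_mult_H2[OF dim b(1) vr r, folded C_def]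
    note m' = Hs_mult_H2[OF dim a(1) m(1) r, folded C_def]
    have "\<bar>\<integral>x. w x * (a x * (b x * v x)) \<partial>cellM\<bar> \<le> ?n * sqrt (sob r (\<lambda>x. a x * (b x * v x)))"
      by (rule hf[OF _ m'(1)]) (use r in auto)
    also have "\<dots> \<le> ?n * sqrt ((C * sob 2 u)\<^sup>2 * sob r v)"
    proof (intro mult_left_mono n0 real_sqrt_le_mono)
      note m'(2)
      also have "C * sob 2 a * sob r (\<lambda>x. b x * v x) \<le> C * sob 2 a * (C * sob 2 b * sob r v)"
        by (intro mult_left_mono m(2) mult_nonneg_nonneg C0 sob_nonneg)
      also have "\<dots> \<le> C * sob 2 u * (C * sob 2 u * sob r v)"
        using a b C0 by (intro mult_mono mult_left_mono mult_right_mono mult_nonneg_nonneg sob_nonneg) auto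
      finally show "sob r (\<lambda>x. a x * (b x * v x)) \<le> (C * sob 2 u)\<^sup>2 * sob r v"
        by (simp add: power2_eq_square mult_ac)
    qed
    finally show ?thesis using C0 by (simp add: real_sqrt_mult real_sqrt_abs abs_mult sob_nonneg)
  qed
  note pl = sob_low_le(1)[OF u p pu]
  have "\<bar>(\<integral>x. w x * (V x * v x) \<partial>cellM) + (\<integral>x. w x * (u x * (u x * v x)) \<partial>cellM)
    + (\<integral>x. w x * (u x * (p x * v x)) \<partial>cellM) + (\<integral>x. w x * (p x * (p x * v x)) \<partial>cellM)\<bar> \<le>
    ?n * (sqrt (C * sob 2 V) * sqrt (sob r v)) + ?n * (C * sob 2 u * sqrt (sob r v)) +
    ?n * (C * sob 2 u * sqrt (sob r v)) + ?n * (C * sob 2 u * sqrt (sob r v))"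
    using 1 2[OF u order_refl u order_refl] 2[OF u order_refl p2 pl] 2[OF p2 pl p2 pl] by linarith
  also have "\<dots> = real N powr (- (1 + r)) * (sqrt (C * sob 2 V) + 3 * (C * sob 2 u)) * sqrt (sob 1 w) * sqrt (sob r v)"
    by (simp add: algebra_simps)
  finally show ?thesis .
qed

text \<open>The factorisation a^3 - b^3 = (a - b)(a^2 + ab + b^2) is used twice, for the pairs u, p
  and p, un. The first factor is \<open>w\<close> in one case and \<open>e\<close> in the
  other.\<close>

lemma error_equation:
  fixes u V p un v :: "real^'d \<Rightarrow> real"
  assumes dim: "CARD('d) \<le> 3" and V: "L2fun V" and u: "Hs 1 u" and p: "p \<in> XN N" and un: "un \<in> XN N"
    and pu: "\<And>k. k \<in> kball N \<Longrightarrow> fcoef p k = fcoef u k" and v: "v \<in> XN N"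
    and ELu: "grad_inner u v + (\<integral>x. V x * (u x * v x) \<partial>cellM) + (\<integral>x. (u x * u x) * (u x * v x) \<partial>cellM) = F"
    and ELn: "grad_inner un v + (\<integral>x. V x * (un x * v x) \<partial>cellM) + (\<integral>x. (un x * un x) * (un x * v x) \<partial>cellM) = F"
  defines "w \<equiv> \<lambda>x. u x - p x" and "e \<equiv> \<lambda>x. p x - un x"
    and "W \<equiv> \<lambda>x. V x + (p x * p x + p x * un x + un x * un x)"
  shows "integrable cellM (\<lambda>x. W x * (e x * v x))"
    and "grad_inner e v + (\<integral>x. W x * (e x * v x) \<partial>cellM) =
     - ((\<integral>x. w x * (V x * v x) \<partial>cellM) + (\<integral>x. w x * (u x * (u x * v x)) \<partial>cellM)
    + (\<integral>x. w x * (u x * (p x * v x)) \<partial>cellM) + (\<integral>x. w x * (p x * (p x * v x)) \<partial>cellM))"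
proof -
  note H = u XN_H1[OF p] XN_H1[OF un] XN_H1[OF v]
  have w1: "Hs 1 w" and e1: "Hs 1 e" unfolding w_def e_def by (intro Hs_diff H)+
  note I = weak_form_integrable[OF dim V]
  have i: "integrable cellM (\<lambda>x. V x * (a x * b x))" if "Hs 1 a" "Hs 1 b" for a b :: "real^'d \<Rightarrow> real"
    by (rule I(1)[OF that that])
  have j: "integrable cellM (\<lambda>x. (a x * b x) * (c x * d x))" if "Hs 1 a" "Hs 1 b" "Hs 1 c" "Hs 1 d" for a b c d :: "real^'d \<Rightarrow> real"
    by (rule I(2)[OF that])
  have "integrable cellM (\<lambda>x. V x * (e x * v x) + ((p x * p x) * (e x * v x) + (p x * un x) * (e x * v x) + (un x * un x) * (e x * v x)))"
    by (intro Bochner_Integration.integrable_add i j H e1)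
  then show WI: "integrable cellM (\<lambda>x. W x * (e x * v x))"
    by (simp add: W_def algebra_simps)
  have j1: "integrable cellM (\<lambda>x. w x * (V x * v x))"
    using i[OF w1 H(4)] by (simp add: mult_ac)
  have j2: "integrable cellM (\<lambda>x. w x * (a x * (b x * v x)))" if "Hs 1 a" "Hs 1 b" for a b :: "real^'d \<Rightarrow> real"
    using j[OF w1 that H(4)] by (simp add: mult_ac)
  note all = WI j1 j2[OF H(1) H(1)] j2[OF H(1) H(2)] j2[OF H(2) H(2)]
  have "(\<integral>x. W x * (e x * v x) \<partial>cellM) + ((\<integral>x. w x * (V x * v x) \<partial>cellM) + (\<integral>x. w x * (u x * (u x * v x)) \<partial>cellM)
    + (\<integral>x. w x * (u x * (p x * v x)) \<partial>cellM) + (\<integral>x. w x * (p x * (p x * v x)) \<partial>cellM)) =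
    (\<integral>x. W x * (e x * v x) + (w x * (V x * v x) + w x * (u x * (u x * v x)) + w x * (u x * (p x * v x)) + w x * (p x * (p x * v x))) \<partial>cellM)"
    using all by simp
  also have "\<dots> = (\<integral>x. V x * (u x * v x) + (u x * u x) * (u x * v x) - V x * (un x * v x) - (un x * un x) * (un x * v x) \<partial>cellM)"
    by (intro Bochner_Integration.integral_cong refl) (simp add: W_def e_def w_def algebra_simps)
  also have "\<dots> = (\<integral>x. V x * (u x * v x) \<partial>cellM) + (\<integral>x. (u x * u x) * (u x * v x) \<partial>cellM) -
    (\<integral>x. V x * (un x * v x) \<partial>cellM) - (\<integral>x. (un x * un x) * (un x * v x) \<partial>cellM)"
    using i[OF H(1,4)] i[OF H(3,4)] j[OF H(1) H(1) H(1) H(4)] j[OF H(3) H(3) H(3) H(4)] by simp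
  also have "\<dots> = grad_inner un v - grad_inner u v" using ELu ELn by linarith
  \<comment> \<open>\<open>v\<close> sees only frequencies in the ball, where \<open>u\<close> and
    \<open>p\<close> have the same coefficients. So \<open>w\<close> leaves no trace in the gradient
    pairing and survives only in the multiplication terms.\<close>
  also have "\<dots> = - grad_inner e v"
  proof -
    have ec: "fcoef e k = fcoef p k - fcoef un k" for k
      unfolding e_def by (intro fcoef_diff L2fun_integrable XN_L2[OF p] XN_L2[OF un])
    show ?thesis
      unfolding grad_inner_XN[OF v] ec sum_negf[symmetric] sum_subtractf[symmetric]
      by (intro sum.cong refl) (simp add: pu algebra_simps)
  qed
  finally show "grad_inner e v + (\<integral>x. W x * (e x * v x) \<partial>cellM) =
     - ((\<integral>x. w x * (V x * v x) \<partial>cellM) + (\<integral>x. w x * (u x * (u x * v x)) \<partial>cellM)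
    + (\<integral>x. w x * (u x * (p x * v x)) \<partial>cellM) + (\<integral>x. w x * (p x * (p x * v x)) \<partial>cellM))"
    by linarith
qed

text \<open>Fixes a single \<open>N\<close>. Both equations share the functional \<open>F\<close>,
  which drops out of their difference. The constants \<open>D\<close> and \<open>lam\<close> formed
  inside mention only \<open>V\<close>, \<open>u\<close> and \<open>Vmin\<close>, so after export
  they are visibly the same for all \<open>N\<close>.\<close>

locale galerkin =
  fixes V u p un :: "real^'d \<Rightarrow> real" and Vmin :: real and N :: nat and F :: "(real^'d \<Rightarrow> real) \<Rightarrow> real"
  assumes dim: "CARD('d) \<le> 3" and V: "Hs 2 V" and u: "Hs 2 u"
    and Vmin: "0 < Vmin" and Vlow: "\<And>x. x \<in> cell \<Longrightarrow> Vmin \<le> V x"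
    and p: "p \<in> XN N" and un: "un \<in> XN N" and N: "1 \<le> N"
    and pu: "\<And>k. k \<in> kball N \<Longrightarrow> fcoef p k = fcoef u k"
    and ELu: "\<And>v. v \<in> XN N \<Longrightarrow> grad_inner u v + (\<integral>x. V x * (u x * v x) \<partial>cellM) + (\<integral>x. (u x * u x) * (u x * v x) \<partial>cellM) = F v"
    and ELn: "\<And>v. v \<in> XN N \<Longrightarrow> grad_inner un v + (\<integral>x. V x * (un x * v x) \<partial>cellM) + (\<integral>x. (un x * un x) * (un x * v x) \<partial>cellM) = F v"
begin

definition w where "w x = u x - p x"
definition e where "e x = p x - un x"
definition W where "W x = V x + (p x * p x + p x * un x + un x * un x)"
definition D where "D = sqrt (32 * wsum TYPE('d) * sob 2 V) + 3 * (32 * wsum TYPE('d) * sob 2 u)"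

lemma D_nonneg: "0 \<le> D"
  unfolding D_def by (intro add_nonneg_nonneg mult_nonneg_nonneg real_sqrt_ge_zero wsum_nonneg sob_nonneg) auto

lemma e_XN: "e \<in> XN N"
  unfolding e_def[abs_def] by (rule XN_diff[OF p un])

text \<open>Twice a^2 + ab + b^2 is (a + b)^2 + a^2 + b^2, so the nonlinearity never spoils
  coercivity, whatever the signs of \<open>p\<close> and \<open>un\<close>.\<close>

lemma W_lower: "x \<in> cell \<Longrightarrow> Vmin \<le> W x"
proof -
  assume "x \<in> cell"
  have "0 \<le> (p x + un x)\<^sup>2 + p x * p x + un x * un x" by simp
  then have "0 \<le> p x * p x + p x * un x + un x * un x"
    by (simp add: power2_eq_square algebra_simps)
  then show ?thesis using Vlow[OF \<open>x \<in> cell\<close>] by (simp add: W_def)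
qed

lemma error_functional:
  assumes v: "v \<in> XN N" and r: "1 \<le> r" "r \<le> 2"
  shows "integrable cellM (\<lambda>x. W x * (e x * v x))"
    and "grad_inner e v + (\<integral>x. W x * (e x * v x) \<partial>cellM) \<le>
      real N powr (- (1 + r)) * D * sqrt (sob 1 w) * sqrt (sob r v)"
proof -
  have V2: "L2fun V" using V by (simp add: Hs_iff)
  have u1: "Hs 1 u" by (rule Hs_mono(1)[OF u]) simp
  note defs = w_def[abs_def] e_def[abs_def] W_def[abs_def] D_def
  note eq = error_equation[OF dim V2 u1 p un pu v ELu[OF v] ELn[OF v]]
  show "integrable cellM (\<lambda>x. W x * (e x * v x))"
    unfolding defs using eq(1) by simp
  show "grad_inner e v + (\<integral>x. W x * (e x * v x) \<partial>cellM) \<le>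
      real N powr (- (1 + r)) * D * sqrt (sob 1 w) * sqrt (sob r v)"
    using consistency_bound[OF dim V u p pu v r N] eq(2) unfolding defs by simp
qed

text \<open>\<open>min 1 Vmin\<close> is the coercivity constant in the full H^1 norm: 1 from the
  gradient part and \<open>Vmin\<close> from the zeroth-order part. One factor of the norm cancels
  at the end.\<close>

lemma error_H1: "min 1 Vmin * sqrt (sob 1 e) \<le> real N powr (-2) * D * sqrt (sob 1 w)"
proof -
  let ?s = "sqrt (sob 1 e)"
  have e2: "L2fun e" and e1: "Hs 1 e" using XN_L2[OF e_XN] XN_H1[OF e_XN] .
  have g: "0 \<le> grad_inner e e"
    by (rule has_sum_nonneg[OF grad_inner_self(1)[OF e1]]) (simp add: wt_ge1)
  have "Vmin * (\<integral>x. (e x)\<^sup>2 \<partial>cellM) = (\<integral>x. Vmin * (e x)\<^sup>2 \<partial>cellM)" by simp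
  also have "\<dots> \<le> (\<integral>x. W x * (e x * e x) \<partial>cellM)"
  proof (rule integral_mono)
    show "integrable cellM (\<lambda>x. Vmin * (e x)\<^sup>2)" using L2funD(2)[OF e2] by simp
    show "integrable cellM (\<lambda>x. W x * (e x * e x))" by (rule error_functional(1)[OF e_XN, of 1]) auto
    show "Vmin * (e x)\<^sup>2 \<le> W x * (e x * e x)" if "x \<in> space cellM" for x
      unfolding power2_eq_square using that by (intro mult_right_mono W_lower) auto
  qed
  finally have 1: "Vmin * (\<integral>x. (e x)\<^sup>2 \<partial>cellM) \<le> (\<integral>x. W x * (e x * e x) \<partial>cellM)" .
  have "min 1 Vmin * sob 1 e = min 1 Vmin * grad_inner e e + min 1 Vmin * (\<integral>x. (e x)\<^sup>2 \<partial>cellM)"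
    unfolding grad_inner_self(2)[OF e1] by (simp add: algebra_simps)
  also have "\<dots> \<le> 1 * grad_inner e e + Vmin * (\<integral>x. (e x)\<^sup>2 \<partial>cellM)"
    by (intro add_mono mult_right_mono g) auto
  also have "\<dots> \<le> real N powr (-2) * D * sqrt (sob 1 w) * ?s"
    using 1 error_functional(2)[OF e_XN, of 1] by simp
  finally have "(min 1 Vmin * ?s) * ?s \<le> (real N powr (-2) * D * sqrt (sob 1 w)) * ?s"
    using sob_nonneg[of 1 e] by (simp add: mult.assoc)
  then show ?thesis
    using sob_nonneg[of 1 e] D_nonneg sob_nonneg[of 1 w]
    by (cases "?s = 0") (auto simp: mult_le_cancel_right)
qed

text \<open>Testing with \<open>v = (\<mu> - \<Delta>)\<^sup>-\<^sup>1 e\<close>: the remainder \<open>(\<mu> - W) e\<close> is absorbed because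
  \<open>0 \<le> \<mu> - W \<le> \<mu> - Vmin\<close> while the resolvent has norm at most \<open>1 / \<mu>\<close> on \<open>L\<^sup>2\<close>.\<close>

lemma error_L2:
  assumes \<mu>: "1 \<le> \<mu>" and Wle: "AE x in cellM. W x \<le> \<mu>"
  shows "(Vmin / \<mu>) * L2norm e \<le> real N powr (-3) * D * sqrt (sob 1 w)"
proof -
  let ?n = "\<integral>x. (e x)\<^sup>2 \<partial>cellM"
  have e2: "L2fun e" by (rule XN_L2[OF e_XN])
  have n0: "0 \<le> ?n" by simp
  \<comment> \<open>This is the symbol of \<mu> - \<Delta>, as \<open>wt k - 1\<close> is that of
    -\<Delta>. From \<open>\<mu> \<le> m k\<close> comes the L^2 bound on the test function; from
    \<open>wt k \<le> m k\<close>, which uses 1 \<le> \<mu>, its H^2 bound with constant 1.\<close>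
  define m where "m k = \<mu> + wt k - 1" for k :: "int^'d"
  have m: "\<mu> \<le> m k" "wt k \<le> m k" "0 < m k" for k
    using \<mu> wt_ge1[of k] by (auto simp: m_def)
  define c where "c k = fcoef e k / m k" for k
  have herm: "c (- k) = cnj (c k)" for k
    by (simp add: c_def fcoef_uminus m_def wt_def)
  define v where "v = tpoly N c"
  have v: "v \<in> XN N" unfolding v_def by (rule tpoly_in_XN[of c, OF herm])
  have v2: "L2fun v" by (rule XN_L2[OF v])
  have vc: "fcoef v k = c k" if "k \<in> kball N" for k
    unfolding v_def fcoef_tpoly[of c, OF herm] using that by simp
  have cm: "(cmod (c k))\<^sup>2 = (cmod (fcoef e k))\<^sup>2 / (m k)\<^sup>2" for k
    using m(3)[of k] by (simp add: c_def norm_divide power_divide)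
  have n_sum: "?n = (\<Sum>k\<in>kball N. (cmod (fcoef e k))\<^sup>2)"
    using integral_XN[OF e2 e_XN] unfolding cmod_power2 by (simp add: power2_eq_square)
  have v_sum: "(\<integral>x. (v x)\<^sup>2 \<partial>cellM) = (\<Sum>k\<in>kball N. (cmod (c k))\<^sup>2)"
    using integral_XN[OF v2 v] unfolding cmod_power2 by (simp add: power2_eq_square vc)
  have "(\<integral>x. (v x)\<^sup>2 \<partial>cellM) \<le> (\<Sum>k\<in>kball N. (cmod (fcoef e k))\<^sup>2 / \<mu>\<^sup>2)"
    unfolding v_sum cm using \<mu> m by (intro sum_mono divide_left_mono power_mono) (auto intro!: mult_pos_pos simp: less_imp_neq[symmetric])
  then have vle: "(\<integral>x. (v x)\<^sup>2 \<partial>cellM) \<le> ?n / \<mu>\<^sup>2"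
    unfolding n_sum by (simp add: sum_divide_distrib)
  have sob2: "sob 2 v \<le> ?n"
    unfolding XN_sob[OF v] n_sum
  proof (rule sum_mono)
    fix k :: "int^'d" assume k: "k \<in> kball N"
    have "wt k powr 2 * (cmod (fcoef v k))\<^sup>2 = (wt k / m k)\<^sup>2 * (cmod (fcoef e k))\<^sup>2"
      using wt_pos[of k] by (simp add: vc[OF k] cm power_divide)
    also have "\<dots> \<le> 1 * (cmod (fcoef e k))\<^sup>2"
      using m[of k] wt_pos[of k] by (intro mult_right_mono power_le_one) auto
    finally show "wt k powr 2 * (cmod (fcoef v k))\<^sup>2 \<le> (cmod (fcoef e k))\<^sup>2" by simp
  qed
  have a: "grad_inner e v + \<mu> * (\<integral>x. e x * v x \<partial>cellM) = ?n"
    unfolding grad_inner_XN[OF v] integral_XN[OF e2 v] n_sum sum_distrib_left sum.distrib[symmetric]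
  proof (rule sum.cong[OF refl])
    fix k :: "int^'d" assume k: "k \<in> kball N"
    have "(wt k - 1) * Re (fcoef e k * cnj (fcoef v k)) + \<mu> * Re (fcoef e k * cnj (fcoef v k)) = m k * Re (fcoef e k * cnj (c k))"
      by (simp add: vc[OF k] m_def algebra_simps)
    also have "Re (fcoef e k * cnj (c k)) = (cmod (fcoef e k))\<^sup>2 / m k"
      unfolding cmod_power2 by (simp add: c_def power2_eq_square add_divide_distrib)
    finally show "(wt k - 1) * Re (fcoef e k * cnj (fcoef v k)) + \<mu> * Re (fcoef e k * cnj (fcoef v k)) = (cmod (fcoef e k))\<^sup>2"
      using m(3)[of k] by simp
  qed
  note WI = error_functional(1)[OF v, of 2, simplified]
  note ev = L2fun_mult_integrable[OF e2 v2]
  \<comment> \<open>The upper bound on \<open>W\<close> holds only almost everywhere. The cell has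
    positive measure, so some point satisfies it together with the lower bound.\<close>
  have lv: "Vmin \<le> \<mu>"
  proof -
    have "ae_filter (cellM :: (real^'d) measure) \<noteq> bot"
      using emeasure_cellM[where 'd = 'd] by (simp add: ae_filter_eq_bot_iff)
    then obtain x where "W x \<le> \<mu>" "x \<in> cell"
      using eventually_happens'[OF _ eventually_conj[OF Wle AE_space]] by auto
    then show ?thesis using W_lower[of x] by linarith
  qed
  \<comment> \<open>The weights in this Young inequality are balanced: after inserting
    \<open>vle\<close> both terms contribute \<open>?n / (2 * \<mu>)\<close>, so the remainder is
    the fraction 1 - Vmin/\<mu> of \<open>?n\<close> and can be absorbed.\<close>
  have "(\<integral>x. \<mu> * (e x * v x) - W x * (e x * v x) \<partial>cellM) \<le> (\<integral>x. (\<mu> - Vmin) * ((e x)\<^sup>2 / (2 * \<mu>) + \<mu> / 2 * (v x)\<^sup>2) \<partial>cellM)"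
  proof (rule integral_mono_AE)
    show "integrable cellM (\<lambda>x. \<mu> * (e x * v x) - W x * (e x * v x))"
      using ev WI by simp
    show "integrable cellM (\<lambda>x. (\<mu> - Vmin) * ((e x)\<^sup>2 / (2 * \<mu>) + \<mu> / 2 * (v x)\<^sup>2))"
      using L2funD(2)[OF e2] L2funD(2)[OF v2] by simp
    show "AE x in cellM. \<mu> * (e x * v x) - W x * (e x * v x) \<le> (\<mu> - Vmin) * ((e x)\<^sup>2 / (2 * \<mu>) + \<mu> / 2 * (v x)\<^sup>2)"
      using Wle AE_space
    proof eventually_elim
      case (elim x)
      then have x: "x \<in> cell" by simp
      have "\<mu> * (e x * v x) - W x * (e x * v x) = (\<mu> - W x) * (e x * v x)" by (simp add: algebra_simps)
      also have "\<dots> \<le> (\<mu> - W x) * \<bar>e x * v x\<bar>" using elim by (intro mult_left_mono) auto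
      also have "\<dots> \<le> (\<mu> - Vmin) * \<bar>e x * v x\<bar>" using W_lower[OF x] by (intro mult_right_mono) auto
      also have "\<dots> \<le> (\<mu> - Vmin) * ((e x)\<^sup>2 / (2 * \<mu>) + \<mu> / 2 * (v x)\<^sup>2)"
      proof (intro mult_left_mono)
        have "0 \<le> (\<bar>e x\<bar> - \<mu> * \<bar>v x\<bar>)\<^sup>2" by simp
        then have "2 * \<mu> * \<bar>e x * v x\<bar> \<le> (e x)\<^sup>2 + \<mu>\<^sup>2 * (v x)\<^sup>2"
          by (simp add: power2_diff power_mult_distrib abs_mult mult_ac)
        then have "\<bar>e x * v x\<bar> \<le> ((e x)\<^sup>2 + \<mu>\<^sup>2 * (v x)\<^sup>2) / (2 * \<mu>)"
          using \<mu> by (simp add: field_simps)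
        also have "\<dots> = (e x)\<^sup>2 / (2 * \<mu>) + \<mu> / 2 * (v x)\<^sup>2"
          using \<mu> by (simp add: field_simps power2_eq_square)
        finally show "\<bar>e x * v x\<bar> \<le> (e x)\<^sup>2 / (2 * \<mu>) + \<mu> / 2 * (v x)\<^sup>2" .
      qed (use lv in simp)
      finally show ?case .
    qed
  qed
  also have "\<dots> = (\<mu> - Vmin) * (?n / (2 * \<mu>) + \<mu> / 2 * (\<integral>x. (v x)\<^sup>2 \<partial>cellM))"
    using L2funD(2)[OF e2] L2funD(2)[OF v2] by simp
  also have "\<dots> \<le> (\<mu> - Vmin) * (?n / (2 * \<mu>) + \<mu> / 2 * (?n / \<mu>\<^sup>2))"
    using lv \<mu> by (intro mult_left_mono add_left_mono vle) auto
  also have "\<dots> = ?n - (Vmin / \<mu>) * ?n"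
    using \<mu> by (simp add: field_simps power2_eq_square)
  finally have "\<mu> * (\<integral>x. e x * v x \<partial>cellM) - (\<integral>x. W x * (e x * v x) \<partial>cellM) \<le> ?n - (Vmin / \<mu>) * ?n"
    using ev WI by simp
  then have "(Vmin / \<mu>) * ?n \<le> grad_inner e v + (\<integral>x. W x * (e x * v x) \<partial>cellM)"
    using a by linarith
  also have "\<dots> \<le> real N powr (-3) * D * sqrt (sob 1 w) * sqrt (sob 2 v)"
    using error_functional(2)[OF v, of 2] by simp
  also have "\<dots> \<le> real N powr (-3) * D * sqrt (sob 1 w) * sqrt ?n"
    using D_nonneg sob_nonneg[of 1 w] by (intro mult_left_mono real_sqrt_le_mono sob2) auto
  finally have "(Vmin / \<mu> * sqrt ?n) * sqrt ?n \<le> (real N powr (-3) * D * sqrt (sob 1 w)) * sqrt ?n"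
    using n0 by (simp add: mult.assoc)
  then show ?thesis
    unfolding L2norm_eq
  proof (cases "sqrt ?n = 0")
    case True
    then show "Vmin / \<mu> * sqrt ?n \<le> real N powr (-3) * D * sqrt (sob 1 w)"
      using D_nonneg sob_nonneg[of 1 w] by simp
  next
    case False
    then have "?n \<noteq> 0" by auto
    then have "0 < ?n" using n0 by linarith
    then have "0 < sqrt ?n" by simp
    with \<open>(Vmin / \<mu> * sqrt ?n) * sqrt ?n \<le> _\<close>
    show "Vmin / \<mu> * sqrt ?n \<le> real N powr (-3) * D * sqrt (sob 1 w)"
      by (rule mult_right_le_imp_le)
  qed
qed

text \<open>The inverse inequality on \<open>XN N\<close> costs N^2 in the squared norm. The H^1
  bound squared offers N^(-4), of which N^(-2) suffices. The number 65 is 64 + 1, with 64 bounding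
  the square of 2 pi.\<close>

lemma sob_e_le: "sob 2 e \<le> 65 * (D / min 1 Vmin)\<^sup>2 * sob 1 u"
proof -
  have w1: "sob 1 w \<le> sob 1 u"
    unfolding w_def[abs_def] by (rule sob_low_le(2)[OF Hs_mono(1)[OF u] p pu]) auto
  have "sob 2 e \<le> 65 * (real N)\<^sup>2 * sob 1 e"
    unfolding XN_sob[OF e_XN] sum_distrib_left
  proof (rule sum_mono)
    fix k :: "int^'d" assume "k \<in> kball N"
    then have "(norm (kvec k))\<^sup>2 \<le> (real N)\<^sup>2" by (intro power_mono) (auto simp: kball_def)
    moreover have "(2 * pi)\<^sup>2 \<le> 64"
    proof -
      have "2 * pi \<le> 8" using pi_less_4 by linarith
      then have "(2 * pi)\<^sup>2 \<le> 8\<^sup>2" by (intro power_mono) auto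
      then show ?thesis by simp
    qed
    ultimately have "(2 * pi)\<^sup>2 * (norm (kvec k))\<^sup>2 \<le> 64 * (real N)\<^sup>2"
      by (intro mult_mono) auto
    moreover have "1 \<le> (real N)\<^sup>2" using N by simp
    ultimately have le: "wt k \<le> 65 * (real N)\<^sup>2" unfolding wt_def by linarith
    have "wt k powr 2 * (cmod (fcoef e k))\<^sup>2 = wt k * (wt k powr 1 * (cmod (fcoef e k))\<^sup>2)"
      using wt_pos[of k] by (simp add: power2_eq_square)
    also have "\<dots> \<le> 65 * (real N)\<^sup>2 * (wt k powr 1 * (cmod (fcoef e k))\<^sup>2)"
      by (intro mult_right_mono le) auto
    finally show "wt k powr 2 * (cmod (fcoef e k))\<^sup>2 \<le> 65 * (real N)\<^sup>2 * (wt k powr 1 * (cmod (fcoef e k))\<^sup>2)" .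
  qed
  also have "sob 1 e \<le> (D / min 1 Vmin)\<^sup>2 * sob 1 u / (real N)\<^sup>2"
  proof -
    have "real N powr (-2) = 1 / (real N)\<^sup>2"
      using N by (simp add: powr_minus field_simps)
    also have "\<dots> \<le> 1 / real N"
      using N by (intro divide_left_mono) (auto simp: power2_eq_square)
    finally have "real N powr (-2) \<le> 1 / real N" .
    then have "real N powr (-2) * D * sqrt (sob 1 w) \<le> (1 / real N) * D * sqrt (sob 1 u)"
      using D_nonneg w1 sob_nonneg[of 1 w] by (intro mult_mono) auto
    with error_H1 have "min 1 Vmin * sqrt (sob 1 e) \<le> (1 / real N) * D * sqrt (sob 1 u)" by linarith
    then have "sqrt (sob 1 e) \<le> (1 / real N) * D * sqrt (sob 1 u) / min 1 Vmin"
      using Vmin by (subst pos_le_divide_eq) (auto simp: mult.commute)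
    then have "sqrt (sob 1 e) \<le> (D / min 1 Vmin) * sqrt (sob 1 u) / real N"
      by (simp add: mult_ac)
    then have "(sqrt (sob 1 e))\<^sup>2 \<le> ((D / min 1 Vmin) * sqrt (sob 1 u) / real N)\<^sup>2"
      using sob_nonneg[of 1 e] by (intro power_mono) auto
    then show ?thesis using sob_nonneg[of 1 e] sob_nonneg[of 1 u]
      by (simp add: power_mult_distrib power_divide)
  qed
  finally show ?thesis using N by simp
qed

text \<open>An almost everywhere upper bound for \<open>W\<close>. The first root bounds
  \<open>V\<close>; the squared sum bounds each of the three products of \<open>p\<close> and
  \<open>un\<close>, with un = p - e controlled through \<open>sob_e_le\<close>. The final 1 secures
  \<open>1 \<le> lam\<close>, as \<open>error_L2\<close> demands of \<mu>.\<close>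

definition lam where
  "lam = sqrt (wsum TYPE('d) * sob 2 V) +
    3 * (sqrt (wsum TYPE('d) * sob 2 u) + sqrt (wsum TYPE('d) * (65 * (D / min 1 Vmin)\<^sup>2 * sob 1 u)))\<^sup>2 + 1"

lemma lam_ge1: "1 \<le> lam"
  unfolding lam_def using wsum_nonneg[where 'd = 'd] sob_nonneg[of 2 V] by simp

lemma W_le_lam: "AE x in cellM. W x \<le> lam"
proof -
  let ?B = "sqrt (wsum TYPE('d) * sob 2 u)" and ?E = "sqrt (wsum TYPE('d) * (65 * (D / min 1 Vmin)\<^sup>2 * sob 1 u))"
  have S0: "0 \<le> wsum TYPE('d)" by (rule wsum_nonneg)
  have pB: "sqrt (wsum TYPE('d) * sob 2 p) \<le> ?B"
    by (intro real_sqrt_le_mono mult_left_mono sob_low_le(1)[OF u p pu] S0)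
  have eE: "sqrt (wsum TYPE('d) * sob 2 e) \<le> ?E"
    by (intro real_sqrt_le_mono mult_left_mono sob_e_le S0)
  show ?thesis
    using H2_bounded[OF dim V] H2_bounded[OF dim XN_Hs[OF p]] H2_bounded[OF dim XN_Hs[OF e_XN]]
  proof (eventually_elim)
    case (elim x)
    let ?R = "?B + ?E"
    have E0: "0 \<le> ?E" using S0 sob_nonneg[of 1 u] by simp
    have px: "\<bar>p x\<bar> \<le> ?R" using elim pB E0 by linarith
    have ux: "\<bar>un x\<bar> \<le> ?R" using elim pB eE unfolding e_def by linarith
    have R0: "0 \<le> ?R" using px by linarith
    have "a * b \<le> ?R * ?R" if "\<bar>a\<bar> \<le> ?R" "\<bar>b\<bar> \<le> ?R" for a b
    proof -
      have "\<bar>a * b\<bar> \<le> ?R * ?R" unfolding abs_mult using that R0 by (intro mult_mono) auto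
      then show ?thesis by linarith
    qed
    from this[OF px px] this[OF px ux] this[OF ux ux] elim
    show ?case unfolding W_def lam_def power2_eq_square by linarith
  qed
qed

lemma error_bound:
  "L2norm (\<lambda>x. p x - un x) + (1 / real N) * H1norm (\<lambda>x. p x - un x) \<le> (D * lam / Vmin + D / min 1 Vmin) * (1 / real N ^ 3) * H1norm (\<lambda>x. p x - u x)"
proof -
  have w1: "Hs 1 (\<lambda>x. p x - u x)" by (intro Hs_diff XN_H1[OF p] Hs_mono(1)[OF u]) auto
  have "fcoef (\<lambda>x. p x - u x) k = - fcoef w k" for k
    using fcoef_cmult[of "-1" w k] by (simp add: w_def)
  then have H: "H1norm (\<lambda>x. p x - u x) = sqrt (sob 1 w)"
    unfolding H1norm_eq[OF w1] sob_def by simp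
  let ?s = "sqrt (sob 1 w)"
  have lam0: "0 < lam" using lam_ge1 by linarith
  have p3: "real N powr (-3) = 1 / real N ^ 3" and p2: "real N powr (-2) = 1 / real N ^ 2"
    using N by (simp_all add: powr_minus field_simps)
  have 1: "L2norm e \<le> (D * lam / Vmin) * (1 / real N ^ 3) * ?s"
  proof -
    have "L2norm e = (lam / Vmin) * ((Vmin / lam) * L2norm e)" using Vmin lam0 by simp
    also have "\<dots> \<le> (lam / Vmin) * ((1 / real N ^ 3) * D * ?s)"
      using error_L2[OF lam_ge1 W_le_lam] Vmin lam0 unfolding p3 by (intro mult_left_mono) auto
    finally show ?thesis by (simp add: mult_ac)
  qed
  have "sqrt (sob 1 e) \<le> (D / min 1 Vmin) * (1 / real N ^ 2) * ?s"
  proof -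
    have "sqrt (sob 1 e) \<le> (1 / real N ^ 2) * D * ?s / min 1 Vmin"
      using error_H1 Vmin unfolding p2 by (subst pos_le_divide_eq) (auto simp: mult.commute)
    then show ?thesis by (simp add: mult_ac)
  qed
  then have "(1 / real N) * sqrt (sob 1 e) \<le> (1 / real N) * ((D / min 1 Vmin) * (1 / real N ^ 2) * ?s)"
    by (intro mult_left_mono) auto
  also have "\<dots> = (D / min 1 Vmin) * (1 / real N ^ 3) * ?s"
    by (simp add: power3_eq_cube power2_eq_square)
  finally show ?thesis
    using 1 unfolding H e_def[abs_def, symmetric] H1norm_eq[OF XN_H1[OF e_XN]] distrib_right by linarith
qed

end

theorem theorem6p1:
  fixes V f u :: "real^'d \<Rightarrow> real" and uN p :: "nat \<Rightarrow> real^'d \<Rightarrow> real"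
    and s rv Vmin :: real
  assumes dim: "CARD('d) \<le> 3"
    and s: "s \<ge> 1" and f: "Hs s f"
    and rv: "rv \<ge> 2" and V: "Hs rv V" and Vmin: "Vmin > 0" and Vlow: "\<forall>x\<in>cell. V x \<ge> Vmin"
    and umin: "Hs 1 u" "\<forall>v. Hs 1 v \<longrightarrow> Esrc V f u \<le> Esrc V f v"
    and uNmin: "\<forall>N. uN N \<in> XN N \<and> (\<forall>v\<in>XN N. Esrc V f (uN N) \<le> Esrc V f v)"
    and proj: "\<forall>N. p N \<in> XN N \<and> (\<forall>v\<in>XN N. X_inner (\<lambda>x. u x - p N x) v = 0)"
  shows "\<exists>C N0. \<forall>N\<ge>N0.
           L2norm (\<lambda>x. p N x - uN N x) + (1 / real N) * H1norm (\<lambda>x. p N x - uN N x)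
             \<le> C * (1 / real N ^ 3) * H1norm (\<lambda>x. p N x - u x)"
proof -
  have V2: "Hs 2 V" by (rule Hs_mono(1)[OF V rv])
  have VL: "L2fun V" and fL: "L2fun f" and uL: "L2fun u" using V f umin(1) by (auto simp: Hs_iff)
  have u2: "Hs 2 u" by (rule minimizer_H2[OF dim V2 fL umin(1)]) (use umin in auto)
  let ?F = "\<lambda>v. \<integral>x. f x * v x \<partial>cellM"
  have gal: "galerkin V u (p N) (uN N) Vmin N ?F" if N: "1 \<le> N" for N
  proof
    have pN: "p N \<in> XN N" and uNN: "uN N \<in> XN N" using proj uNmin by auto
    show "fcoef (p N) k = fcoef u k" if "k \<in> kball N" for k
      by (rule projection_coef[OF uL pN _ that]) (use proj in auto)
    fix v :: "real^'d \<Rightarrow> real" assume v: "v \<in> XN N"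
    have "Esrc V f u \<le> Esrc V f (\<lambda>x. u x + t * v x)" for t
      using umin Hs_add[OF umin(1) Hs_cmult[OF XN_H1[OF v]]] by blast
    from euler_lagrange[OF dim VL fL umin(1) v this]
    show "grad_inner u v + (\<integral>x. V x * (u x * v x) \<partial>cellM) + (\<integral>x. (u x * u x) * (u x * v x) \<partial>cellM) = ?F v"
      by simp
    have "Esrc V f (uN N) \<le> Esrc V f (\<lambda>x. uN N x + t * v x)" for t
      using uNmin XN_add[OF uNN XN_cmult[OF v]] by blast
    from euler_lagrange[OF dim VL fL XN_H1[OF uNN] v this]
    show "grad_inner (uN N) v + (\<integral>x. V x * (uN N x * v x) \<partial>cellM) + (\<integral>x. (uN N x * uN N x) * (uN N x * v x) \<partial>cellM) = ?F v"
      by simp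
  qed (use dim V2 u2 Vmin Vlow proj uNmin N in auto)

  \<comment> \<open>The locale constants do not involve \<open>N\<close>, so a single witness works
    for all N \<ge> 1.\<close>
  show ?thesis
    using galerkin.error_bound[OF gal]
    by (intro exI[of _ "galerkin.D V u * galerkin.lam V u Vmin / Vmin + galerkin.D V u / min 1 Vmin"] exI[of _ 1]) blast
qed

end
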